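(* $\mathrm{SOM}(Q^{\star}_{\mathrm{Grp}}) \equiv Q^{\star}_{\mathrm{Grp}}\mathrm{FO}$. That is, for every string signature $\tau$, every sentence of $\mathrm{SOM}(Q^{\star}_{\mathrm{Grp}})[\tau]$ is equivalent over all $\tau$-string structures to a sentence of $Q^{\star}_{\mathrm{Grp}}\mathrm{FO}[\tau]$, and conversely.
   Context: Strings as structures: an alphabet is a finite linearly ordered sequence $\Sigma=(a_1,\dots,a_s)$. A nonempty string $b_0\cdots b_{n-1}$ over $\Sigma$ is identified with the structure of signature $\tau=\langle P_{a_1},\dots,P_{a_s}\rangle$ with universe $\{0,\dots,n-1\}$, where $<$ is the natural order and $P_{a_i}=\{j : b_j=a_i\}$. First-order logic FO over such structures uses $=$, $<$, the unary predicates, constants $\min=0$ and $\max=n-1$, Boolean connectives and $\exists,\forall$; SOM (monadic second-order logic) additionally has unary second-order variables and $\exists,\forall$ over them. No other built-in relations are present. Monadic second-order Lindström quantifier $Q^{\star}_L$: let $L$ be a language over $(a_1,\dots,a_s)$ and $\overline X=(X_1,\dots,X_k)$ a tuple of distinct unary second-order variables. Over a structure with universe $\{0,\dots,n-1\}$, encode an assignment $(A_1,\dots,A_k)$ by the bit string $s^1_0\cdots s^1_{n-1}s^2_0\cdots s^2_{n-1}\cdots s^k_0\cdots s^k_{n-1}$ where $s^i_j=1$ iff $j\in A_i$, and order the $2^{nk}$ assignments $\overline{A}^{(0)}<\dots<\overline{A}^{(2^{nk}-1)}$ lexicographically by code. Then $\mathcal A\models Q^{\star}_L\overline X[\varphi_1,\dots,\varphi_{s-1}]$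 iff the word of length $2^{nk}$ whose $i$-th letter is $a_j$ for the least $j\le s-1$ with $\mathcal A\models\varphi_j(\overline A^{(i)})$, and $a_s$ if there is no such $j$, belongs to $L$. A groupoid is a finite set $G$ with a binary operation having an identity element. For $S\subseteq G$, the word-problem $\mathcal W(S,G)$ is the set of words over the alphabet $G$ (in some fixed order) that can be bracketed so that they multiply out to an element of $S$. A groupoidal quantifier is a quantifier defined by a word-problem of some finite groupoid. $Q^{\star}_{\mathrm{Grp}}\mathrm{FO}$ consists of all formulas $Q^{\star}_L\overline X[\varphi_1,\dots,\varphi_{s-1}]$ with $L$ a groupoid word-problem and $\varphi_i$ first-order formulas (which may contain the set variables $\overline X$). $\mathrm{SOM}(Q^{\star}_{\mathrm{Grp}})$ is SOM closed additionally under applying $Q^{\star}_L$ ($L$ a groupoid word-problem) to arbitrary formulas of the logic, with arbitrary nesting. For logics $\mathcal L,\mathcal L'$, $\mathcal L\equiv\mathcal L'$ means that over every string signature each sentence of either logic has an equivalent sentence in the other. *)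

theory Defs
  imports Main
begin

text \<open>A string signature with alphabet (a_0,...,a_(s-1)) is represented by the number s;
 letter a_i is the natural number i. A string is a nonempty list of naturals below s.\<close>

definition is_string :: "nat \<Rightarrow> nat list \<Rightarrow> bool" where
  "is_string s w \<longleftrightarrow> w \<noteq> [] \<and> set w \<subseteq> {..<s}"

datatype trm = V nat | Mn | Mx

text \<open>Formulas. First-order variables and unary second-order (set) variables are indexed by nat.
 The constructor Qg m f S Xs phis is the monadic second-order Lindstroem quantifier
 for the word problem W(S,G) of the groupoid G = ({0..<m}, f), alphabet order 0 < 1 < ... < m-1,
 applied to the set-variable tuple Xs and the m-1 formulas phis.\<close>

datatype form =
    Eq trm trm
  | Lt trm trm
  | Pr nat trm
  | Mem nat trm
  | Neg form
  | Conj form form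
  | Disj form form
  | Ex nat form
  | All nat form
  | ExS nat form
  | AllS nat form
  | Qg nat "nat \<Rightarrow> nat \<Rightarrow> nat" "nat set" "nat list" "form list"

definition is_groupoid :: "nat \<Rightarrow> (nat \<Rightarrow> nat \<Rightarrow> nat) \<Rightarrow> bool" where
  "is_groupoid m f \<longleftrightarrow> (\<forall>x<m. \<forall>y<m. f x y < m) \<and> (\<exists>e<m. \<forall>x<m. f e x = x \<and> f x e = x)"

inductive brv :: "(nat \<Rightarrow> nat \<Rightarrow> nat) \<Rightarrow> nat list \<Rightarrow> nat \<Rightarrow> bool" for f where
  single: "brv f [a] a"
| split: "brv f u x \<Longrightarrow> brv f v y \<Longrightarrow> brv f (u @ v) (f x y)"

definition word_problem :: "nat \<Rightarrow> (nat \<Rightarrow> nat \<Rightarrow> nat) \<Rightarrow> nat set \<Rightarrow> nat list set" where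
  "word_problem m f S = {w. set w \<subseteq> {..<m} \<and> (\<exists>g\<in>S. brv f w g)}"

fun tval :: "nat list \<Rightarrow> (nat \<Rightarrow> nat) \<Rightarrow> trm \<Rightarrow> nat" where
  "tval w fo (V i) = fo i"
| "tval w fo Mn = 0"
| "tval w fo Mx = length w - 1"

text \<open>The i-th assignment (in the lexicographic order of codes) to a k-tuple of subsets of
 {0..<n}: bit number p (counted from the left, 0-based) of the code of length n*k is the
 binary digit of i of weight 2^(n*k-1-p); the l-th set (0-based) occupies positions l*n+j.\<close>
definition asg :: "nat \<Rightarrow> nat \<Rightarrow> nat \<Rightarrow> nat \<Rightarrow> nat set" where
  "asg n k i l = {j. j < n \<and> odd (i div 2 ^ (n * k - 1 - (l * n + j)))}"

definition upd_sets :: "(nat \<Rightarrow> nat set) \<Rightarrow> nat list \<Rightarrow> nat set list \<Rightarrow> (nat \<Rightarrow> nat set)" where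
  "upd_sets so Xs As = fold (\<lambda>(X, A) so. so(X := A)) (zip Xs As) so"

definition first_true :: "bool list \<Rightarrow> nat" where
  "first_true bs = length (takeWhile Not bs)"

fun sat :: "nat list \<Rightarrow> (nat \<Rightarrow> nat) \<Rightarrow> (nat \<Rightarrow> nat set) \<Rightarrow> form \<Rightarrow> bool" where
  "sat w fo so (Eq t u) = (tval w fo t = tval w fo u)"
| "sat w fo so (Lt t u) = (tval w fo t < tval w fo u)"
| "sat w fo so (Pr a t) = (tval w fo t < length w \<and> w ! tval w fo t = a)"
| "sat w fo so (Mem X t) = (tval w fo t \<in> so X)"
| "sat w fo so (Neg \<phi>) = (\<not> sat w fo so \<phi>)"
| "sat w fo so (Conj \<phi> \<psi>) = (sat w fo so \<phi> \<and> sat w fo so \<psi>)"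
| "sat w fo so (Disj \<phi> \<psi>) = (sat w fo so \<phi> \<or> sat w fo so \<psi>)"
| "sat w fo so (Ex x \<phi>) = (\<exists>a<length w. sat w (fo(x := a)) so \<phi>)"
| "sat w fo so (All x \<phi>) = (\<forall>a<length w. sat w (fo(x := a)) so \<phi>)"
| "sat w fo so (ExS X \<phi>) = (\<exists>A\<subseteq>{..<length w}. sat w fo (so(X := A)) \<phi>)"
| "sat w fo so (AllS X \<phi>) = (\<forall>A\<subseteq>{..<length w}. sat w fo (so(X := A)) \<phi>)"
| "sat w fo so (Qg m f S Xs \<phi>s) =
     (map (\<lambda>i. first_true
                 (map (\<lambda>\<phi>. sat w fo
                          (upd_sets so Xs (map (asg (length w) (length Xs) i) [0..<length Xs])) \<phi>)
                      \<phi>s))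
          [0..<2 ^ (length w * length Xs)]
      \<in> word_problem m f S)"

fun tvars :: "trm \<Rightarrow> nat set" where
  "tvars (V i) = {i}" | "tvars Mn = {}" | "tvars Mx = {}"

fun fvars :: "form \<Rightarrow> nat set" where
  "fvars (Eq t u) = tvars t \<union> tvars u"
| "fvars (Lt t u) = tvars t \<union> tvars u"
| "fvars (Pr a t) = tvars t"
| "fvars (Mem X t) = tvars t"
| "fvars (Neg \<phi>) = fvars \<phi>"
| "fvars (Conj \<phi> \<psi>) = fvars \<phi> \<union> fvars \<psi>"
| "fvars (Disj \<phi> \<psi>) = fvars \<phi> \<union> fvars \<psi>"
| "fvars (Ex x \<phi>) = fvars \<phi> - {x}"
| "fvars (All x \<phi>) = fvars \<phi> - {x}"
| "fvars (ExS X \<phi>) = fvars \<phi>"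
| "fvars (AllS X \<phi>) = fvars \<phi>"
| "fvars (Qg m f S Xs \<phi>s) = (\<Union>\<phi>\<in>set \<phi>s. fvars \<phi>)"

fun svars :: "form \<Rightarrow> nat set" where
  "svars (Eq t u) = {}"
| "svars (Lt t u) = {}"
| "svars (Pr a t) = {}"
| "svars (Mem X t) = {X}"
| "svars (Neg \<phi>) = svars \<phi>"
| "svars (Conj \<phi> \<psi>) = svars \<phi> \<union> svars \<psi>"
| "svars (Disj \<phi> \<psi>) = svars \<phi> \<union> svars \<psi>"
| "svars (Ex x \<phi>) = svars \<phi>"
| "svars (All x \<phi>) = svars \<phi>"
| "svars (ExS X \<phi>) = svars \<phi> - {X}"
| "svars (AllS X \<phi>) = svars \<phi> - {X}"
| "svars (Qg m f S Xs \<phi>s) = (\<Union>\<phi>\<in>set \<phi>s. svars \<phi>) - set Xs"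

definition sentence :: "form \<Rightarrow> bool" where
  "sentence \<phi> \<longleftrightarrow> fvars \<phi> = {} \<and> svars \<phi> = {}"

fun wf :: "nat \<Rightarrow> form \<Rightarrow> bool" where
  "wf s (Eq t u) = True"
| "wf s (Lt t u) = True"
| "wf s (Pr a t) = (a < s)"
| "wf s (Mem X t) = True"
| "wf s (Neg \<phi>) = wf s \<phi>"
| "wf s (Conj \<phi> \<psi>) = (wf s \<phi> \<and> wf s \<psi>)"
| "wf s (Disj \<phi> \<psi>) = (wf s \<phi> \<and> wf s \<psi>)"
| "wf s (Ex x \<phi>) = wf s \<phi>"
| "wf s (All x \<phi>) = wf s \<phi>"
| "wf s (ExS X \<phi>) = wf s \<phi>"
| "wf s (AllS X \<phi>) = wf s \<phi>"
| "wf s (Qg m f S Xs \<phi>s) =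
     (is_groupoid m f \<and> S \<subseteq> {..<m} \<and> Xs \<noteq> [] \<and> distinct Xs \<and> length \<phi>s = m - 1
      \<and> (\<forall>\<phi>\<in>set \<phi>s. wf s \<phi>))"

fun is_fo :: "form \<Rightarrow> bool" where
  "is_fo (Neg \<phi>) = is_fo \<phi>"
| "is_fo (Conj \<phi> \<psi>) = (is_fo \<phi> \<and> is_fo \<psi>)"
| "is_fo (Disj \<phi> \<psi>) = (is_fo \<phi> \<and> is_fo \<psi>)"
| "is_fo (Ex x \<phi>) = is_fo \<phi>"
| "is_fo (All x \<phi>) = is_fo \<phi>"
| "is_fo (ExS X \<phi>) = False"
| "is_fo (AllS X \<phi>) = False"
| "is_fo (Qg m f S Xs \<phi>s) = False"
| "is_fo _ = True"

definition SOM_Grp_sentence :: "nat \<Rightarrow> form \<Rightarrow> bool" where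
  "SOM_Grp_sentence s \<phi> \<longleftrightarrow> wf s \<phi> \<and> sentence \<phi>"

definition QGrpFO_sentence :: "nat \<Rightarrow> form \<Rightarrow> bool" where
  "QGrpFO_sentence s \<phi> \<longleftrightarrow> wf s \<phi> \<and> sentence \<phi> \<and>
     (\<exists>m f S Xs \<phi>s. \<phi> = Qg m f S Xs \<phi>s \<and> (\<forall>\<psi>\<in>set \<phi>s. is_fo \<psi>))"

definition models :: "nat list \<Rightarrow> form \<Rightarrow> bool" where
  "models w \<phi> \<longleftrightarrow> sat w (\<lambda>_. 0) (\<lambda>_. {}) \<phi>"

definition equiv_over :: "nat \<Rightarrow> form \<Rightarrow> form \<Rightarrow> bool" where
  "equiv_over s \<phi> \<psi> \<longleftrightarrow> (\<forall>w. is_string s w \<longrightarrow> (models w \<phi> \<longleftrightarrow> models w \<psi>))"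

end

theory Submission
  imports Defs
begin

text \<open>Only one direction needs work. A formula is translated, by induction, into a proof system: its configurations
are tuples of sets, read as numbers below \<open>2 ^ (n * k)\<close>, its rules ``conclude \<open>z\<close> from \<open>x\<close> and \<open>y\<close>'' are
first-order definable, and every provable configuration has a proof of size \<open>2 ^ O(n)\<close>. Provability in such
systems is closed under the positive connectives, existential quantifiers and, by a CYK-style system, under
groupoidal quantifiers. For negation we use inductive counting: clocks stratify the provable configurations by
time; if the number of pairs of provable configurations below a time bound is known, then the unprovability of a
configuration just above the bound is certified by exhibiting that many provable pairs, none of which is a pair
of premises for it. Hence the number for the next bound can be certified as well.

Finally, provability is expressed by one groupoidal quantifier. The word it reads consists of \<open>2 ^ O(n)\<close> copies of
the list of all rule instances, each instance written as a skippable block that pops (the bits of) \<open>z\<close> and pushes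
\<open>y\<close> and \<open>x\<close>. That some choice of blocks empties the stack is a fixed context-free property of this word. The
multiplication of sets of nonterminals turns a context-free grammar into a groupoid, and letters without meaning
become its neutral element.\<close>

subsection \<open>Numbers encoded by tuples of sets\<close>

text \<open>A groupoidal word problem is context-free, so one quantifier can do what a pushdown
  automaton does on a word of length \<open>2 ^ (n * k)\<close>. Proofs of size
  \<open>2 ^ O(n)\<close> over configurations of \<open>O(n)\<close> bits are the matching notion of
  tree-shaped computation, and every construction has to stay within these bounds. The obstacle is
  negation: inspecting all candidate proofs would be doubly exponential, and dualising the rules
  would turn the choice of premises into a universal quantifier. Counting avoids both, since a count
  is certified by one linear pass over the candidates. Pairs are counted because a rule has two
  premises: the absence of a fitting pair must be visible in a single pass. Since numbers are given
  by sets and rules by first-order formulas, the arithmetic of the rules is kept to comparison,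
  successor and extreme values; sizes are therefore tracked by start and end times and not by sums.
  Oracles make the constructions modular: a system may cite relations already known to be definable,
  and replacing the citations by proofs costs only a factor \<open>2 ^ O(n)\<close>.\<close>

definition dv :: "nat \<Rightarrow> nat list \<Rightarrow> nat" where
  "dv B ds = foldl (\<lambda>a d. a * B + d) 0 ds"

lemma foldl_dv: "foldl (\<lambda>a d. a * B + d) (x::nat) ds = x * B ^ length ds + foldl (\<lambda>a d. a * B + d) 0 ds"
proof (induction ds rule: rev_induct)
  case (snoc d ds)
  show ?case unfolding foldl_append foldl_Cons foldl_Nil by (subst snoc.IH) (simp add: algebra_simps)
qed simp

lemma dv_Nil [simp]: "dv B [] = 0"
  by (simp add: dv_def)

lemma dv_append: "dv B (xs @ ys) = dv B xs * B ^ length ys + dv B ys"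
  unfolding dv_def foldl_append by (rule foldl_dv)

lemma dv_single [simp]: "dv B [d] = d"
  by (simp add: dv_def)

lemma dv_Cons: "dv B (d # ds) = d * B ^ length ds + dv B ds"
  using dv_append[of B "[d]" ds] by simp

lemma dv_bound: "\<forall>d\<in>set ds. d < B \<Longrightarrow> dv B ds < B ^ length ds"
proof (induction ds)
  case (Cons d ds)
  then have "dv B ds < B ^ length ds" "d < B" by auto
  then have "d * B ^ length ds + dv B ds < (d + 1) * B ^ length ds" by simp
  also have "\<dots> \<le> B * B ^ length ds" using \<open>d < B\<close> by (intro mult_right_mono) auto
  finally show ?case by (simp add: dv_Cons)
qed simp

lemma two_digit_less:
  fixes a b c d M :: nat assumes "b < M" "d < M"
  shows "a * M + b < c * M + d \<longleftrightarrow> a < c \<or> a = c \<and> b < d"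
proof -
  have *: "x * M + y < x' * M + y'" if "x < x'" "y < M" for x x' y y'
  proof -
    have "x * M + y < (x + 1) * M" using that by simp
    also have "\<dots> \<le> x' * M" using that by (intro mult_right_mono) auto
    finally show ?thesis by simp
  qed
  show ?thesis using *[of a c b d] *[of c a d b] assms by (cases a c rule: linorder_cases) auto
qed

lemma two_digit_eq:
  fixes a b c d M :: nat assumes "b < M" "d < M"
  shows "a * M + b = c * M + d \<longleftrightarrow> a = c \<and> b = d"
  using two_digit_less[OF assms, of a c] two_digit_less[OF assms(2,1), of c a] by (auto simp: neq_iff)

lemma two_digit_Suc:
  fixes a b c d M :: nat assumes "b < M" "d < M"
  shows "Suc (a * M + b) = c * M + d \<longleftrightarrow> a = c \<and> Suc b = d \<or> Suc a = c \<and> Suc b = M \<and> d = 0"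
proof (cases "Suc b = M")
  case True
  then have "Suc (a * M + b) = Suc a * M + 0" by simp
  moreover have "Suc a * M + 0 = c * M + d \<longleftrightarrow> Suc a = c \<and> 0 = d"
    using assms by (intro two_digit_eq) auto
  ultimately show ?thesis using assms True by auto
next
  case False
  then have "a * M + Suc b = c * M + d \<longleftrightarrow> a = c \<and> Suc b = d"
    using assms by (intro two_digit_eq) auto
  then show ?thesis using False by simp
qed

lemma ex_less_Suc2: "(\<exists>l<Suc n. P l) \<longleftrightarrow> P 0 \<or> (\<exists>l<n. P (Suc l))"
  by (metis Suc_less_eq less_Suc_eq_0_disj)

lemma all_less_Suc2: "(\<forall>l<Suc n. P l) \<longleftrightarrow> P 0 \<and> (\<forall>l<n. P (Suc l))"
  by (metis Suc_less_eq less_Suc_eq_0_disj)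

lemma dv_inj:
  "length ds = length es \<Longrightarrow> \<forall>d\<in>set ds. d < B \<Longrightarrow> \<forall>d\<in>set es. d < B \<Longrightarrow> dv B ds = dv B es \<longleftrightarrow> ds = es"
proof (induction ds es rule: list_induct2)
  case (Cons d ds e es)
  then show ?case using two_digit_eq[of "dv B ds" "B ^ length ds" "dv B es" d e]
    by (auto simp: dv_Cons dv_bound dest: dv_bound)
qed simp

lemma dv_less:
  "length ds = length es \<Longrightarrow> \<forall>d\<in>set ds. d < B \<Longrightarrow> \<forall>d\<in>set es. d < B \<Longrightarrow>
   dv B ds < dv B es \<longleftrightarrow> (\<exists>l<length ds. ds ! l < es ! l \<and> (\<forall>l'<l. ds ! l' = es ! l'))"
proof (induction ds es rule: list_induct2)
  case (Cons d ds e es)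
  have b: "dv B ds < B ^ length ds" "dv B es < B ^ length ds"
    using Cons.prems Cons.hyps dv_bound[of ds B] dv_bound[of es B] by auto
  have "dv B (d # ds) < dv B (e # es) \<longleftrightarrow> d < e \<or> d = e \<and> dv B ds < dv B es"
    using two_digit_less[OF b, of d e] Cons.hyps by (simp only: dv_Cons)
  moreover have "(\<exists>l<length (d # ds). (d # ds) ! l < (e # es) ! l \<and> (\<forall>l'<l. (d # ds) ! l' = (e # es) ! l')) \<longleftrightarrow>
    d < e \<or> d = e \<and> (\<exists>l<length ds. ds ! l < es ! l \<and> (\<forall>l'<l. ds ! l' = es ! l'))"
    by (simp add: ex_less_Suc2 all_less_Suc2) blast
  ultimately show ?case using Cons.IH Cons.prems by auto
qed simp

lemma dv_zero: "dv B ds = 0 \<longleftrightarrow> (\<forall>d\<in>set ds. d = 0)" if "0 < B"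
  using that by (induction ds) (auto simp: dv_Cons)

lemma dv_max: "\<forall>d\<in>set ds. d < B \<Longrightarrow> Suc (dv B ds) = B ^ length ds \<longleftrightarrow> (\<forall>d\<in>set ds. Suc d = B)"
proof (induction ds)
  case (Cons d ds)
  then have b: "dv B ds < B ^ length ds" "d < B" by (auto simp: dv_bound)
  have "Suc (d * B ^ length ds + dv B ds) = B * B ^ length ds + 0 \<longleftrightarrow>
    d = B \<and> Suc (dv B ds) = 0 \<or> Suc d = B \<and> Suc (dv B ds) = B ^ length ds \<and> (0::nat) = 0"
    using b by (intro two_digit_Suc) auto
  then show ?case using Cons by (auto simp: dv_Cons)
qed simp

lemma ex_first_Suc:
  "(\<exists>l<Suc n. A l \<and> (\<forall>l'<l. B l') \<and> (\<forall>l'<Suc n. l < l' \<longrightarrow> C l')) \<longleftrightarrow>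
   A 0 \<and> (\<forall>l<n. C (Suc l)) \<or>
   B 0 \<and> (\<exists>l<n. A (Suc l) \<and> (\<forall>l'<l. B (Suc l')) \<and> (\<forall>l'<n. l < l' \<longrightarrow> C (Suc l')))"
  unfolding ex_less_Suc2 all_less_Suc2 by auto

text \<open>Adding one increments a single digit, after which only maximal digits follow, and these
  turn into zeros; the digits before it are unchanged. In this form the carry needs no recursion and
  can be stated in first-order logic. \<open>ex_first_Suc\<close> splits off the case that the
  incremented digit is the first one.\<close>

lemma dv_Suc:
  "length ds = length es \<Longrightarrow> \<forall>d\<in>set ds. d < B \<Longrightarrow> \<forall>d\<in>set es. d < B \<Longrightarrow>
   Suc (dv B ds) = dv B es \<longleftrightarrow> (\<exists>l<length ds. Suc (ds ! l) = es ! l \<and> (\<forall>l'<l. ds ! l' = es ! l') \<and>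
      (\<forall>l'<length ds. l < l' \<longrightarrow> Suc (ds ! l') = B \<and> es ! l' = 0))"
proof (induction ds es rule: list_induct2)
  case (Cons d ds e es)
  have b: "dv B ds < B ^ length ds" "dv B es < B ^ length ds" "0 < B"
    using Cons.prems Cons.hyps dv_bound[of ds B] dv_bound[of es B] by auto
  have m: "Suc (dv B ds) = B ^ length ds \<longleftrightarrow> (\<forall>l<length ds. Suc (ds ! l) = B)"
    using dv_max[of ds B] Cons.prems by (simp add: all_set_conv_all_nth)
  have z: "dv B es = 0 \<longleftrightarrow> (\<forall>l<length ds. es ! l = 0)"
    using dv_zero[OF b(3), of es] Cons.hyps by (simp add: all_set_conv_all_nth)
  have "Suc (dv B (d # ds)) = dv B (e # es) \<longleftrightarrow> d = e \<and> Suc (dv B ds) = dv B es \<or>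
      Suc d = e \<and> Suc (dv B ds) = B ^ length ds \<and> dv B es = 0"
    using two_digit_Suc[OF b(1,2), of d e] Cons.hyps by (simp only: dv_Cons)
  moreover note ex_first_Suc[of "length ds" "\<lambda>l. Suc ((d # ds) ! l) = (e # es) ! l"
      "\<lambda>l. (d # ds) ! l = (e # es) ! l" "\<lambda>l. Suc ((d # ds) ! l) = B \<and> (e # es) ! l = 0"]
  ultimately show ?case using Cons.IH Cons.prems m z by simp blast
qed simp

text \<open>Removing the least significant digit leaves the digit list of \<open>i div B\<close>;
  this is why \<open>i\<close> is arbitrary in the induction.\<close>

lemma dv_digits: "dv B (map (\<lambda>l. i div B ^ (k - 1 - l) mod B) [0..<k]) = i mod B ^ k" if "0 < B"
proof (induction k arbitrary: i)
  case (Suc k)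
  have "map (\<lambda>l. i div B ^ (k - l) mod B) [0..<k] = map (\<lambda>l. (i div B) div B ^ (k - 1 - l) mod B) [0..<k]"
  proof (intro map_cong refl)
    fix l assume "l \<in> set [0..<k]"
    then have "k - l = Suc (k - 1 - l)" by auto
    then show "i div B ^ (k - l) mod B = (i div B) div B ^ (k - 1 - l) mod B"
      by (simp only: power_Suc div_mult2_eq)
  qed
  then have "dv B (map (\<lambda>l. i div B ^ (k - l) mod B) [0..<k]) = i div B mod B ^ k"
    using Suc[of "i div B"] by (simp only:)
  then have "dv B (map (\<lambda>l. i div B ^ (Suc k - 1 - l) mod B) [0..<Suc k]) = (i div B mod B ^ k) * B + i mod B"
    by (simp add: dv_append del: map_eq_conv)
  also have "\<dots> = i mod B ^ Suc k"
    unfolding power_Suc mod_mult2_eq by (subst mult.commute) (rule refl)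
  finally show ?case .
qed simp

text \<open>Position \<open>0\<close> is the most significant bit, and in a tuple the first set is
  the most significant digit to base \<open>2 ^ n\<close>. This is the order of the codes in
  \<open>asg\<close>, so that the \<open>i\<close>-th assignment is the tuple with number
  \<open>i\<close> (\<open>numl_asg\<close>).\<close>

definition snum :: "nat \<Rightarrow> nat set \<Rightarrow> nat" where
  "snum n A = dv 2 (map (\<lambda>j. of_bool (j \<in> A)) [0..<n])"

definition numl :: "nat \<Rightarrow> nat set list \<Rightarrow> nat" where
  "numl n As = dv (2 ^ n) (map (snum n) As)"

definition num :: "nat \<Rightarrow> (nat \<Rightarrow> nat set) \<Rightarrow> nat list \<Rightarrow> nat" where
  "num n e vs = numl n (map e vs)"

lemma snum_bound [simp]: "snum n A < 2 ^ n"
  using dv_bound[of "map (\<lambda>j. of_bool (j \<in> A)) [0..<n]" 2] by (auto simp: snum_def)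

lemma snum_eq: "A \<subseteq> {..<n} \<Longrightarrow> B \<subseteq> {..<n} \<Longrightarrow> snum n A = snum n B \<longleftrightarrow> A = B"
  using dv_inj[of "map (\<lambda>j. of_bool (j \<in> A)) [0..<n]" "map (\<lambda>j. of_bool (j \<in> B)) [0..<n]" 2]
  unfolding snum_def by (auto simp: of_bool_eq_iff)

lemma snum_less:
  "snum n A < snum n B \<longleftrightarrow> (\<exists>j<n. j \<notin> A \<and> j \<in> B \<and> (\<forall>j'<n. j' < j \<longrightarrow> (j' \<in> A \<longleftrightarrow> j' \<in> B)))"
proof -
  have "snum n A < snum n B \<longleftrightarrow> (\<exists>j<n. of_bool (j \<in> A) < (of_bool (j \<in> B) :: nat) \<and>
      (\<forall>j'<j. of_bool (j' \<in> A) = (of_bool (j' \<in> B) :: nat)))"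
    using dv_less[of "map (\<lambda>j. of_bool (j \<in> A)) [0..<n]" "map (\<lambda>j. of_bool (j \<in> B)) [0..<n]" 2]
    unfolding snum_def by (simp cong: conj_cong)
  also have "\<dots> \<longleftrightarrow> (\<exists>j<n. j \<notin> A \<and> j \<in> B \<and> (\<forall>j'<n. j' < j \<longrightarrow> (j' \<in> A \<longleftrightarrow> j' \<in> B)))"
    by (rule ex_cong1) (auto simp: of_bool_def)
  finally show ?thesis .
qed

lemma snum_Suc:
  "Suc (snum n A) = snum n B \<longleftrightarrow> (\<exists>j<n. j \<notin> A \<and> j \<in> B \<and> (\<forall>j'<n. j' < j \<longrightarrow> (j' \<in> A \<longleftrightarrow> j' \<in> B)) \<and>
     (\<forall>j'<n. j < j' \<longrightarrow> j' \<in> A \<and> j' \<notin> B))"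
proof -
  have "Suc (snum n A) = snum n B \<longleftrightarrow> (\<exists>j<n. Suc (of_bool (j \<in> A)) = (of_bool (j \<in> B) :: nat) \<and>
      (\<forall>j'<j. of_bool (j' \<in> A) = (of_bool (j' \<in> B) :: nat)) \<and>
      (\<forall>j'<n. j < j' \<longrightarrow> Suc (of_bool (j' \<in> A)) = 2 \<and> (of_bool (j' \<in> B) :: nat) = 0))"
    using dv_Suc[of "map (\<lambda>j. of_bool (j \<in> A)) [0..<n]" "map (\<lambda>j. of_bool (j \<in> B)) [0..<n]" 2]
    unfolding snum_def by (simp cong: conj_cong)
  also have "\<dots> \<longleftrightarrow> (\<exists>j<n. j \<notin> A \<and> j \<in> B \<and> (\<forall>j'<n. j' < j \<longrightarrow> (j' \<in> A \<longleftrightarrow> j' \<in> B)) \<and>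
     (\<forall>j'<n. j < j' \<longrightarrow> j' \<in> A \<and> j' \<notin> B))"
    by (rule ex_cong1) (auto simp: of_bool_def)
  finally show ?thesis .
qed

lemma snum_zero: "A \<subseteq> {..<n} \<Longrightarrow> snum n A = 0 \<longleftrightarrow> A = {}"
  by (auto simp: snum_def dv_zero)

lemma snum_max: "A \<subseteq> {..<n} \<Longrightarrow> Suc (snum n A) = 2 ^ n \<longleftrightarrow> A = {..<n}"
  using dv_max[of "map (\<lambda>j. of_bool (j \<in> A)) [0..<n]" 2] by (auto simp: snum_def split: if_splits)

lemma numl_bound [simp]: "numl n As < 2 ^ (n * length As)"
  using dv_bound[of "map (snum n) As" "2 ^ n"] by (auto simp: numl_def power_mult)

lemma num_bound [simp]: "num n e vs < 2 ^ (n * length vs)"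
  using numl_bound[of n "map e vs"] by (simp add: num_def)

lemma numl_append: "numl n (As @ Bs) = numl n As * 2 ^ (n * length Bs) + numl n Bs"
  by (simp add: numl_def dv_append power_mult)

lemma num_append: "num n e (us @ vs) = num n e us * 2 ^ (n * length vs) + num n e vs"
  by (simp add: num_def numl_append)

lemma num_Nil [simp]: "num n e [] = 0"
  by (simp add: num_def numl_def)

lemma numl_inj:
  "length As = length Bs \<Longrightarrow> \<forall>A\<in>set As. A \<subseteq> {..<n} \<Longrightarrow> \<forall>A\<in>set Bs. A \<subseteq> {..<n} \<Longrightarrow>
   numl n As = numl n Bs \<longleftrightarrow> As = Bs"
  unfolding numl_def by (subst dv_inj) (auto simp: list_eq_iff_nth_eq snum_eq)

lemma asg_exponent: fixes l k j n :: nat shows "l < k \<Longrightarrow> j < n \<Longrightarrow> n * k - 1 - (l * n + j) = n * (k - 1 - l) + (n - 1 - j)"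
proof -
  assume a: "l < k" "j < n"
  then obtain d where d: "k = Suc (l + d)" using less_iff_Suc_add by auto
  obtain r where r: "n = Suc (j + r)" using a less_iff_Suc_add by auto
  show ?thesis unfolding d r by (simp add: algebra_simps)
qed

lemma snum_asg: assumes "l < k" shows "snum n (asg n k i l) = i div 2 ^ (n * (k - 1 - l)) mod 2 ^ n"
proof -
  let ?i = "i div 2 ^ (n * (k - 1 - l))"
  have "map (\<lambda>j. of_bool (j \<in> asg n k i l)) [0..<n] = map (\<lambda>j. ?i div 2 ^ (n - 1 - j) mod (2::nat)) [0..<n]"
  proof (intro map_cong refl)
    fix j assume "j \<in> set [0..<n]"
    then have "j < n" by simp
    then have "i div 2 ^ (n * k - 1 - (l * n + j)) = ?i div 2 ^ (n - 1 - j)"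
      unfolding asg_exponent[OF assms \<open>j < n\<close>] by (simp only: power_add div_mult2_eq)
    then show "of_bool (j \<in> asg n k i l) = ?i div 2 ^ (n - 1 - j) mod 2"
      using \<open>j < n\<close> by (auto simp: asg_def mod2_eq_if)
  qed
  then show ?thesis unfolding snum_def by (simp only: dv_digits)
qed

lemma numl_asg: assumes "i < 2 ^ (n * k)" shows "numl n (map (asg n k i) [0..<k]) = i"
proof -
  have "map (snum n \<circ> asg n k i) [0..<k] = map (\<lambda>l. i div (2 ^ n) ^ (k - 1 - l) mod 2 ^ n) [0..<k]"
    by (intro map_cong refl) (simp add: snum_asg power_mult)
  then show ?thesis using assms unfolding numl_def map_map by (simp only: dv_digits zero_less_power zero_less_numeral) (simp add: power_mult)
qed

lemma asg_subset: "asg n k i l \<subseteq> {..<n}"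
  by (auto simp: asg_def)

lemma asg_numl:
  assumes "\<forall>A\<in>set As. A \<subseteq> {..<n}" "l < length As"
  shows "asg n (length As) (numl n As) l = As ! l"
proof -
  have "map (asg n (length As) (numl n As)) [0..<length As] = As"
    using assms numl_asg[of "numl n As" n "length As"]
    by (subst numl_inj[symmetric, of _ _ n]) (auto simp: asg_def)
  then show ?thesis using assms(2) by (metis add_0 length_upt nth_map nth_upt diff_zero)
qed

subsection \<open>First-order definable relations\<close>

abbreviation wnum :: "nat list \<Rightarrow> (nat \<Rightarrow> nat set) \<Rightarrow> nat list \<Rightarrow> nat" where
  "wnum w \<equiv> num (length w)"

abbreviation cap :: "nat list \<Rightarrow> nat \<Rightarrow> nat" where
  "cap w k \<equiv> 2 ^ (length w * k)"

definition venv :: "nat list \<Rightarrow> (nat \<Rightarrow> nat set) \<Rightarrow> bool" where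
  "venv w e \<longleftrightarrow> (\<forall>i. e i \<subseteq> {..<length w})"

text \<open>The only free variables are set variables: all data are numbers given by sets, and
  first-order variables occur only bound.\<close>

definition fodef :: "nat \<Rightarrow> (nat list \<Rightarrow> (nat \<Rightarrow> nat set) \<Rightarrow> bool) \<Rightarrow> bool" where
  "fodef s P \<longleftrightarrow> (\<exists>\<phi>. wf s \<phi> \<and> is_fo \<phi> \<and> fvars \<phi> = {} \<and>
     (\<forall>w e. is_string s w \<longrightarrow> venv w e \<longrightarrow> (sat w (\<lambda>_. 0) e \<phi> \<longleftrightarrow> P w e)))"

lemma fodefI:
  "wf s \<phi> \<Longrightarrow> is_fo \<phi> \<Longrightarrow> fvars \<phi> = {} \<Longrightarrow>
   (\<And>w e. is_string s w \<Longrightarrow> venv w e \<Longrightarrow> sat w (\<lambda>_. 0) e \<phi> \<longleftrightarrow> P w e) \<Longrightarrow> fodef s P"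
  unfolding fodef_def by blast

lemma fodef_cong:
  assumes "fodef s P" "\<And>w e. is_string s w \<Longrightarrow> venv w e \<Longrightarrow> Q w e \<longleftrightarrow> P w e"
  shows "fodef s Q"
  using assms unfolding fodef_def by simp

named_theorems fod

lemma fodef_const [fod]: "fodef s (\<lambda>w e. c)"
proof (cases c)
  case True then show ?thesis by (intro fodefI[where \<phi> = "Eq Mn Mn"]) auto
next
  case False then show ?thesis by (intro fodefI[where \<phi> = "Neg (Eq Mn Mn)"]) auto
qed

lemma fodef_not [fod]: "fodef s P \<Longrightarrow> fodef s (\<lambda>w e. \<not> P w e)"
  unfolding fodef_def by (metis wf.simps(5) is_fo.simps(1) fvars.simps(5) sat.simps(5))

lemma fodef_conj [fod]: "fodef s P \<Longrightarrow> fodef s Q \<Longrightarrow> fodef s (\<lambda>w e. P w e \<and> Q w e)"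
proof -
  assume "fodef s P" "fodef s Q"
  then obtain \<phi> \<psi> where "wf s \<phi>" "is_fo \<phi>" "fvars \<phi> = {}" "wf s \<psi>" "is_fo \<psi>" "fvars \<psi> = {}"
    "\<And>w e. is_string s w \<Longrightarrow> venv w e \<Longrightarrow> sat w (\<lambda>_. 0) e \<phi> \<longleftrightarrow> P w e"
    "\<And>w e. is_string s w \<Longrightarrow> venv w e \<Longrightarrow> sat w (\<lambda>_. 0) e \<psi> \<longleftrightarrow> Q w e"
    unfolding fodef_def by blast
  then show ?thesis by (intro fodefI[where \<phi> = "Conj \<phi> \<psi>"]) auto
qed

lemma fodef_disj [fod]: "fodef s P \<Longrightarrow> fodef s Q \<Longrightarrow> fodef s (\<lambda>w e. P w e \<or> Q w e)"
proof -
  assume "fodef s P" "fodef s Q"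
  then obtain \<phi> \<psi> where "wf s \<phi>" "is_fo \<phi>" "fvars \<phi> = {}" "wf s \<psi>" "is_fo \<psi>" "fvars \<psi> = {}"
    "\<And>w e. is_string s w \<Longrightarrow> venv w e \<Longrightarrow> sat w (\<lambda>_. 0) e \<phi> \<longleftrightarrow> P w e"
    "\<And>w e. is_string s w \<Longrightarrow> venv w e \<Longrightarrow> sat w (\<lambda>_. 0) e \<psi> \<longleftrightarrow> Q w e"
    unfolding fodef_def by blast
  then show ?thesis by (intro fodefI[where \<phi> = "Disj \<phi> \<psi>"]) auto
qed

lemma fodef_imp [fod]: "fodef s P \<Longrightarrow> fodef s Q \<Longrightarrow> fodef s (\<lambda>w e. P w e \<longrightarrow> Q w e)"
  unfolding imp_conv_disj by (intro fodef_disj fodef_not)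

lemma fodef_ex_less [fod]: "(\<And>i. i < k \<Longrightarrow> fodef s (P i)) \<Longrightarrow> fodef s (\<lambda>w e. \<exists>i<k. P i w e)" for k :: nat
proof (induction k)
  case (Suc k)
  then have "fodef s (\<lambda>w e. (\<exists>i<k. P i w e) \<or> P k w e)" by (intro fod) auto
  then show ?case by (rule fodef_cong) (auto simp: less_Suc_eq)
qed (simp add: fod)

lemma fodef_all_less [fod]: "(\<And>i. i < k \<Longrightarrow> fodef s (P i)) \<Longrightarrow> fodef s (\<lambda>w e. \<forall>i<k. P i w e)" for k :: nat
proof -
  assume "\<And>i. i < k \<Longrightarrow> fodef s (P i)"
  then have "fodef s (\<lambda>w e. \<not> (\<exists>i<k. \<not> P i w e))" by (intro fod)
  then show ?thesis by simp
qed

lemma fodef_empty [fod]: "fodef s (\<lambda>w e. e x = {})"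
  by (rule fodefI[where \<phi> = "All 0 (Neg (Mem x (V 0)))"]) (auto simp: venv_def)

lemma fodef_full [fod]: "fodef s (\<lambda>w e. e x = {..<length w})"
  by (rule fodefI[where \<phi> = "All 0 (Mem x (V 0))"]) (auto simp: venv_def)

lemma fodef_eq [fod]: "fodef s (\<lambda>w e. e x = e y)"
  by (rule fodefI[where \<phi> = "All 0 (Disj (Conj (Mem x (V 0)) (Mem y (V 0))) (Conj (Neg (Mem x (V 0))) (Neg (Mem y (V 0)))))"])
    (auto simp: venv_def)

lemma fodef_snum_less [fod]: "fodef s (\<lambda>w e. snum (length w) (e x) < snum (length w) (e y))"
  unfolding snum_less
  by (rule fodefI[where \<phi> = "Ex 0 (Conj (Neg (Mem x (V 0))) (Conj (Mem y (V 0)) (All 1 (Disj (Neg (Lt (V 1) (V 0)))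
       (Disj (Conj (Mem x (V 1)) (Mem y (V 1))) (Conj (Neg (Mem x (V 1))) (Neg (Mem y (V 1)))))))))"]) auto

lemma fodef_snum_Suc [fod]: "fodef s (\<lambda>w e. Suc (snum (length w) (e x)) = snum (length w) (e y))"
  unfolding snum_Suc
  by (rule fodefI[where \<phi> = "Ex 0 (Conj (Neg (Mem x (V 0))) (Conj (Mem y (V 0)) (Conj (All 1 (Disj (Neg (Lt (V 1) (V 0)))
       (Disj (Conj (Mem x (V 1)) (Mem y (V 1))) (Conj (Neg (Mem x (V 1))) (Neg (Mem y (V 1)))))))
       (All 1 (Disj (Neg (Lt (V 0) (V 1))) (Conj (Mem x (V 1)) (Neg (Mem y (V 1)))))))))"]) auto

lemma venvD: "venv w e \<Longrightarrow> e i \<subseteq> {..<length w}"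
  by (simp add: venv_def)

lemma num_eq:
  assumes "venv w e" "venv w e'" "length us = length vs"
  shows "wnum w e us = num (length w) e' vs \<longleftrightarrow> (\<forall>l<length vs. e (us ! l) = e' (vs ! l))"
  unfolding num_def using assms by (subst numl_inj) (auto simp: venvD list_eq_iff_nth_eq)

lemma num_less:
  assumes "venv w e" "length us = length vs"
  shows "wnum w e us < wnum w e vs \<longleftrightarrow>
    (\<exists>l<length vs. snum (length w) (e (us ! l)) < snum (length w) (e (vs ! l)) \<and> (\<forall>l'<l. e (us ! l') = e (vs ! l')))"
proof -
  have "wnum w e us < wnum w e vs \<longleftrightarrow> (\<exists>l<length vs. snum (length w) (e (us ! l)) < snum (length w) (e (vs ! l)) \<and>
    (\<forall>l'<l. snum (length w) (e (us ! l')) = snum (length w) (e (vs ! l'))))"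
    using assms dv_less[of "map (snum (length w)) (map e us)" "map (snum (length w)) (map e vs)" "2 ^ length w"]
    by (simp add: num_def numl_def cong: conj_cong)
  then show ?thesis using assms by (simp add: snum_eq venvD)
qed

lemma num_Suc:
  assumes "venv w e" "length us = length vs"
  shows "Suc (wnum w e us) = wnum w e vs \<longleftrightarrow>
    (\<exists>l<length vs. Suc (snum (length w) (e (us ! l))) = snum (length w) (e (vs ! l)) \<and> (\<forall>l'<l. e (us ! l') = e (vs ! l')) \<and>
      (\<forall>l'<length vs. l < l' \<longrightarrow> e (us ! l') = {..<length w} \<and> e (vs ! l') = {}))"
proof -
  have "Suc (wnum w e us) = wnum w e vs \<longleftrightarrow>
    (\<exists>l<length vs. Suc (snum (length w) (e (us ! l))) = snum (length w) (e (vs ! l)) \<and>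
      (\<forall>l'<l. snum (length w) (e (us ! l')) = snum (length w) (e (vs ! l'))) \<and>
      (\<forall>l'<length vs. l < l' \<longrightarrow> Suc (snum (length w) (e (us ! l'))) = 2 ^ length w \<and> snum (length w) (e (vs ! l')) = 0))"
    using assms dv_Suc[of "map (snum (length w)) (map e us)" "map (snum (length w)) (map e vs)" "2 ^ length w"]
    by (simp add: num_def numl_def cong: conj_cong)
  then show ?thesis using assms by (simp add: snum_eq venvD snum_max snum_zero)
qed

lemma num_zero: "venv w e \<Longrightarrow> wnum w e vs = 0 \<longleftrightarrow> (\<forall>l<length vs. e (vs ! l) = {})"
  using dv_zero[of "2 ^ length w" "map (snum (length w)) (map e vs)"]
  by (auto simp: num_def numl_def snum_zero venvD all_set_conv_all_nth)

lemma num_max: "venv w e \<Longrightarrow> Suc (wnum w e vs) = cap w (length vs) \<longleftrightarrow> (\<forall>l<length vs. e (vs ! l) = {..<length w})"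
  using dv_max[of "map (snum (length w)) (map e vs)" "2 ^ length w"]
  by (simp add: num_def numl_def snum_max venvD all_set_conv_all_nth power_mult)

lemma fodef_num_eq [fod]: "length us = length vs \<Longrightarrow> fodef s (\<lambda>w e. wnum w e us = wnum w e vs)"
  by (rule fodef_cong[where P = "\<lambda>w e. \<forall>l<length vs. e (us ! l) = e (vs ! l)"]) (intro fod, simp add: num_eq)

lemma fodef_num_less [fod]: "length us = length vs \<Longrightarrow> fodef s (\<lambda>w e. wnum w e us < wnum w e vs)"
  by (rule fodef_cong, rule_tac[2] num_less) (intro fod, auto)

lemma fodef_num_le [fod]: "length us = length vs \<Longrightarrow> fodef s (\<lambda>w e. wnum w e us \<le> wnum w e vs)"
  using fodef_not[OF fodef_num_less, of vs us s] by (simp add: not_less)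

lemma fodef_num_Suc [fod]: "length us = length vs \<Longrightarrow> fodef s (\<lambda>w e. Suc (wnum w e us) = wnum w e vs)"
  by (rule fodef_cong, rule_tac[2] num_Suc) (intro fod, auto)

lemma fodef_num_Suc' [fod]: "length us = length vs \<Longrightarrow> fodef s (\<lambda>w e. wnum w e vs = Suc (wnum w e us))"
  using fodef_num_Suc[of us vs s] by (simp add: eq_commute)

lemma fodef_num_zero [fod]: "fodef s (\<lambda>w e. wnum w e vs = 0)"
  by (rule fodef_cong, rule_tac[2] num_zero) (intro fod)

lemma fodef_num_max [fod]: "length vs = k \<Longrightarrow> fodef s (\<lambda>w e. Suc (wnum w e vs) = cap w k)"
  by (rule fodef_cong[where P = "\<lambda>w e. \<forall>l<length vs. e (vs ! l) = {..<length w}"]) (intro fod, hypsubst, simp add: num_max)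

text \<open>The configurations below carry registers. A register of width \<open>k\<close> is a number below \<open>cap w k\<close>, given in
formulas by \<open>k\<close> set variables.\<close>

definition nums :: "nat list \<Rightarrow> (nat \<Rightarrow> nat set) \<Rightarrow> nat list list \<Rightarrow> nat list" where
  "nums w e vss = map (num (length w) e) vss"

lemma length_nums [simp]: "length (nums w e vss) = length vss"
  by (simp add: nums_def)

lemma nth_nums [simp]: "i < length vss \<Longrightarrow> nums w e vss ! i = wnum w e (vss ! i)"
  by (simp add: nums_def)

definition okr :: "nat list \<Rightarrow> nat list \<Rightarrow> nat list \<Rightarrow> bool" where
  "okr w ks as \<longleftrightarrow> length as = length ks \<and> (\<forall>i<length ks. as ! i < cap w (ks ! i))"

lemma okr_Nil [simp]: "okr w [] as \<longleftrightarrow> as = []" by (auto simp: okr_def)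

lemma okr_Cons: "okr w (k # ks) as \<longleftrightarrow> (\<exists>a as'. as = a # as' \<and> a < cap w k \<and> okr w ks as')"
  by (cases as) (auto simp: okr_def all_less_Suc2)

lemma okr_Cons_Cons [simp]: "okr w (k # ks) (a # as) \<longleftrightarrow> a < cap w k \<and> okr w ks as"
  by (auto simp: okr_Cons)

text \<open>Definability is demanded for every choice of the set variables that hold the registers,
  so the registers of different configurations can be combined in one formula, or be slices of one
  longer list of variables, without renaming.\<close>

definition fr1 where
  "fr1 s ks Q \<longleftrightarrow> (\<forall>vs. map length vs = ks \<longrightarrow> fodef s (\<lambda>w e. Q w (nums w e vs)))"

definition fr2 where
  "fr2 s ks ks' Q \<longleftrightarrow> (\<forall>vs vs'. map length vs = ks \<longrightarrow> map length vs' = ks' \<longrightarrow>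
     fodef s (\<lambda>w e. Q w (nums w e vs) (nums w e vs')))"

definition fr3 where
  "fr3 s ks ks1 ks2 Q \<longleftrightarrow> (\<forall>vs vs1 vs2. map length vs = ks \<longrightarrow> map length vs1 = ks1 \<longrightarrow> map length vs2 = ks2 \<longrightarrow>
     fodef s (\<lambda>w e. Q w (nums w e vs) (nums w e vs1) (nums w e vs2)))"

lemma fodef_nums_eq [fod]:
  assumes "map length us = map length vs" shows "fodef s (\<lambda>w e. nums w e us = nums w e vs)"
proof (rule fodef_cong[where P = "\<lambda>w e. \<forall>l<length vs. wnum w e (us ! l) = wnum w e (vs ! l)"])
  have l: "length us = length vs" using assms by (metis length_map)
  then have "length (us ! l) = length (vs ! l)" if "l < length vs" for l
    using assms that by (metis nth_map)
  then show "fodef s (\<lambda>w e. \<forall>l<length vs. wnum w e (us ! l) = wnum w e (vs ! l))"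
    by (intro fod) auto
  show "nums w e us = nums w e vs \<longleftrightarrow> (\<forall>l<length vs. wnum w e (us ! l) = wnum w e (vs ! l))" for w e
    using l by (simp add: list_eq_iff_nth_eq)
qed

subsection \<open>Proof systems with oracles\<close>

text \<open>\<open>drv \<dots> q as a\<close>: the configuration with state \<open>q\<close> and registers \<open>as\<close> has a proof of size \<open>a\<close>. State \<open>0\<close> needs no
proof, and \<open>O'\<close> supplies additional axioms. The registers in state \<open>q\<close> have the widths \<open>K q\<close>, and the rules of a
system that decides \<open>P\<close> start from state \<open>1\<close>.\<close>

inductive drv :: "(nat \<Rightarrow> nat list \<Rightarrow> nat list \<Rightarrow> bool) \<Rightarrow> nat \<Rightarrow> (nat \<Rightarrow> nat list) \<Rightarrow>
    (nat list \<Rightarrow> nat \<Rightarrow> nat list \<Rightarrow> nat \<Rightarrow> nat list \<Rightarrow> nat \<Rightarrow> nat list \<Rightarrow> bool) \<Rightarrow> nat list \<Rightarrow>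
    nat \<Rightarrow> nat list \<Rightarrow> nat \<Rightarrow> bool" for O' Q K R w where
  finished: "drv O' Q K R w 0 as 0"
| ask: "0 < q \<Longrightarrow> q < Q \<Longrightarrow> O' q w as \<Longrightarrow> drv O' Q K R w q as 1"
| rule: "0 < q \<Longrightarrow> q < Q \<Longrightarrow> q1 < Q \<Longrightarrow> q2 < Q \<Longrightarrow> okr w (K q1) as1 \<Longrightarrow> okr w (K q2) as2 \<Longrightarrow>
    R w q as q1 as1 q2 as2 \<Longrightarrow> drv O' Q K R w q1 as1 a \<Longrightarrow> drv O' Q K R w q2 as2 b \<Longrightarrow>
    drv O' Q K R w q as (Suc (a + b))"

text \<open>States are not visible to formulas: definability is required for each triple of states
  separately. The size bound concerns one proof of each true instance, whereas soundness covers
  proofs of any size.\<close>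

definition sys :: "nat \<Rightarrow> (nat \<Rightarrow> nat list \<Rightarrow> nat list \<Rightarrow> bool) \<Rightarrow> nat list \<Rightarrow> (nat list \<Rightarrow> nat list \<Rightarrow> bool) \<Rightarrow> nat \<Rightarrow>
    (nat \<Rightarrow> nat list) \<Rightarrow> (nat list \<Rightarrow> nat \<Rightarrow> nat list \<Rightarrow> nat \<Rightarrow> nat list \<Rightarrow> nat \<Rightarrow> nat list \<Rightarrow> bool) \<Rightarrow> nat \<Rightarrow> bool" where
  "sys s O' ks P Q K R c \<longleftrightarrow> 1 < Q \<and> K 1 = ks \<and>
     (\<forall>q<Q. \<forall>q1<Q. \<forall>q2<Q. fr3 s (K q) (K q1) (K q2) (\<lambda>w as as1 as2. R w q as q1 as1 q2 as2)) \<and>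
     (\<forall>w as. is_string s w \<longrightarrow> okr w ks as \<longrightarrow>
        (P w as \<longrightarrow> (\<exists>a\<le>2 ^ (c * length w). drv O' Q K R w 1 as a)) \<and>
        (\<forall>a. drv O' Q K R w 1 as a \<longrightarrow> P w as))"

abbreviation no_oracle :: "nat \<Rightarrow> nat list \<Rightarrow> nat list \<Rightarrow> bool" where
  "no_oracle \<equiv> \<lambda>_ _ _. False"

definition pdef :: "nat \<Rightarrow> nat list \<Rightarrow> (nat list \<Rightarrow> nat list \<Rightarrow> bool) \<Rightarrow> bool" where
  "pdef s ks P \<longleftrightarrow> (\<exists>Q K R c. sys s no_oracle ks P Q K R c)"

lemma pdef_cong:
  assumes "pdef s ks P" "\<And>w as. is_string s w \<Longrightarrow> okr w ks as \<Longrightarrow> Q w as \<longleftrightarrow> P w as"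
  shows "pdef s ks Q"
  using assms unfolding pdef_def sys_def by simp

lemma ex_okr: "\<exists>as. okr w ks as"
  by (rule exI[of _ "map (\<lambda>_. 0) ks"]) (simp add: okr_def)

lemma is_string_pos: "is_string s w \<Longrightarrow> 0 < length w"
  by (simp add: is_string_def)

text \<open>Eliminating the oracle at state \<open>p\<close>: the states \<open>q'\<close> of the system deciding it become \<open>Q + q'\<close>.
  Its final state becomes the ordinary state \<open>Q\<close>, from which one more step leads to state \<open>0\<close>.\<close>

lemma oracle_elim:
  assumes S: "sys s O' ks P Q K R c" and p: "0 < p" "p < Q" and Or: "pdef s (K p) (O' p)"
  shows "\<exists>Q' K' R' c'. sys s (\<lambda>q w as. q < Q \<and> q \<noteq> p \<and> O' q w as) ks P Q' K' R' c' \<and> Q \<le> Q' \<and> (\<forall>q<Q. K' q = K q)"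
proof -
  obtain Q2 K2 R2 c2 where S2: "sys s no_oracle (K p) (O' p) Q2 K2 R2 c2"
    using Or unfolding pdef_def by blast
  define Q' where "Q' = Q + Q2"
  define K' where "K' q = (if q < Q then K q else K2 (q - Q))" for q
  define R' where "R' w q as q1 as1 q2 as2 \<longleftrightarrow>
      (q < Q \<and> q1 < Q \<and> q2 < Q \<and> R w q as q1 as1 q2 as2) \<or>
      (q = p \<and> q1 = Q + 1 \<and> as1 = as \<and> q2 = 0) \<or>
      (q = Q \<and> q1 = 0 \<and> q2 = 0) \<or>
      (Q \<le> q \<and> Q \<le> q1 \<and> Q \<le> q2 \<and> R2 w (q - Q) as (q1 - Q) as1 (q2 - Q) as2)" for w q as q1 as1 q2 as2
  define O2 where "O2 q w as \<longleftrightarrow> q < Q \<and> q \<noteq> p \<and> O' q w as" for q w as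
  have Q: "1 < Q" "1 < Q2" "K 1 = ks" "K2 1 = K p" using S S2 by (auto simp: sys_def)
  have fo: "fr3 s (K' q) (K' q1) (K' q2) (\<lambda>w as as1 as2. R' w q as q1 as1 q2 as2)"
    if "q < Q'" "q1 < Q'" "q2 < Q'" for q q1 q2
    unfolding fr3_def
  proof (intro allI impI)
    fix vs vs1 vs2 :: "nat list list" assume l: "map length vs = K' q" "map length vs1 = K' q1" "map length vs2 = K' q2"
    have 1: "fodef s (\<lambda>w e. q < Q \<and> q1 < Q \<and> q2 < Q \<and> R w q (nums w e vs) q1 (nums w e vs1) q2 (nums w e vs2))"
      (is "fodef s (\<lambda>w e. ?P w e)")
    proof (cases "q < Q \<and> q1 < Q \<and> q2 < Q")
      case True
      then show ?thesis using S l unfolding sys_def fr3_def by (simp add: K'_def)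
    next
      case False
      have "?P = (\<lambda>w e. False)" using False by auto
      then show ?thesis by (simp add: fod)
    qed
    have 2: "fodef s (\<lambda>w e. Q \<le> q \<and> Q \<le> q1 \<and> Q \<le> q2 \<and>
        R2 w (q - Q) (nums w e vs) (q1 - Q) (nums w e vs1) (q2 - Q) (nums w e vs2))"
      (is "fodef s (\<lambda>w e. ?P w e)")
    proof (cases "Q \<le> q \<and> Q \<le> q1 \<and> Q \<le> q2")
      case True
      then have "q - Q < Q2" "q1 - Q < Q2" "q2 - Q < Q2" using that by (auto simp: Q'_def)
      then show ?thesis using True S2 l unfolding sys_def fr3_def by (simp add: K'_def)
    next
      case False
      have "?P = (\<lambda>w e. False)" using False by auto
      then show ?thesis by (simp add: fod)
    qed
    have 3: "fodef s (\<lambda>w e. q = p \<and> q1 = Q + 1 \<and> nums w e vs1 = nums w e vs \<and> q2 = 0)"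
      (is "fodef s (\<lambda>w e. ?P w e)")
    proof (cases "q = p \<and> q1 = Q + 1")
      case True
      then have "map length vs1 = map length vs" using l p Q by (simp add: K'_def)
      then show ?thesis by (intro fod)
    next
      case False
      have "?P = (\<lambda>w e. False)" using False by auto
      then show ?thesis by (simp add: fod)
    qed
    show "fodef s (\<lambda>w e. R' w q (nums w e vs) q1 (nums w e vs1) q2 (nums w e vs2))"
      unfolding R'_def by (intro fodef_disj 1 2 3 fodef_conj fodef_const)
  qed
  let ?d = "drv O' Q K R" and ?d' = "drv O2 Q' K' R'" and ?d2 = "drv no_oracle Q2 K2 R2"
  \<comment> \<open>A proof with \<open>a\<close> rule applications has \<open>a + 1\<close> leaves,
    all in the final state; each leaf needs one more step from state \<open>Q\<close>, which gives
    \<open>a + (a + 1)\<close>.\<close>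
  have sub: "?d' w (Q + q) as (2 * a + 1)" if "?d2 w q as a" for w q as a
    using that
  proof induction
    case (finished as)
    obtain bs where "okr w (K' 0) bs" using ex_okr by blast
    then have "?d' w (Q + 0) as (Suc (0 + 0))"
      using Q by (intro drv.rule[of _ _ 0 0 _ _ bs bs] drv.finished) (auto simp: Q'_def R'_def)
    then show ?case by simp
  next
    case (rule q q1 q2 as1 as2 as a b)
    have "?d' w (Q + q) as (Suc ((2 * a + 1) + (2 * b + 1)))"
      by (rule drv.rule[OF _ _ _ _ _ _ _ rule.IH]) (use rule.hyps Q in \<open>auto simp: Q'_def R'_def K'_def\<close>)
    then show ?case by simp
  qed simp
  \<comment> \<open>A question to the oracle at \<open>p\<close> counted \<open>1\<close>; it
    becomes the step into the inner system followed by a proof of size \<open>2 * a + 1\<close> with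
    \<open>a\<close> at most \<open>2 ^ (c2 * length w)\<close>.\<close>
  have main: "\<exists>a'\<le>a * (2 * 2 ^ (c2 * length w) + 2). ?d' w q as a'"
    if "?d w q as a" "is_string s w" "okr w (K q) as" for w q as a
    using that
  proof induction
    case (finished as) then show ?case by (intro exI[of _ 0]) (auto intro: drv.finished)
  next
    case (ask q as)
    show ?case
    proof (cases "q = p")
      case True
      then obtain a where a: "a \<le> 2 ^ (c2 * length w)" "?d2 w 1 as a"
        using S2 ask unfolding sys_def by blast
      obtain bs where "okr w (K' 0) bs" using ex_okr by blast
      then have "?d' w q as (Suc (2 * a + 1 + 0))"
        using sub[OF a(2)] p Q ask True
        by (intro drv.rule[of _ _ "Q + 1" 0 _ _ as bs] drv.finished) (auto simp: Q'_def R'_def K'_def)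
      then show ?thesis using a(1) by (intro exI[of _ "2 * a + 2"]) simp
    next
      case False
      then have "?d' w q as 1" using ask by (intro drv.ask) (auto simp: Q'_def O2_def)
      then show ?thesis by (intro exI[of _ 1]) simp
    qed
  next
    case (rule q q1 q2 as1 as2 as a b)
    then obtain a' b' where a: "a' \<le> a * (2 * 2 ^ (c2 * length w) + 2)" "?d' w q1 as1 a'"
      "b' \<le> b * (2 * 2 ^ (c2 * length w) + 2)" "?d' w q2 as2 b'" by blast
    have "?d' w q as (Suc (a' + b'))"
      by (rule drv.rule[OF _ _ _ _ _ _ _ a(2,4)]) (use rule.hyps in \<open>auto simp: Q'_def R'_def K'_def\<close>)
    moreover have "Suc (a' + b') \<le> Suc (a + b) * (2 * 2 ^ (c2 * length w) + 2)"
      using a(1,3) by (simp add: algebra_simps)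
    ultimately show ?case by blast
  qed
  have sound: "(q < Q \<longrightarrow> (\<exists>a. ?d w q as a)) \<and> (Q \<le> q \<longrightarrow> (\<exists>a. ?d2 w (q - Q) as a))"
    if "?d' w q as a" "is_string s w" for w q as a
    using that
  proof induction
    case (finished as) then show ?case using Q by (auto intro: drv.finished)
  next
    case (ask q as)
    then show ?case by (auto simp: O2_def split: if_splits intro: drv.ask)
  next
    case (rule q q1 q2 as1 as2 as a b)
    \<comment> \<open>Rules of the inner system applied at its own final state fall under the third
      case, where the claim holds because that state needs no proof.\<close>
    from rule.hyps(7) consider "q < Q" "q1 < Q" "q2 < Q" "R w q as q1 as1 q2 as2"
      | "q = p" "q1 = Q + 1" "as1 = as" "q2 = 0" | "q = Q"
      | "Q < q" "Q \<le> q1" "Q \<le> q2" "R2 w (q - Q) as (q1 - Q) as1 (q2 - Q) as2"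
      unfolding R'_def by force
    then show ?case
    proof cases
      case 1
      then show ?thesis using rule by (auto simp: K'_def intro!: drv.rule)
    next
      case 2
      then obtain a where "?d2 w 1 as a" using rule by auto
      then have "O' p w as" using S2 rule 2 Q unfolding sys_def by (auto simp: K'_def)
      then show ?thesis using 2 p by (auto intro: drv.ask)
    next
      case 3
      then show ?thesis by (auto intro: drv.finished)
    next
      case 4
      then obtain a b where "?d2 w (q1 - Q) as1 a" "?d2 w (q2 - Q) as2 b" using rule by auto
      then have "?d2 w (q - Q) as (Suc (a + b))"
        using rule 4 by (intro drv.rule[of _ _ "q1 - Q" "q2 - Q" _ _ as1 as2]) (auto simp: K'_def Q'_def)
      then show ?thesis using 4 by auto
    qed
  qed
  have "sys s O2 ks P Q' K' R' (c + c2 + 2)"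
    unfolding sys_def
  proof (intro conjI allI impI)
    show "1 < Q'" "K' 1 = ks" using Q by (auto simp: Q'_def K'_def)
  next
    fix w as assume w: "is_string s w" "okr w ks as" "P w as"
    then obtain a where a: "a \<le> 2 ^ (c * length w)" "?d w 1 as a"
      using S unfolding sys_def by blast
    then obtain a' where a': "a' \<le> a * (2 * 2 ^ (c2 * length w) + 2)" "?d' w 1 as a'"
      using main w Q by blast
    have 4: "(4::nat) \<le> 2 ^ (2 * length w)"
      using is_string_pos[OF w(1)] power_increasing[of 2 "2 * length w" "2::nat"] by (cases "length w") auto
    have "a * (2 * 2 ^ (c2 * length w) + 2) \<le> 2 ^ (c * length w) * (2 ^ (c2 * length w) * 4)"
      using a(1) by (intro mult_mono) auto
    also have "\<dots> \<le> 2 ^ (c * length w) * (2 ^ (c2 * length w) * 2 ^ (2 * length w))"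
      using 4 by (intro mult_mono) auto
    finally have "a * (2 * 2 ^ (c2 * length w) + 2) \<le> 2 ^ ((c + c2 + 2) * length w)"
      by (simp only: add_mult_distrib power_add mult.assoc)
    then show "\<exists>a\<le>2 ^ ((c + c2 + 2) * length w). ?d' w 1 as a" using a' le_trans by blast
  next
    fix w as a assume "is_string s w" "okr w ks as" "?d' w 1 as a"
    then show "P w as" using sound[of w 1 as a] S Q unfolding sys_def by blast
  qed (use fo in blast)
  moreover have "O2 = (\<lambda>q w as. q < Q \<and> q \<noteq> p \<and> O' q w as)" by (simp add: O2_def fun_eq_iff)
  ultimately show ?thesis by (intro exI[of _ Q'] exI[of _ K'] exI[of _ R'] exI[of _ "c + c2 + 2"]) (auto simp: Q'_def K'_def)
qed

text \<open>\<open>oracle_elim\<close> is applied to the oracle states one after the other. New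
  states are numbered above the old ones, so the widths at the remaining oracle states do not
  change, and the fixed number of eliminations keeps the size of the form \<open>2 ^ O(n)\<close>.
  This is the tool for the closure properties: it suffices to give a small system that asks about
  the given relations.\<close>

lemma sys_pdef:
  assumes S: "sys s O' ks P Q K R c" and Or: "\<And>q. 0 < q \<Longrightarrow> q < Q \<Longrightarrow> pdef s (K q) (O' q)"
  shows "pdef s ks P"
proof -
  have "\<exists>Q' K' R' c'. sys s (\<lambda>q w as. Suc r \<le> q \<and> q < Q \<and> O' q w as) ks P Q' K' R' c' \<and> Q \<le> Q' \<and> (\<forall>q<Q. K' q = K q)"
    if "r < Q" for r
    using that
  proof (induction r)
    case 0
    have "drv (\<lambda>q w as. Suc 0 \<le> q \<and> q < Q \<and> O' q w as) Q K R w q as a \<longleftrightarrow> drv O' Q K R w q as a" for w q as a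
    proof
      show "drv (\<lambda>q w as. Suc 0 \<le> q \<and> q < Q \<and> O' q w as) Q K R w q as a \<Longrightarrow> drv O' Q K R w q as a"
        by (induction rule: drv.induct) (auto intro: drv.intros drv.ask[unfolded One_nat_def])
      show "drv O' Q K R w q as a \<Longrightarrow> drv (\<lambda>q w as. Suc 0 \<le> q \<and> q < Q \<and> O' q w as) Q K R w q as a"
      proof (induction rule: drv.induct)
        case (ask q as)
        then show ?case by (intro drv.ask) auto
      qed (auto intro: drv.intros)
    qed
    then have "sys s (\<lambda>q w as. Suc 0 \<le> q \<and> q < Q \<and> O' q w as) ks P Q K R c"
      using S unfolding sys_def by simp
    then show ?case by blast
  next
    case (Suc r)
    then obtain Q' K' R' c' where S': "sys s (\<lambda>q w as. Suc r \<le> q \<and> q < Q \<and> O' q w as) ks P Q' K' R' c'"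
      "Q \<le> Q'" "\<forall>q<Q. K' q = K q" by auto
    have "pdef s (K' (Suc r)) (\<lambda>w as. Suc r \<le> Suc r \<and> Suc r < Q \<and> O' (Suc r) w as)"
      using Or[of "Suc r"] Suc.prems S' by simp
    then obtain Q2 K2 R2 c2 where S2: "sys s (\<lambda>q w as. q < Q' \<and> q \<noteq> Suc r \<and> Suc r \<le> q \<and> q < Q \<and> O' q w as) ks P Q2 K2 R2 c2"
      "Q' \<le> Q2" "\<forall>q<Q'. K2 q = K' q"
      using oracle_elim[OF S'(1), of "Suc r"] S' Suc.prems by auto
    have "(\<lambda>q w as. q < Q' \<and> q \<noteq> Suc r \<and> Suc r \<le> q \<and> q < Q \<and> O' q w as) = (\<lambda>q w as. Suc (Suc r) \<le> q \<and> q < Q \<and> O' q w as)"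
      using S'(2) by (auto simp: fun_eq_iff)
    then have "sys s (\<lambda>q w as. Suc (Suc r) \<le> q \<and> q < Q \<and> O' q w as) ks P Q2 K2 R2 c2" using S2(1) by simp
    moreover have "Q \<le> Q2" "\<forall>q<Q. K2 q = K q" using S2(2,3) S'(2,3) by auto
    ultimately show ?case by blast
  qed
  from this[of "Q - 1"] S obtain Q' K' R' c' where
    "sys s (\<lambda>q w as. Suc (Q - 1) \<le> q \<and> q < Q \<and> O' q w as) ks P Q' K' R' c'"
    unfolding sys_def by auto
  moreover have "(\<lambda>q (w :: nat list) (as :: nat list). Suc (Q - 1) \<le> q \<and> q < Q \<and> O' q w as) = no_oracle"
    by (auto simp: fun_eq_iff)
  ultimately show ?thesis unfolding pdef_def by auto
qed

subsection \<open>Closure properties\<close>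

lemma fodef_guard: "(c \<Longrightarrow> fodef s P) \<Longrightarrow> fodef s (\<lambda>w e. c \<and> P w e)"
  by (cases c) (simp_all add: fodef_const)

lemma nums_Nil [simp]: "nums w e [] = []" by (simp add: nums_def)

lemma nums_Cons [simp]: "nums w e (v # vs) = wnum w e v # nums w e vs" by (simp add: nums_def)

lemma nums_append [simp]: "nums w e (us @ vs) = nums w e us @ nums w e vs" by (simp add: nums_def)

lemma drv_step:
  assumes "drv O' Q K R w q as a" "0 < q" "\<not> O' q w as"
  obtains q1 as1 q2 as2 a1 a2 where "q1 < Q" "q2 < Q" "okr w (K q1) as1" "okr w (K q2) as2"
    "R w q as q1 as1 q2 as2" "drv O' Q K R w q1 as1 a1" "drv O' Q K R w q2 as2 a2" "a = Suc (a1 + a2)"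
  using assms by (cases rule: drv.cases) auto

lemma drv_asked:
  assumes "drv O' Q K R w q as a" "0 < q" "\<And>q1 as1 q2 as2. \<not> R w q as q1 as1 q2 as2"
  shows "O' q w as"
  using assms by (cases rule: drv.cases) auto

lemma pdef_fo:
  assumes "fr1 s ks G" shows "pdef s ks G"
proof (rule sys_pdef)
  let ?R = "\<lambda>w q as q1 (as1 :: nat list) q2 (as2 :: nat list). (q = (1::nat) \<and> q1 = (0::nat) \<and> q2 = (0::nat)) \<and> G w as"
  let ?K = "\<lambda>q::nat. if q = 1 then ks else []"
  show "sys s no_oracle ks G 2 ?K ?R 0"
    unfolding sys_def
  proof (intro conjI allI impI)
    fix q q1 q2 :: nat
    show "fr3 s (?K q) (?K q1) (?K q2) (\<lambda>w as as1 as2. ?R w q as q1 as1 q2 as2)"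
      unfolding fr3_def using assms by (intro allI impI fodef_guard) (simp add: fr1_def)
  next
    fix w as assume "G w as"
    then have "drv no_oracle 2 ?K ?R w 1 as (Suc (0 + 0))"
      by (intro drv.rule[of _ _ 0 0 _ _ "[]" "[]"] drv.finished) auto
    then show "\<exists>a\<le>2 ^ (0 * length w). drv no_oracle 2 ?K ?R w 1 as a"
      by (intro exI[of _ 1]) simp
  next
    fix w as a assume "drv no_oracle 2 ?K ?R w 1 as a"
    then show "G w as" by (rule drv_step) auto
  qed simp_all
  show "0 < q \<Longrightarrow> q < 2 \<Longrightarrow> pdef s (?K q) (no_oracle q)" for q
    unfolding pdef_def sys_def
    by (rule exI[of _ 2], rule exI[of _ "\<lambda>_. ?K q"], rule exI[of _ "\<lambda>_ _ _ _ _ _ _. False"], rule exI[of _ 0])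
      (auto simp: fr3_def fodef_const elim: drv_step)
qed

lemma pdef_const: "pdef s ks (\<lambda>w as. c)"
  by (rule pdef_fo) (simp add: fr1_def fodef_const)

lemma two_power_ge: "0 < n \<Longrightarrow> (m::nat) \<le> 2 ^ c \<Longrightarrow> m \<le> 2 ^ (c * n)"
  by (erule le_trans) (simp add: power_increasing)

text \<open>The registers of a premise are not determined by those of the conclusion; this freedom
  is the existential quantifier.\<close>

lemma pdef_ex:
  assumes G: "fr2 s ks ks' G" and P: "pdef s ks' P"
  shows "pdef s ks (\<lambda>w as. \<exists>bs. okr w ks' bs \<and> G w as bs \<and> P w bs)"
proof (rule sys_pdef)
  let ?R = "\<lambda>w q as q1 as1 q2 (as2 :: nat list). (q = (1::nat) \<and> q1 = (2::nat) \<and> q2 = (0::nat)) \<and> G w as as1"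
  let ?K = "\<lambda>q::nat. if q = 1 then ks else if q = 2 then ks' else []"
  let ?O = "\<lambda>q w as. q = 2 \<and> P w as"
  show "sys s ?O ks (\<lambda>w as. \<exists>bs. okr w ks' bs \<and> G w as bs \<and> P w bs) 3 ?K ?R 1"
    unfolding sys_def
  proof (intro conjI allI impI)
    fix q q1 q2 :: nat
    show "fr3 s (?K q) (?K q1) (?K q2) (\<lambda>w as as1 as2. ?R w q as q1 as1 q2 as2)"
      unfolding fr3_def using G by (intro allI impI fodef_guard) (simp add: fr2_def)
  next
    fix w as assume w: "is_string s w" and "\<exists>bs. okr w ks' bs \<and> G w as bs \<and> P w bs"
    then obtain bs where "okr w ks' bs" "G w as bs" "P w bs" by blast
    then have "drv ?O 3 ?K ?R w 1 as (Suc (1 + 0))"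
      by (intro drv.rule[of _ _ 2 0 _ _ bs "[]"] drv.finished drv.ask) auto
    then show "\<exists>a\<le>2 ^ (1 * length w). drv ?O 3 ?K ?R w 1 as a"
      using two_power_ge[of "length w" 2 1] is_string_pos[OF w] by (intro exI[of _ 2]) (auto simp: numeral_2_eq_2)
  next
    fix w as a assume "drv ?O 3 ?K ?R w 1 as a"
    then show "\<exists>bs. okr w ks' bs \<and> G w as bs \<and> P w bs" by (rule drv_step) (auto dest!: drv_asked)
  qed simp_all
  show "0 < q \<Longrightarrow> q < 3 \<Longrightarrow> pdef s (?K q) (?O q)" for q
    using P by (cases "q = 2") (simp_all add: pdef_const)
qed

lemma pdef_conj:
  assumes P: "pdef s ks P" and P': "pdef s ks P'"
  shows "pdef s ks (\<lambda>w as. P w as \<and> P' w as)"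
proof (rule sys_pdef)
  let ?R = "\<lambda>w q as q1 as1 q2 (as2 :: nat list). (q = (1::nat) \<and> q1 = (2::nat) \<and> q2 = (3::nat)) \<and> as1 = as \<and> as2 = as"
  let ?K = "\<lambda>q::nat. if 0 < q then ks else []"
  let ?O = "\<lambda>q w as. q = 2 \<and> P w as \<or> q = 3 \<and> P' w as"
  show "sys s ?O ks (\<lambda>w as. P w as \<and> P' w as) 4 ?K ?R 2"
    unfolding sys_def
  proof (intro conjI allI impI)
    fix q q1 q2 :: nat
    show "fr3 s (?K q) (?K q1) (?K q2) (\<lambda>w as as1 as2. ?R w q as q1 as1 q2 as2)"
      unfolding fr3_def by (intro allI impI fodef_guard fod) auto
  next
    fix w as assume w: "is_string s w" "okr w ks as" and "P w as \<and> P' w as"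
    then have "drv ?O 4 ?K ?R w 1 as (Suc (1 + 1))"
      by (intro drv.rule[of _ _ 2 3 _ _ as as] drv.ask) auto
    then show "\<exists>a\<le>2 ^ (2 * length w). drv ?O 4 ?K ?R w 1 as a"
      using two_power_ge[of "length w" 3 2] is_string_pos[OF w(1)] by (intro exI[of _ 3]) (auto simp: numeral_3_eq_3)
  next
    fix w as a assume "drv ?O 4 ?K ?R w 1 as a"
    then have "P w as \<and> P' w as" by (rule drv_step) (auto dest!: drv_asked)
    then show "P w as" "P' w as" by auto
  qed simp_all
  show "0 < q \<Longrightarrow> q < 4 \<Longrightarrow> pdef s (?K q) (?O q)" for q
    using P P' by (cases "q = 2"; cases "q = 3") (simp_all add: pdef_const)
qed

lemma pdef_disj:
  assumes P: "pdef s ks P" and P': "pdef s ks P'"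
  shows "pdef s ks (\<lambda>w as. P w as \<or> P' w as)"
proof (rule sys_pdef)
  let ?R = "\<lambda>w q as q1 as1 q2 (as2 :: nat list). (q = (1::nat) \<and> (q1 = (2::nat) \<or> q1 = 3) \<and> q2 = (0::nat)) \<and> as1 = as"
  let ?K = "\<lambda>q::nat. if 0 < q then ks else []"
  let ?O = "\<lambda>q w as. q = 2 \<and> P w as \<or> q = 3 \<and> P' w as"
  show "sys s ?O ks (\<lambda>w as. P w as \<or> P' w as) 4 ?K ?R 1"
    unfolding sys_def
  proof (intro conjI allI impI)
    fix q q1 q2 :: nat
    show "fr3 s (?K q) (?K q1) (?K q2) (\<lambda>w as as1 as2. ?R w q as q1 as1 q2 as2)"
      unfolding fr3_def by (intro allI impI fodef_guard fod) auto
  next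
    fix w as assume w: "is_string s w" "okr w ks as" and PP: "P w as \<or> P' w as"
    have "drv ?O 4 ?K ?R w 1 as (Suc (1 + 0))"
    proof (cases "P w as")
      case True
      then show ?thesis using w by (intro drv.rule[of _ _ 2 0 _ _ as "[]"] drv.ask drv.finished) auto
    next
      case False
      then show ?thesis using w PP by (intro drv.rule[of _ _ 3 0 _ _ as "[]"] drv.ask drv.finished) auto
    qed
    then show "\<exists>a\<le>2 ^ (1 * length w). drv ?O 4 ?K ?R w 1 as a"
      using two_power_ge[of "length w" 2 1] is_string_pos[OF w(1)] by (intro exI[of _ 2]) (auto simp: numeral_2_eq_2)
  next
    fix w as a assume "drv ?O 4 ?K ?R w 1 as a"
    then show "P w as \<or> P' w as" by (rule drv_step) (auto dest!: drv_asked)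
  qed simp_all
  show "0 < q \<Longrightarrow> q < 4 \<Longrightarrow> pdef s (?K q) (?O q)" for q
    using P P' by (cases "q = 2"; cases "q = 3") (simp_all add: pdef_const)
qed

lemma pdef_all_less: "(\<And>i. i < k \<Longrightarrow> pdef s ks (P i)) \<Longrightarrow> pdef s ks (\<lambda>w as. \<forall>i<k. P i w as)" for k :: nat
proof (induction k)
  case (Suc k)
  then have "pdef s ks (\<lambda>w as. (\<forall>i<k. P i w as) \<and> P k w as)" by (intro pdef_conj) auto
  then show ?case by (rule pdef_cong) (auto simp: less_Suc_eq)
qed (simp add: pdef_const)

text \<open>A substitution is an existential quantification over the graph of \<open>g\<close>. The
  graph is definable because \<open>g\<close> is computed by \<open>f\<close> on the lists of
  variables, so that only equality of registers has to be expressed.\<close>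

lemma pdef_subst:
  assumes P: "pdef s ks' P" and f: "\<And>vs. map length vs = ks \<Longrightarrow> map length (f vs) = ks'"
    and g: "\<And>vs w e. map length vs = ks \<Longrightarrow> nums w e (f vs) = g w (nums w e vs)"
    and ok: "\<And>w as. okr w ks as \<Longrightarrow> okr w ks' (g w as)"
  shows "pdef s ks (\<lambda>w as. P w (g w as))"
proof (rule pdef_cong)
  have "fr2 s ks ks' (\<lambda>w as bs. bs = g w as)"
    unfolding fr2_def by (simp flip: g) (intro allI impI fod, simp add: f)
  then show "pdef s ks (\<lambda>w as. \<exists>bs. okr w ks' bs \<and> bs = g w as \<and> P w bs)" using P by (rule pdef_ex)
  show "P w (g w as) \<longleftrightarrow> (\<exists>bs. okr w ks' bs \<and> bs = g w as \<and> P w bs)" if "okr w ks as" for w as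
    using ok[OF that] by auto
qed

lemma pdef_sel:
  assumes P: "pdef s (map (nth ks) idx) P" and i: "\<And>i. i \<in> set idx \<Longrightarrow> i < length ks"
  shows "pdef s ks (\<lambda>w as. P w (map (nth as) idx))"
proof (rule pdef_subst[OF P])
  fix vs :: "nat list list" assume l: "map length vs = ks"
  then have l': "length vs = length ks" by auto
  show "map length (map (nth vs) idx) = map (nth ks) idx" using i l by auto
  show "nums w e (map (nth vs) idx) = map (nth (nums w e vs)) idx" for w e
    using i l' by (simp add: nums_def)
qed (use i in \<open>auto simp: okr_def\<close>)

section \<open>Iteration of a definable step, and counting by a linear pass\<close>

definition iter where
  "iter S W w t u ps \<longleftrightarrow> (\<exists>h. h (0::nat) = (0::nat) \<and> h t = u \<and>
     (\<forall>i<t. S w i (h i) (h (Suc i)) ps) \<and> (\<forall>i\<le>t. h i < cap w W))"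

text \<open>State \<open>1\<close> claims that \<open>t\<close> steps lead from \<open>0\<close> to
  \<open>u\<close>; its rule guesses the value before the last step and verifies that step in state
  \<open>2\<close>. Proofs are combs of size \<open>2 * t + 1\<close>, hence exponential although
  \<open>t\<close> itself may be as large as \<open>cap w T - 1\<close>.\<close>

lemma pdef_iter:
  assumes S: "pdef s (T # W # W # ks) (\<lambda>w as. S w (as ! 0) (as ! 1) (as ! 2) (drop 3 as))"
  shows "pdef s (T # W # ks) (\<lambda>w as. iter S W w (as ! 0) (as ! 1) (drop 2 as))"
proof (rule sys_pdef)
  let ?R = "\<lambda>w q as q1 as1 q2 as2.
     (q = (1::nat) \<and> q1 = (0::nat) \<and> q2 = (0::nat)) \<and> as ! 0 = (0::nat) \<and> as ! 1 = (0::nat) \<or>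
     (q = 1 \<and> q1 = 1 \<and> q2 = 2) \<and> (\<exists>t u u' ps. as = Suc t # u' # ps \<and> as1 = t # u # ps \<and> as2 = t # u # u' # ps)"
  let ?K = "\<lambda>q::nat. if q = 1 then T # W # ks else if q = 2 then T # W # W # ks else []"
  let ?O = "\<lambda>q w as. q = 2 \<and> S w (as ! 0) (as ! 1) (as ! 2) (drop 3 as)"
  let ?d = "drv ?O 3 ?K ?R"
  show "sys s ?O (T # W # ks) (\<lambda>w as. iter S W w (as ! 0) (as ! 1) (drop 2 as)) 3 ?K ?R (Suc T)"
    unfolding sys_def
  proof (intro conjI allI impI)
    fix q q1 q2 :: nat
    show "fr3 s (?K q) (?K q1) (?K q2) (\<lambda>w as as1 as2. ?R w q as q1 as1 q2 as2)"
      unfolding fr3_def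
    proof (intro allI impI fodef_disj; rule fodef_guard)
      fix vs vs1 vs2 :: "nat list list"
      assume l: "map length vs = ?K q" "map length vs1 = ?K q1" "map length vs2 = ?K q2" and q: "q = 1 \<and> q1 = 0 \<and> q2 = 0"
      then obtain v0 v1 vs' where "vs = v0 # v1 # vs'" by (auto simp: map_eq_Cons_conv)
      then show "fodef s (\<lambda>w e. nums w e vs ! 0 = 0 \<and> nums w e vs ! 1 = 0)" by (simp, intro fod)
    next
      fix vs vs1 vs2 :: "nat list list"
      assume l: "map length vs = ?K q" "map length vs1 = ?K q1" "map length vs2 = ?K q2" and q: "q = 1 \<and> q1 = 1 \<and> q2 = 2"
      then obtain a0 a1 a2 b0 b1 b2 c0 c1 c2 c3 where v: "vs = a0 # a1 # a2" "vs1 = b0 # b1 # b2" "vs2 = c0 # c1 # c2 # c3"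
        and l': "length a0 = T" "length a1 = W" "map length a2 = ks"
        "length b0 = T" "length b1 = W" "map length b2 = ks"
        "length c0 = T" "length c1 = W" "length c2 = W" "map length c3 = ks" by (auto simp: map_eq_Cons_conv)
      have "fodef s (\<lambda>w e. wnum w e a0 = Suc (wnum w e b0) \<and> nums w e b2 = nums w e a2 \<and>
          wnum w e c0 = wnum w e b0 \<and> wnum w e c1 = wnum w e b1 \<and>
          wnum w e c2 = wnum w e a1 \<and> nums w e c3 = nums w e a2)"
        by (intro fod) (simp_all add: l')
      then show "fodef s (\<lambda>w e. \<exists>t u u' ps. nums w e vs = Suc t # u' # ps \<and> nums w e vs1 = t # u # ps \<and> nums w e vs2 = t # u # u' # ps)"
        by (rule fodef_cong) (auto simp: v)
    qed
  next
    fix w as assume w: "is_string s w" "okr w (T # W # ks) as" and it: "iter S W w (as ! 0) (as ! 1) (drop 2 as)"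
    obtain t u ps where as: "as = t # u # ps" and t: "t < cap w T" and ps: "okr w ks ps"
      using w(2) by (auto simp: okr_Cons)
    obtain h where h: "h 0 = 0" "h t = u" "\<And>i. i < t \<Longrightarrow> S w i (h i) (h (Suc i)) ps" "\<And>i. i \<le> t \<Longrightarrow> h i < cap w W"
      using it as by (auto simp: iter_def)
    have "?d w 1 (i # h i # ps) (2 * i + 1)" if "i \<le> t" for i
      using that
    proof (induction i)
      case 0
      have "?d w 1 (0 # h 0 # ps) (Suc (0 + 0))"
        by (rule drv.rule[of _ _ 0 0 _ _ "[]" "[]"]) (auto simp: h intro: drv.finished)
      then show ?case by simp
    next
      case (Suc i)
      then have "?d w 1 (i # h i # ps) (2 * i + 1)" by simp
      moreover have "?d w 2 (i # h i # h (Suc i) # ps) 1" using h(3)[of i] Suc by (intro drv.ask) auto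
      ultimately have "?d w 1 (Suc i # h (Suc i) # ps) (Suc (2 * i + 1 + 1))"
        using t h(4)[of i] h(4)[of "Suc i"] Suc.prems ps by (intro drv.rule[of _ _ 1 2]) auto
      then show ?case by simp
    qed
    then have "?d w 1 as (2 * t + 1)" using as h by auto
    moreover have "2 * t + 1 \<le> 2 ^ (Suc T * length w)"
    proof -
      have 2: "(2::nat) \<le> 2 ^ length w"
        using is_string_pos[OF w(1)] power_increasing[of 1 "length w" "2::nat"] by (cases "length w") auto
      have "2 * t + 1 \<le> 2 * cap w T" using t by simp
      also have "\<dots> \<le> 2 ^ length w * cap w T" using 2 by (rule mult_right_mono) simp
      finally show ?thesis by (simp add: power_add mult.commute)
    qed
    ultimately show "\<exists>a\<le>2 ^ (Suc T * length w). ?d w 1 as a" by blast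
  next
    have *: "?d w q as a \<Longrightarrow> q = 1 \<Longrightarrow> okr w (T # W # ks) as \<Longrightarrow> iter S W w (as ! 0) (as ! 1) (drop 2 as)" for w q as a
    proof (induction rule: drv.induct)
      case (rule q q1 q2 as1 as2 as a b)
      from rule.hyps(7) rule.prems consider "as ! 0 = 0" "as ! 1 = 0"
        | t u u' ps where "q1 = 1" "q2 = 2" "as = Suc t # u' # ps" "as1 = t # u # ps" "as2 = t # u # u' # ps" by auto
      then show ?case
      proof cases
        case 1
        then show ?thesis by (auto simp: iter_def intro!: exI[of _ "\<lambda>_. 0"])
      next
        case 2
        have "iter S W w t u ps" using rule 2 by simp
        then obtain h where h: "h 0 = 0" "h t = u" "\<And>i. i < t \<Longrightarrow> S w i (h i) (h (Suc i)) ps" "\<And>i. i \<le> t \<Longrightarrow> h i < cap w W"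
          by (auto simp: iter_def)
        have "S w t u u' ps" using drv_asked[OF rule.hyps(9)] 2 by simp
        then have "iter S W w (Suc t) u' ps" unfolding iter_def using h rule.prems 2
          by (intro exI[of _ "h(Suc t := u')"]) (auto simp: less_Suc_eq le_Suc_eq)
        then show ?thesis using 2 by simp
      qed
    qed simp_all
    fix w as a assume "okr w (T # W # ks) as" "?d w 1 as a"
    then show "iter S W w (as ! 0) (as ! 1) (drop 2 as)" using * by blast
  qed simp_all
  show "0 < q \<Longrightarrow> q < 3 \<Longrightarrow> pdef s (?K q) (?O q)" for q
    using S by (cases "q = 2") (simp_all add: pdef_const)
qed

text \<open>\<open>A\<close> justifies counting a position and \<open>B\<close> justifies passing
  over it; they may overlap, so \<open>u\<close> need not be unique. The largest number
  \<open>cap w W - 1\<close> is left out because it is the number of steps of the pass and must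
  itself fit into a register of width \<open>W\<close>.\<close>

definition cnt where
  "cnt A B W w u ps \<longleftrightarrow> (\<exists>D\<subseteq>{..<cap w W - 1 :: nat}. (\<forall>p\<in>D. A w p ps) \<and>
     (\<forall>p<cap w W - 1. p \<notin> D \<longrightarrow> B w p ps) \<and> card D = u)"

lemma iter_cnt:
  assumes u: "u < cap w W"
  shows "iter (\<lambda>w p q q' ps. A w p ps \<and> q' = Suc q \<or> B w p ps \<and> q' = q) W w (cap w W - 1) u ps \<longleftrightarrow> cnt A B W w u ps"
    (is "iter ?S W w ?M u ps \<longleftrightarrow> _")
proof
  assume "iter ?S W w ?M u ps"
  then obtain h where h: "h 0 = 0" "h ?M = u" "\<And>i. i < ?M \<Longrightarrow> ?S w i (h i) (h (Suc i)) ps"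
    by (auto simp: iter_def)
  define D where "D = {p. p < ?M \<and> A w p ps \<and> h (Suc p) = Suc (h p)}"
  have "card (D \<inter> {..<i}) = h i" if "i \<le> ?M" for i
    using that
  proof (induction i)
    case (Suc i)
    then have i: "i < ?M" by simp
    show ?case
    proof (cases "i \<in> D")
      case True
      then have "D \<inter> {..<Suc i} = insert i (D \<inter> {..<i})" by auto
      then show ?thesis using Suc True by (simp add: D_def)
    next
      case False
      then have "D \<inter> {..<Suc i} = D \<inter> {..<i}" by (auto simp: less_Suc_eq)
      moreover have "h (Suc i) = h i" using False h(3)[OF i] i unfolding D_def by blast
      ultimately show ?thesis using Suc.IH i by simp
    qed
  qed (simp add: h(1))
  moreover have "D \<inter> {..<?M} = D" by (auto simp: D_def)
  ultimately have "card D = u" using h(2) by (metis le_refl)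
  then show "cnt A B W w u ps" unfolding cnt_def
  proof (intro exI[of _ D] conjI allI ballI impI)
    show "B w p ps" if "p < ?M" "p \<notin> D" for p
      using h(3)[OF that(1)] that unfolding D_def by blast
  qed (use \<open>card D = u\<close> in \<open>auto simp: D_def\<close>)
next
  assume "cnt A B W w u ps"
  then obtain D where D: "D \<subseteq> {..<?M}" "\<And>p. p \<in> D \<Longrightarrow> A w p ps" "\<And>p. p < ?M \<Longrightarrow> p \<notin> D \<Longrightarrow> B w p ps" "card D = u"
    unfolding cnt_def by blast
  have fin: "finite D" using D(1) finite_subset by blast
  have "?S w i (card (D \<inter> {..<i})) (card (D \<inter> {..<Suc i})) ps" if i: "i < ?M" for i
  proof (cases "i \<in> D")
    case True
    then have "D \<inter> {..<Suc i} = insert i (D \<inter> {..<i})" by auto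
    then show ?thesis using True D by simp
  next
    case False
    then have "D \<inter> {..<Suc i} = D \<inter> {..<i}" by (auto simp: less_Suc_eq)
    then show ?thesis using False D i by simp
  qed
  moreover have "D \<inter> {..<?M} = D" using D(1) by auto
  moreover have "card (D \<inter> {..<i}) < cap w W" for i
    using card_mono[OF fin, of "D \<inter> {..<i}"] D(4) u by simp
  ultimately show "iter ?S W w ?M u ps"
    unfolding iter_def using D(4) by (intro exI[of _ "\<lambda>i. card (D \<inter> {..<i})"]) auto
qed

lemma pdef_cnt:
  assumes A: "pdef s (W # ks) (\<lambda>w as. A w (as ! 0) (drop 1 as))" and B: "pdef s (W # ks) (\<lambda>w as. B w (as ! 0) (drop 1 as))"
  shows "pdef s (W # ks) (\<lambda>w as. cnt A B W w (as ! 0) (drop 1 as))"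
proof -
  let ?S = "\<lambda>w p q q' ps. A w p ps \<and> q' = Suc q \<or> B w p ps \<and> q' = (q::nat)"
  have sub: "pdef s (W # W # W # ks) (\<lambda>w as. P w (as ! 0) (drop 3 as))"
    if "pdef s (W # ks) (\<lambda>w as. P w (as ! 0) (drop 1 as))" for P
  proof -
    have "pdef s (W # W # W # ks) (\<lambda>w as. P w ((as ! 0 # drop 3 as) ! 0) (drop 1 (as ! 0 # drop 3 as)))"
      by (rule pdef_subst[OF that, where f = "\<lambda>vs. hd vs # drop 3 vs" and g = "\<lambda>w as. as ! 0 # drop 3 as"])
        (auto simp: map_eq_Cons_conv okr_Cons)
    then show ?thesis by simp
  qed
  have fo: "fr1 s (W # W # W # ks) (\<lambda>w as. as ! 2 = Suc (as ! 1))" "fr1 s (W # W # W # ks) (\<lambda>w as. as ! 2 = as ! 1)"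
    unfolding fr1_def by (auto simp: map_eq_Cons_conv intro!: fod)
  have "pdef s (W # W # W # ks) (\<lambda>w as. A w (as ! 0) (drop 3 as) \<and> as ! 2 = Suc (as ! 1) \<or> B w (as ! 0) (drop 3 as) \<and> as ! 2 = as ! 1)"
    by (intro pdef_disj pdef_conj sub A B pdef_fo fo)
  then have it: "pdef s (W # W # ks) (\<lambda>w as. iter ?S W w (as ! 0) (as ! 1) (drop 2 as))"
    by (rule pdef_iter)
  have G: "fr2 s (W # ks) (W # W # ks) (\<lambda>w as bs. Suc (bs ! 0) = cap w W \<and> drop 1 bs = as)"
    unfolding fr2_def by (auto simp: map_eq_Cons_conv intro!: fod)
  show ?thesis
  proof (rule pdef_cong[OF pdef_ex[OF G it]])
    fix w as assume "okr w (W # ks) as"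
    then obtain u ps where as: "as = u # ps" and u: "u < cap w W" "okr w ks ps" by (auto simp: okr_Cons)
    have "(\<exists>bs. okr w (W # W # ks) bs \<and> (Suc (bs ! 0) = cap w W \<and> drop 1 bs = as) \<and>
        iter ?S W w (bs ! 0) (bs ! 1) (drop 2 bs)) \<longleftrightarrow> iter ?S W w (cap w W - 1) u ps"
      (is "?L = ?R")
    proof
      assume ?L
      then obtain t where "Suc t = cap w W" "iter ?S W w t u ps" by (auto simp: okr_Cons as)
      moreover from this have "t = cap w W - 1" by simp
      ultimately show ?R by simp
    next
      assume ?R
      then show ?L using u by (intro exI[of _ "(cap w W - 1) # u # ps"]) (simp add: as)
    qed
    then show "cnt A B W w (as ! 0) (drop 1 as) \<longleftrightarrow> (\<exists>bs. okr w (W # W # ks) bs \<and> (Suc (bs ! 0) = cap w W \<and> drop 1 bs = as) \<and>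
        iter ?S W w (bs ! 0) (bs ! 1) (drop 2 bs))"
      using iter_cnt[OF u(1), where A = A and B = B and ps = ps] by (simp add: as)
  qed
qed

subsection \<open>Normal form of proof systems\<close>

fun unpack :: "nat \<Rightarrow> nat list \<Rightarrow> nat \<Rightarrow> nat list" where
  "unpack n [] z = []"
| "unpack n (k # ks) z = (z div 2 ^ (n * sum_list ks) mod 2 ^ (n * k)) # unpack n ks z"

fun pack :: "nat \<Rightarrow> nat list \<Rightarrow> nat list \<Rightarrow> nat" where
  "pack n (k # ks) (a # as) = a * 2 ^ (n * sum_list ks) + pack n ks as"
| "pack n ks as = 0"

text \<open>The variables are cut off from the end of the list, as \<open>unpack\<close> reads a
  number from its low digits: whatever stands in front, such as the tag of a state, is ignored by
  both.\<close>

fun slices :: "nat list \<Rightarrow> nat list \<Rightarrow> nat list list" where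
  "slices [] vs = []"
| "slices (k # ks) vs = take k (drop (length vs - (k + sum_list ks)) vs) # slices ks vs"

lemma length_unpack [simp]: "length (unpack n ks z) = length ks"
  by (induction ks) auto

lemma okr_unpack: "okr w ks (unpack (length w) ks z)"
  by (induction ks) auto

lemma num_slice:
  assumes "k + j \<le> length vs"
  shows "num n e (take k (drop (length vs - (k + j)) vs)) = num n e vs div 2 ^ (n * j) mod 2 ^ (n * k)"
proof -
  define us where "us = take (length vs - (k + j)) vs"
  define ts where "ts = take k (drop (length vs - (k + j)) vs)"
  define rs where "rs = drop (length vs - j) vs"
  have l: "length ts = k" "length rs = j" using assms by (auto simp: ts_def rs_def)
  have "drop k (drop (length vs - (k + j)) vs) = rs" using assms by (simp add: rs_def)
  then have vs: "vs = us @ ts @ rs" unfolding us_def ts_def by (metis append_take_drop_id)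
  have "num n e vs div 2 ^ (n * j) = num n e us * 2 ^ (n * k) + num n e ts"
    using num_bound[of n e rs] unfolding vs append_assoc[symmetric] num_append[of _ _ "us @ ts"] l by (simp add: num_append l)
  then show ?thesis using num_bound[of n e ts] by (simp add: l flip: ts_def)
qed

lemma nums_slices: "sum_list ks \<le> length vs \<Longrightarrow> nums w e (slices ks vs) = unpack (length w) ks (wnum w e vs)"
  by (induction ks) (simp_all add: num_slice)

lemma length_slices: "sum_list ks \<le> length vs \<Longrightarrow> map length (slices ks vs) = ks"
  by (induction ks) auto

lemma pack_bound: "okr w ks as \<Longrightarrow> pack (length w) ks as < cap w (sum_list ks)"
proof (induction ks arbitrary: as)
  case (Cons k ks)
  then obtain a as' where as: "as = a # as'" "a < cap w k" "okr w ks as'" by (auto simp: okr_Cons)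
  let ?M = "cap w (sum_list ks) :: nat"
  have "a * ?M + pack (length w) ks as' < (a + 1) * ?M" using Cons.IH[OF as(3)] by simp
  also have "\<dots> \<le> cap w k * ?M" using as by (intro mult_right_mono) auto
  finally show ?case by (simp add: as power_add algebra_simps)
qed simp

lemma unpack_pack: "okr w ks as \<Longrightarrow> unpack (length w) ks (x * cap w (sum_list ks) + pack (length w) ks as) = as"
proof (induction ks arbitrary: as x)
  case (Cons k ks)
  then obtain a as' where as: "as = a # as'" "a < cap w k" "okr w ks as'" by (auto simp: okr_Cons)
  have *: "x * cap w (sum_list (k # ks)) + pack (length w) (k # ks) as =
    (x * cap w k + a) * cap w (sum_list ks) + pack (length w) ks as'"
    by (simp add: as power_add algebra_simps)
  show ?case unfolding unpack.simps * Cons.IH[OF as(3)] using pack_bound[OF as(3)] as by simp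
qed simp

lemma pdef_unpack:
  assumes "pdef s (ws @ ks) P"
  shows "pdef s (sum_list ws # ks) (\<lambda>w as. P w (unpack (length w) ws (as ! 0) @ drop 1 as))"
proof (rule pdef_subst[OF assms])
  fix vs :: "nat list list" assume "map length vs = sum_list ws # ks"
  then obtain v vs' where vs: "vs = v # vs'" "length v = sum_list ws" "map length vs' = ks" by (auto simp: map_eq_Cons_conv)
  show "map length (slices ws (hd vs) @ tl vs) = ws @ ks" using vs by (simp add: length_slices)
  show "nums w e (slices ws (hd vs) @ tl vs) = unpack (length w) ws (nums w e vs ! 0) @ drop 1 (nums w e vs)" for w e
    using vs by (simp add: nums_slices)
next
  fix w as assume "okr w (sum_list ws # ks) as"
  then obtain a as' where "as = a # as'" "okr w ks as'" by (auto simp: okr_Cons)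
  then show "okr w (ws @ ks) (unpack (length w) ws (as ! 0) @ drop 1 as)"
    using okr_unpack[of w ws a] by (auto simp: okr_def nth_append)
qed

text \<open>In the normal form there are neither states nor separate registers: a configuration is one number of width \<open>Suc k\<close>,
and it is final iff the most significant of its \<open>Suc k\<close> sets is empty.\<close>

inductive psz :: "nat \<Rightarrow> (nat list \<Rightarrow> nat \<Rightarrow> nat \<Rightarrow> nat \<Rightarrow> bool) \<Rightarrow> nat list \<Rightarrow> nat \<Rightarrow> nat \<Rightarrow> bool" for k R w where
  finished: "z < cap w k \<Longrightarrow> psz k R w z 0"
| rule: "cap w k \<le> z \<Longrightarrow> x < cap w (Suc k) \<Longrightarrow> y < cap w (Suc k) \<Longrightarrow> R w z x y \<Longrightarrow>
    psz k R w x a \<Longrightarrow> psz k R w y b \<Longrightarrow> psz k R w z (Suc (a + b))"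

text \<open>\<open>Init\<close> is a relation and not a function because the number coding a
  configuration has digits that are not determined by the registers. For sentences, where
  \<open>ks\<close> is empty, the initial number must be unique: the first copy in the final word
  pushes exactly one configuration.\<close>

definition pure_sys where
  "pure_sys s ks P k R c Init \<longleftrightarrow>
     (\<forall>vz vx vy. length vz = Suc k \<longrightarrow> length vx = Suc k \<longrightarrow> length vy = Suc k \<longrightarrow>
        fodef s (\<lambda>w e. R w (wnum w e vz) (wnum w e vx) (wnum w e vy))) \<and>
     (\<forall>vs vz. map length vs = ks \<longrightarrow> length vz = Suc k \<longrightarrow> fodef s (\<lambda>w e. Init w (nums w e vs) (wnum w e vz))) \<and>
     (\<forall>w as. is_string s w \<longrightarrow> okr w ks as \<longrightarrow> (\<exists>z<cap w (Suc k). Init w as z)) \<and>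
     (\<forall>w as z. is_string s w \<longrightarrow> okr w ks as \<longrightarrow> Init w as z \<longrightarrow>
        cap w k \<le> z \<and> (P w as \<longrightarrow> (\<exists>a\<le>2 ^ (c * length w). psz k R w z a)) \<and> (\<forall>a. psz k R w z a \<longrightarrow> P w as)) \<and>
     (\<forall>w z z'. ks = [] \<longrightarrow> is_string s w \<longrightarrow> Init w [] z \<longrightarrow> Init w [] z' \<longrightarrow> z = z')"

text \<open>A configuration becomes \<open>Q\<close> sets that form the tag of its state, followed
  by \<open>D\<close> sets with room for the registers of any state. For a fixed state, testing the
  tag and extracting the registers are first-order, and the new rule relation is a finite
  disjunction over triples of states.\<close>

lemma pdef_pure:
  assumes "pdef s ks P"
  shows "\<exists>k R c Init. pure_sys s ks P k R c Init"
proof -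
  obtain Q K R c where S: "sys s no_oracle ks P Q K R c" using assms unfolding pdef_def by blast
  have Q: "1 < Q" "K 1 = ks" using S by (auto simp: sys_def)
  define D where "D = (\<Sum>q<Q. sum_list (K q))"
  have D: "sum_list (K q) \<le> D" if "q < Q" for q
    unfolding D_def using that by (intro member_le_sum) auto
  define k where "k = Q + D - 1"
  have k: "Suc k = Q + D" "D \<le> k" using Q by (auto simp: k_def)
  \<comment> \<open>The tag of state \<open>0\<close> consists of empty sets. For any other state
    the leading set is full, which marks the configuration as not final, and so is the set with the
    index of the state.\<close>
  define tag where "tag n q = map (\<lambda>i. if q \<noteq> 0 \<and> (i = 0 \<or> i = q) then {..<n} else {}) [0..<Q]" for n q :: nat
  define st where "st w q z \<longleftrightarrow> z div cap w D = numl (length w) (tag (length w) q)" for w :: "nat list" and q z :: nat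
  define reg where "reg w q z = unpack (length w) (K q) z" for w :: "nat list" and q z :: nat
  \<comment> \<open>The digits between the tag and the registers. They are free in general and are
    set to zero in \<open>Init\<close> to obtain a unique initial number.\<close>
  define pad where "pad w q z = z div cap w (sum_list (K q)) mod 2 ^ (length w * (D - sum_list (K q)))" for w :: "nat list" and q z :: nat
  define R' where "R' w z x y \<longleftrightarrow> (\<exists>q<Q. \<exists>q1<Q. \<exists>q2<Q. q \<noteq> 0 \<and> st w q z \<and> st w q1 x \<and> st w q2 y \<and>
     R w q (reg w q z) q1 (reg w q1 x) q2 (reg w q2 y))" for w z x y
  define Init where "Init w as z \<longleftrightarrow> st w 1 z \<and> reg w 1 z = as \<and> pad w 1 z = 0" for w as z
  have tag: "length (tag n q) = Q" "\<And>A. A \<in> set (tag n q) \<Longrightarrow> A \<subseteq> {..<n}" for n q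
    by (auto simp: tag_def split: if_splits)
  have st_inj: "q = q'" if "st w q z" "st w q' z" "q \<noteq> 0" "q' \<noteq> 0" "q' < Q" "is_string s w" for w q q' z
  proof -
    have "tag (length w) q = tag (length w) q'"
      using that numl_inj[of "tag (length w) q" "tag (length w) q'" "length w"] tag by (simp add: st_def)
    then have "tag (length w) q ! q' = tag (length w) q' ! q'" by simp
    then show ?thesis using that is_string_pos[of s w] by (auto simp: tag_def split: if_splits)
  qed
  have st0: "z < cap w k" if "st w 0 z" for w z
  proof -
    have "numl (length w) (tag (length w) 0) = 0"
      by (simp add: numl_def tag_def dv_zero snum_zero)
    then have "z < cap w D" using that by (simp add: st_def div_eq_0_iff)
    also have "\<dots> \<le> cap w k" using k by (intro power_increasing) auto
    finally show ?thesis .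
  qed
  have st1: "cap w k \<le> z" if "st w q z" "q \<noteq> 0" "is_string s w" for w q z
  proof -
    have "tag (length w) q = {..<length w} # tl (tag (length w) q)"
      using that Q by (simp add: tag_def upt_conv_Cons)
    moreover have "length (tl (tag (length w) q)) = Q - 1" by (simp add: tag)
    moreover have "snum (length w) {..<length w} \<noteq> 0"
      using is_string_pos[OF that(3)] by (subst snum_zero) auto
    ultimately have "cap w (Q - 1) \<le> numl (length w) (tag (length w) q)"
      using numl_append[of "length w" "[{..<length w}]" "tl (tag (length w) q)"] by (simp add: numl_def[of _ "[_]"] trans_le_add1)
    then have "cap w (Q - 1) * cap w D \<le> z"
      using that(1) unfolding st_def by (metis div_times_less_eq_dividend le_trans mult_le_mono1)
    moreover have "k = Q - 1 + D" using Q by (simp add: k_def)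
    ultimately show ?thesis by (simp add: power_add algebra_simps)
  qed
  have ex: "\<exists>z<cap w (Suc k). st w q z \<and> reg w q z = as \<and> pad w q z = 0"
    if "q < Q" "okr w (K q) as" for w q as
  proof -
    let ?p = "pack (length w) (K q) as" and ?t = "numl (length w) (tag (length w) q)"
    let ?S = "sum_list (K q)"
    define z where "z = ?t * cap w D + ?p"
    have p: "?p < cap w ?S" using pack_bound that by blast
    also have "\<dots> \<le> cap w D" using D[OF that(1)] by (intro power_increasing) auto
    finally have pD: "?p < cap w D" .
    have "D = (D - ?S) + ?S" using D[OF that(1)] by simp
    then have e: "cap w D = (2::nat) ^ (length w * (D - ?S)) * cap w ?S"
      by (metis distrib_left power_add)
    have "z < (?t + 1) * cap w D" using pD by (simp add: z_def)
    also have "\<dots> \<le> cap w Q * cap w D"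
      using numl_bound[of "length w" "tag (length w) q"] tag(1) by (intro mult_right_mono) auto
    finally have "z < cap w (Suc k)" by (simp only: k power_add distrib_left)
    moreover have "st w q z" using pD by (simp add: st_def z_def)
    moreover have "reg w q z = as"
      unfolding reg_def z_def e mult.assoc[symmetric] by (rule unpack_pack[OF that(2)])
    moreover have "pad w q z = 0"
      unfolding pad_def z_def e mult.assoc[symmetric] using p by simp
    ultimately show ?thesis by blast
  qed
  have fst: "fodef s (\<lambda>w e. st w q (wnum w e vs))" if "length vs = Suc k" for q vs
  proof (rule fodef_cong[where P = "\<lambda>w e. \<forall>i<Q. (q \<noteq> 0 \<and> (i = 0 \<or> i = q) \<longrightarrow> e (vs ! i) = {..<length w}) \<and>
      (\<not> (q \<noteq> 0 \<and> (i = 0 \<or> i = q)) \<longrightarrow> e (vs ! i) = {})"])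
    fix w e assume "is_string s w" "venv w e"
    have "length (take Q vs) = Q" "length (drop Q vs) = D" using that k by auto
    then have "wnum w e vs div cap w D = numl (length w) (map e (take Q vs))"
      using num_append[of "length w" e "take Q vs" "drop Q vs"] num_bound[of "length w" e "drop Q vs"] by (simp add: num_def)
    then have "st w q (wnum w e vs) \<longleftrightarrow> map e (take Q vs) = tag (length w) q"
      unfolding st_def using that k tag \<open>venv w e\<close> by (subst numl_inj[symmetric]) (auto simp: venvD)
    also have "\<dots> \<longleftrightarrow> (\<forall>i<Q. e (vs ! i) = tag (length w) q ! i)"
      using that k tag by (simp add: list_eq_iff_nth_eq)
    finally show "st w q (wnum w e vs) \<longleftrightarrow> (\<forall>i<Q. (q \<noteq> 0 \<and> (i = 0 \<or> i = q) \<longrightarrow> e (vs ! i) = {..<length w}) \<and>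
      (\<not> (q \<noteq> 0 \<and> (i = 0 \<or> i = q)) \<longrightarrow> e (vs ! i) = {}))"
      by (auto simp: tag_def)
  qed (intro fod)
  have freg: "nums w e (slices (K q) vs) = reg w q (wnum w e vs)" "map length (slices (K q) vs) = K q"
    if "length vs = Suc k" "q < Q" for w e q vs
    using D[OF that(2)] that k by (simp_all add: reg_def nums_slices length_slices)
  have fpad: "fodef s (\<lambda>w e. pad w q (wnum w e vs) = 0)" if "length vs = Suc k" "q < Q" for q vs
  proof -
    have "wnum w e (take (D - sum_list (K q)) (drop (length vs - (D - sum_list (K q) + sum_list (K q))) vs)) = pad w q (wnum w e vs)" for w e
      unfolding pad_def using D[OF that(2)] that k by (intro num_slice) auto
    then show ?thesis by (simp only: fodef_num_zero flip: \<open>\<And>w e. wnum w e _ = pad w q (wnum w e vs)\<close>)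
  qed
  have c: "psz k R' w z a" if "drv no_oracle Q K R w q as a" "is_string s w" "q < Q" "okr w (K q) as" "st w q z" "reg w q z = as" for w q as a z
    using that
  proof (induction arbitrary: z)
    case (finished as) then show ?case by (intro psz.finished st0)
  next
    case (rule q q1 q2 as1 as2 as a b)
    obtain x y where x: "x < cap w (Suc k)" "st w q1 x" "reg w q1 x = as1" and y: "y < cap w (Suc k)" "st w q2 y" "reg w q2 y = as2"
      using ex rule.hyps by meson
    show ?case
    proof (rule psz.rule[where x = x and y = y])
      show "R' w z x y" unfolding R'_def using rule.hyps rule.prems x y by (intro exI[of _ q] exI[of _ q1] exI[of _ q2] conjI) auto
    qed (use rule x y st1 in auto)
  qed simp
  have snd: "\<exists>a. drv no_oracle Q K R w q (reg w q z) a" if "psz k R' w z a" "is_string s w" "q < Q" "q \<noteq> 0" "st w q z" for w q z a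
    using that
  proof (induction arbitrary: q)
    case (finished z) then show ?case using st1 by fastforce
  next
    case (rule z x y a b)
    then obtain q' q1 q2 where q: "q' < Q" "q1 < Q" "q2 < Q" "q' \<noteq> 0" "st w q' z" "st w q1 x" "st w q2 y"
      "R w q' (reg w q' z) q1 (reg w q1 x) q2 (reg w q2 y)" unfolding R'_def by blast
    have "q' = q" using st_inj[OF q(5) rule.prems(4)] q rule.prems by blast
    have "\<exists>a. drv no_oracle Q K R w q1 (reg w q1 x) a" "\<exists>a. drv no_oracle Q K R w q2 (reg w q2 y) a"
      using rule.IH q rule.prems(1) by (metis drv.finished)+
    then show ?case using q rule.prems okr_unpack unfolding \<open>q' = q\<close> reg_def by (blast intro: drv.rule)
  qed
  have "pure_sys s ks P k R' c Init"
    unfolding pure_sys_def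
  proof (intro conjI allI impI)
    fix vz vx vy :: "nat list" assume l: "length vz = Suc k" "length vx = Suc k" "length vy = Suc k"
    show "fodef s (\<lambda>w e. R' w (wnum w e vz) (wnum w e vx) (wnum w e vy))"
      unfolding R'_def
    proof (intro fodef_ex_less fodef_conj fodef_const fst l)
      fix q q1 q2 assume q: "q < Q" "q1 < Q" "q2 < Q"
      show "fodef s (\<lambda>w e. R w q (reg w q (wnum w e vz)) q1 (reg w q1 (wnum w e vx)) q2 (reg w q2 (wnum w e vy)))"
        using S q freg(2)[OF l(1) q(1)] freg(2)[OF l(2) q(2)] freg(2)[OF l(3) q(3)]
        unfolding freg(1)[OF l(1) q(1), symmetric] freg(1)[OF l(2) q(2), symmetric] freg(1)[OF l(3) q(3), symmetric] sys_def fr3_def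
        by blast
    qed
  next
    fix vs :: "nat list list" and vz :: "nat list" assume l: "map length vs = ks" "length vz = Suc k"
    show "fodef s (\<lambda>w e. Init w (nums w e vs) (wnum w e vz))"
      unfolding Init_def freg(1)[OF l(2) Q(1), symmetric]
      by (intro fodef_conj fst fpad l Q fodef_nums_eq) (use freg(2)[OF l(2) Q(1)] l Q in simp)
  next
    fix w as assume "is_string s w" "okr w ks as"
    then show "\<exists>z<cap w (Suc k). Init w as z" unfolding Init_def using ex[of 1 w as] Q by simp
  next
    fix w as z assume w: "is_string s w" "okr w ks as" "Init w as z"
    then show "cap w k \<le> z" using st1 by (auto simp: Init_def)
    show "\<exists>a\<le>2 ^ (c * length w). psz k R' w z a" if "P w as"
    proof -
      have "\<exists>a\<le>2 ^ (c * length w). drv no_oracle Q K R w 1 as a"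
        using S w(1,2) that by (simp add: sys_def)
      then obtain a where "a \<le> 2 ^ (c * length w)" "drv no_oracle Q K R w 1 as a" by blast
      moreover from this have "psz k R' w z a" using w Q by (intro c[of w 1 as]) (auto simp: Init_def)
      ultimately show ?thesis by blast
    qed
    show "P w as" if "psz k R' w z a" for a
    proof -
      have "\<exists>a. drv no_oracle Q K R w 1 as a" using snd[OF that w(1) Q(1)] w by (simp add: Init_def)
      then show ?thesis using S w(1,2) by (auto simp: sys_def)
    qed
  next
    fix w z z' assume "ks = []" "Init w [] z" "Init w [] z'"
    then have "z div cap w D = z' div cap w D" "z mod cap w D = z' mod cap w D"
      using Q by (auto simp: Init_def st_def pad_def)
    then show "z = z'" by (metis div_mult_mod_eq)
  qed
  then show ?thesis by blast
qed

subsection \<open>Complementation by inductive counting\<close>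

text \<open>The difference of start time \<open>a\<close> and end time \<open>b\<close> is the exact
  size of the proof, so subproofs can be concatenated in time without adding sizes.\<close>

definition timed where
  "timed k R w c a b \<longleftrightarrow> b \<le> a \<and> psz k R w c (a - b)"

lemma psz_done: "psz k R w z a \<Longrightarrow> z < cap w k \<Longrightarrow> a = 0"
  by (auto elim: psz.cases)

lemma timed_done: "c < cap w k \<Longrightarrow> timed k R w c a b \<longleftrightarrow> a = b"
  by (auto simp: timed_def intro: psz.finished dest: psz_done)

lemma fodef_done [fod]: "length v = Suc k \<Longrightarrow> fodef s (\<lambda>w e. wnum w e v < cap w k)"
proof (rule fodef_cong[where P = "\<lambda>w e. e (hd v) = {}"])
  fix w e assume l: "length v = Suc k" and e: "venv w e"
  then obtain x vs where v: "v = x # vs" "length vs = k" by (auto simp: length_Suc_conv)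
  have "wnum w e v = snum (length w) (e x) * cap w k + wnum w e vs"
    using num_append[of "length w" e "[x]" vs] v by (simp add: num_def numl_def)
  then show "wnum w e v < cap w k \<longleftrightarrow> e (hd v) = {}"
    using num_bound[of "length w" e vs] v snum_zero[OF venvD[OF e, of x]]
      two_digit_less[of "wnum w e vs" "cap w k" 0 "snum (length w) (e x)" 1] by simp
qed (intro fod)

text \<open>Adding two clocks turns a proof of size \<open>m\<close> into a proof that starts at time \<open>b + m\<close> and ends at time \<open>b\<close>.\<close>

lemma pdef_timed:
  assumes R: "\<And>vz vx vy. length vz = Suc k \<Longrightarrow> length vx = Suc k \<Longrightarrow> length vy = Suc k \<Longrightarrow>
        fodef s (\<lambda>w e. R w (wnum w e vz) (wnum w e vx) (wnum w e vy))"
  shows "pdef s [Suc k, T, T] (\<lambda>w as. timed k R w (as ! 0) (as ! 1) (as ! 2))"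
proof -
  let ?K = "\<lambda>_ :: nat. [Suc k, T, T]"
  let ?dn = "\<lambda>w (c :: nat). c < 2 ^ (length (w :: nat list) * k)"
  \<comment> \<open>One tick pays for the rule itself; the first premise then runs to an
    intermediate time, guessed by the rule, at which the second premise starts. A final premise is
    sent to state \<open>0\<close>, which accepts all registers, so the equality of its two clocks
    is imposed here.\<close>
  let ?R = "\<lambda>w q as q1 as1 q2 as2. (q = (1::nat) \<and> q1 < (2::nat) \<and> q2 < (2::nat)) \<and> \<not> ?dn w (as ! 0) \<and>
     R w (as ! 0) (as1 ! 0) (as2 ! 0) \<and> as ! 1 = Suc (as1 ! 1) \<and> as1 ! 2 = as2 ! (1::nat) \<and> as2 ! 2 = as ! (2::nat) \<and>
     (?dn w (as1 ! 0) \<and> q1 = 0 \<and> as1 ! 1 = as1 ! 2 \<or> \<not> ?dn w (as1 ! 0) \<and> q1 = 1) \<and>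
     (?dn w (as2 ! 0) \<and> q2 = 0 \<and> as2 ! 1 = as2 ! 2 \<or> \<not> ?dn w (as2 ! 0) \<and> q2 = 1)"
  let ?d = "drv no_oracle 2 ?K ?R"
  have "pdef s [Suc k, T, T] (\<lambda>w as. \<not> ?dn w (as ! 0) \<and> timed k R w (as ! 0) (as ! 1) (as ! 2))"
  proof (rule sys_pdef)
    show "sys s no_oracle [Suc k, T, T] (\<lambda>w as. \<not> ?dn w (as ! 0) \<and> timed k R w (as ! 0) (as ! 1) (as ! 2)) 2 ?K ?R T"
      unfolding sys_def
    proof (intro conjI allI impI)
      fix q q1 q2 :: nat
      show "fr3 s (?K q) (?K q1) (?K q2) (\<lambda>w as as1 as2. ?R w q as q1 as1 q2 as2)"
        unfolding fr3_def
      proof (intro allI impI fodef_guard)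
        fix vs vs1 vs2 :: "nat list list"
        assume l: "map length vs = [Suc k, T, T]" "map length vs1 = [Suc k, T, T]" "map length vs2 = [Suc k, T, T]"
        then obtain v0 v1 v2 x0 x1 x2 y0 y1 y2 where "vs = [v0, v1, v2]" "vs1 = [x0, x1, x2]" "vs2 = [y0, y1, y2]"
          and "length v0 = Suc k" "length v1 = T" "length v2 = T" "length x0 = Suc k" "length x1 = T" "length x2 = T"
          "length y0 = Suc k" "length y1 = T" "length y2 = T" by (auto simp: map_eq_Cons_conv)
        then show "fodef s (\<lambda>w e. \<not> ?dn w (nums w e vs ! 0) \<and>
          R w (nums w e vs ! 0) (nums w e vs1 ! 0) (nums w e vs2 ! 0) \<and> nums w e vs ! 1 = Suc (nums w e vs1 ! 1) \<and>
          nums w e vs1 ! 2 = nums w e vs2 ! 1 \<and> nums w e vs2 ! 2 = nums w e vs ! 2 \<and>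
          (?dn w (nums w e vs1 ! 0) \<and> q1 = 0 \<and> nums w e vs1 ! 1 = nums w e vs1 ! 2 \<or> \<not> ?dn w (nums w e vs1 ! 0) \<and> q1 = 1) \<and>
          (?dn w (nums w e vs2 ! 0) \<and> q2 = 0 \<and> nums w e vs2 ! 1 = nums w e vs2 ! 2 \<or> \<not> ?dn w (nums w e vs2 ! 0) \<and> q2 = 1))"
          by simp (intro fod R; simp)
      qed
    next
      have *: "?d w 1 [c, b + m, b] m"
        if "psz k R w c m" "\<not> ?dn w c" "b + m < cap w T" for w c m b
        using that
      proof (induction arbitrary: b)
        case (rule z x y m1 m2)
        have x: "?d w (if ?dn w x then 0 else 1) [x, b + m2 + m1, b + m2] m1"
          using rule.IH(1)[of "b + m2"] rule.prems psz_done[OF rule.hyps(5)] by (auto intro: drv.finished)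
        have y: "?d w (if ?dn w y then 0 else 1) [y, b + m2, b] m2"
          using rule.IH(2)[of b] rule.prems psz_done[OF rule.hyps(6)] by (auto intro: drv.finished)
        show ?case
          by (rule drv.rule[OF _ _ _ _ _ _ _ x y])
            (use rule.hyps rule.prems psz_done[OF rule.hyps(5)] psz_done[OF rule.hyps(6)] in auto)
      qed simp
      fix w as
      assume w: "is_string s w" "okr w [Suc k, T, T] as" and P: "\<not> ?dn w (as ! 0) \<and> timed k R w (as ! 0) (as ! 1) (as ! 2)"
      obtain c a b where as: "as = [c, a, b]" and a: "a < cap w T" using w(2) by (auto simp: okr_Cons)
      have "b \<le> a" "psz k R w c (a - b)" "\<not> ?dn w c" using P as by (auto simp: timed_def)
      then have "?d w 1 as (a - b)" using *[of w c "a - b" b] a as by simp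
      moreover have "a - b \<le> 2 ^ (T * length w)" using a by (simp add: mult.commute)
      ultimately show "\<exists>a\<le>2 ^ (T * length w). ?d w 1 as a" by blast
    next
      have *: "timed k R w (as ! 0) (as ! 1) (as ! 2) \<and> \<not> ?dn w (as ! 0)" if "?d w q as m" "q = 1" for w as q m
        using that
      proof induction
        case (rule q q1 q2 as1 as2 as a b)
        have x: "timed k R w (as1 ! 0) (as1 ! 1) (as1 ! 2)"
          using rule.hyps(7) rule.IH(1) by (auto simp: timed_done)
        have y: "timed k R w (as2 ! 0) (as2 ! 1) (as2 ! 2)"
          using rule.hyps(7) rule.IH(2) by (auto simp: timed_done)
        have R: "R w (as ! 0) (as1 ! 0) (as2 ! 0)" "\<not> ?dn w (as ! 0)" "as ! 1 = Suc (as1 ! 1)" "as1 ! 2 = as2 ! 1" "as2 ! 2 = as ! 2"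
          using rule.hyps(7) by auto
        have "as1 ! 0 < cap w (Suc k)" "as2 ! 0 < cap w (Suc k)"
          using rule.hyps(5,6) by (auto simp: okr_Cons)
        then have p: "psz k R w (as ! 0) (Suc ((as1 ! 1 - as1 ! 2) + (as2 ! 1 - as2 ! 2)))"
          using x y R by (intro psz.rule[where x = "as1 ! 0" and y = "as2 ! 0"]) (auto simp: timed_def)
        have e: "Suc ((as1 ! 1 - as1 ! 2) + (as2 ! 1 - as2 ! 2)) = as ! 1 - as ! 2"
          using x y R by (auto simp: timed_def)
        have "as ! 2 \<le> as ! 1" using x y R by (auto simp: timed_def)
        then show ?case using p[unfolded e] R(2) by (simp only: timed_def simp_thms)
      qed auto
      fix w as a assume "?d w 1 as a"
      then show "\<not> ?dn w (as ! 0)" "timed k R w (as ! 0) (as ! 1) (as ! 2)" using * by blast+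
    qed simp_all
  qed (simp add: pdef_const)
  moreover have "pdef s [Suc k, T, T] (\<lambda>w as. ?dn w (as ! 0) \<and> as ! 1 = as ! 2)"
    by (rule pdef_fo) (auto simp: fr1_def map_eq_Cons_conv intro!: fod)
  ultimately have "pdef s [Suc k, T, T] (\<lambda>w as. (?dn w (as ! 0) \<and> as ! 1 = as ! 2) \<or>
      (\<not> ?dn w (as ! 0) \<and> timed k R w (as ! 0) (as ! 1) (as ! 2)))" by (intro pdef_disj)
  then show ?thesis by (rule pdef_cong) (auto simp: timed_done)
qed

lemma fr1_conj: "fr1 s ks P \<Longrightarrow> fr1 s ks Q \<Longrightarrow> fr1 s ks (\<lambda>w as. P w as \<and> Q w as)"
  by (simp add: fr1_def fodef_conj)

lemma fr1_not: "fr1 s ks P \<Longrightarrow> fr1 s ks (\<lambda>w as. \<not> P w as)"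
  by (simp add: fr1_def fodef_not)

lemma fr1_atom:
  assumes "\<And>vs. length vs = length ks \<Longrightarrow> (\<And>i. i < length ks \<Longrightarrow> length (vs ! i) = ks ! i) \<Longrightarrow> fodef s (\<lambda>w e. Q w (nums w e vs))"
  shows "fr1 s ks Q"
  unfolding fr1_def
proof (intro allI impI assms)
  fix vs :: "nat list list" assume "map length vs = ks"
  then show "length vs = length ks" "\<And>i. i < length ks \<Longrightarrow> length (vs ! i) = ks ! i" by auto
qed

lemma fr1_less: "i < length ks \<Longrightarrow> j < length ks \<Longrightarrow> ks ! i = ks ! j \<Longrightarrow> fr1 s ks (\<lambda>w as. as ! i < as ! j)"
  by (rule fr1_atom) (simp add: fod)

lemma fr1_le: "i < length ks \<Longrightarrow> j < length ks \<Longrightarrow> ks ! i = ks ! j \<Longrightarrow> fr1 s ks (\<lambda>w as. as ! i \<le> as ! j)"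
  by (rule fr1_atom) (simp add: fod)

lemma fr1_eq: "i < length ks \<Longrightarrow> j < length ks \<Longrightarrow> ks ! i = ks ! j \<Longrightarrow> fr1 s ks (\<lambda>w as. as ! i = as ! j)"
  by (rule fr1_atom) (simp add: fod)

lemma fr1_Suc: "i < length ks \<Longrightarrow> j < length ks \<Longrightarrow> ks ! i = ks ! j \<Longrightarrow> fr1 s ks (\<lambda>w as. as ! i = Suc (as ! j))"
  by (rule fr1_atom) (simp add: fod)

lemma fr1_zero: "i < length ks \<Longrightarrow> fr1 s ks (\<lambda>w as. as ! i = 0)"
  by (rule fr1_atom) (simp add: fod)

lemma fr1_done: "i < length ks \<Longrightarrow> ks ! i = Suc k \<Longrightarrow> fr1 s ks (\<lambda>w as. as ! i < cap w k)"
  by (rule fr1_atom) (simp add: fod)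

lemma pdef_cnt_unpack:
  assumes "pdef s (ws @ ks) A" "pdef s (ws @ ks) B"
  shows "pdef s (sum_list ws # ks) (\<lambda>w as. cnt (\<lambda>w p ps. A w (unpack (length w) ws p @ ps)) (\<lambda>w p ps. B w (unpack (length w) ws p @ ps))
     (sum_list ws) w (as ! 0) (drop 1 as))"
  by (intro pdef_cnt pdef_unpack assms)

text \<open>If \<open>A\<close> and \<open>B\<close> are complementary, there is no choice in the
  pass. The first assumption excludes the one number that the pass does not visit.\<close>

lemma cnt_exact:
  assumes "\<And>p. p < cap w W \<Longrightarrow> A w p ps \<Longrightarrow> p < cap w W - 1"
    and "\<And>p. p < cap w W \<Longrightarrow> B w p ps \<longleftrightarrow> \<not> A w p ps"
  shows "cnt A B W w u ps \<longleftrightarrow> u = card {p. p < cap w W \<and> A w p ps}"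
proof -
  let ?X = "{p. p < cap w W \<and> A w p ps}"
  have less: "p < cap w W" if "p < cap w W - 1" for p :: nat using that by simp
  have "D = ?X" if "D \<subseteq> {..<cap w W - 1}" "\<forall>p\<in>D. A w p ps"
    "\<forall>p<cap w W - 1. p \<notin> D \<longrightarrow> B w p ps" for D
  proof (rule set_eqI)
    fix p show "p \<in> D \<longleftrightarrow> p \<in> ?X" using that assms[of p] less[of p] by blast
  qed
  moreover have "?X \<subseteq> {..<cap w W - 1}" using assms(1) by auto
  moreover have "\<forall>p<cap w W - 1. p \<notin> ?X \<longrightarrow> B w p ps" using assms(2) less by blast
  ultimately show ?thesis unfolding cnt_def by blast
qed

text \<open>With a trivial \<open>B\<close> any position may be passed over, so every subset of the
  positions in \<open>A\<close> can be counted.\<close>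

lemma cnt_lower:
  assumes "\<And>p. p < cap w W \<Longrightarrow> A w p ps \<Longrightarrow> p < cap w W - 1"
  shows "cnt A (\<lambda>_ _ _. True) W w u ps \<longleftrightarrow> u \<le> card {p. p < cap w W \<and> A w p ps}"
proof -
  let ?X = "{p. p < cap w W \<and> A w p ps}"
  have less: "p < cap w W" if "p < cap w W - 1" for p :: nat using that by simp
  have "cnt A (\<lambda>_ _ _. True) W w u ps \<longleftrightarrow> (\<exists>D\<subseteq>?X. card D = u)"
    unfolding cnt_def using assms less by (intro ex_cong1) auto
  also have "\<dots> \<longleftrightarrow> u \<le> card ?X"
    using card_mono[of ?X] obtain_subset_with_card_n[of u ?X] by auto
  finally show ?thesis .
qed

text \<open>In the proof, a number \<open>p\<close> of width \<open>W\<close> stands for a pair of timed configurations; its first component only makes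
room, so that every pair is less than the largest number. \<open>A\<close> says that \<open>p\<close> is a pair of provable configurations
starting before time \<open>t\<close>, and \<open>N t\<close> is the number of these pairs. If \<open>u = N t\<close>, then \<open>Co w [u, t, c, a, b]\<close>
expresses that \<open>(c, a, b)\<close> with \<open>a \<le> t\<close> is not provable, \<open>B\<close> is the complement of \<open>A1\<close>, which is \<open>A\<close> for \<open>t + 1\<close>, and
\<open>Step\<close> determines \<open>N (t + 1)\<close>.\<close>

lemma pdef_not:
  assumes "pdef s ks P" shows "pdef s ks (\<lambda>w as. \<not> P w as)"
proof -
  obtain k R c Init where S: "pure_sys s ks P k R c Init" using pdef_pure[OF assms] by blast
  \<comment> \<open>Proofs of size up to \<open>2 ^ (c * length w)\<close> must start strictly
    before the last time \<open>cap w T - 1\<close>; the additional factor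
    \<open>2 ^ (2 * length w)\<close>, which is at least \<open>4\<close>, provides the
    room.\<close>
  define T where "T = c + 2"
  \<comment> \<open>In the lists \<open>us\<close> below, indices \<open>1\<close> to
    \<open>3\<close> are the first timed configuration and \<open>4\<close> to \<open>6\<close> the
    second. Parameters follow: index \<open>7\<close> is the time bound; from index \<open>8\<close>
    on there is the conclusion in \<open>bad\<close>, the known count in \<open>untimed\<close> and
    the initial configuration in \<open>Fin\<close>.\<close>
  define ws where "ws = [1, Suc k, T, T, Suc k, T, T]"
  define W where "W = sum_list ws"
  define tm where "tm = timed k R"
  define both where "both w us \<longleftrightarrow> us ! 0 = 0 \<and> tm w (us ! 1) (us ! 2) (us ! 3) \<and> tm w (us ! 4) (us ! 5) (us ! 6)" for w us
  define A where "A w us \<longleftrightarrow> both w us \<and> us ! 2 < us ! 7 \<and> us ! 5 < us ! 7" for w us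
  define A1 where "A1 w us \<longleftrightarrow> both w us \<and> us ! 2 \<le> us ! 7 \<and> us ! 5 \<le> us ! 7" for w us
  define bad where "bad w us \<longleftrightarrow> R w (us ! 8) (us ! 1) (us ! 4) \<and> us ! 9 = Suc (us ! 2) \<and> us ! 3 = us ! 5 \<and> us ! 6 = us ! 10" for w us
  define count where "count F G w u ps \<longleftrightarrow> cnt (\<lambda>w p ps. F w (unpack (length w) ws p @ ps)) (\<lambda>w p ps. G w (unpack (length w) ws p @ ps)) W w u ps"
    for F G :: "nat list \<Rightarrow> nat list \<Rightarrow> bool" and w u ps
  define Co where "Co w as \<longleftrightarrow> count (\<lambda>w us. A w us \<and> \<not> bad w us) (\<lambda>_ _. True) w (as ! 0) (drop 1 as)" for w as
  \<comment> \<open>A final configuration fails to be provable only by different clock values; for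
    the others the certificate \<open>Co\<close> is needed.\<close>
  define untimed where "untimed i w us \<longleftrightarrow> us ! i < cap w k \<and> us ! (i + 1) \<noteq> us ! (i + 2) \<or>
     \<not> us ! i < cap w k \<and> Co w [us ! 8, us ! 7, us ! i, us ! (i + 1), us ! (i + 2)]" for i :: nat and w us
  define B where "B w us \<longleftrightarrow> us ! 0 \<noteq> 0 \<or> us ! 7 < us ! 2 \<or> us ! 7 < us ! 5 \<or> untimed 1 w us \<or> untimed 4 w us" for w us
  define Step where "Step w t u u' ps \<longleftrightarrow> count A1 B w u' [t, u]" for w t u u' and ps :: "nat list"
  \<comment> \<open>A provable \<open>z\<close> forms a pair with itself, so it occurs as the first
    component of a counted pair. Exhibiting all pairs, none with first component \<open>z\<close>,
    refutes it.\<close>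
  define Fin where "Fin w as \<longleftrightarrow> count (\<lambda>w us. A w us \<and> us ! 1 \<noteq> us ! 8) (\<lambda>_ _. True) w (as ! 0) (drop 1 as)" for w as

  have R: "fodef s (\<lambda>w e. R w (wnum w e vz) (wnum w e vx) (wnum w e vy))"
    if "length vz = Suc k" "length vx = Suc k" "length vy = Suc k" for vz vx vy
    using S that by (simp add: pure_sys_def)
  have Et: "pdef s [Suc k, T, T] (\<lambda>w as. timed k R w (as ! 0) (as ! 1) (as ! 2))"
    by (rule pdef_timed) (rule R)
  have tm: "pdef s ks (\<lambda>w us. tm w (us ! i) (us ! j) (us ! l))"
    if "map (nth ks) [i, j, l] = [Suc k, T, T]" "i < length ks" "j < length ks" "l < length ks" for i j l ks
  proof -
    have "pdef s ks (\<lambda>w us. (\<lambda>w as. tm w (as ! 0) (as ! 1) (as ! 2)) w (map (nth us) [i, j, l]))"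
      by (rule pdef_sel) (use Et that in \<open>auto simp: tm_def\<close>)
    then show ?thesis by simp
  qed
  have Eboth: "pdef s (ws @ ks) both" for ks
    unfolding both_def by (intro pdef_conj pdef_fo fr1_zero tm) (simp_all add: ws_def)
  have EA: "pdef s (ws @ T # ks) A" "pdef s (ws @ T # ks) A1" for ks
    unfolding A_def A1_def by (intro pdef_conj Eboth pdef_fo fr1_conj fr1_less fr1_le; simp add: ws_def)+
  have Ebad: "pdef s (ws @ [T, Suc k, T, T]) (\<lambda>w us. \<not> bad w us)"
    unfolding bad_def
    by (intro pdef_fo fr1_not fr1_conj fr1_eq fr1_Suc) (simp_all add: ws_def, rule fr1_atom, simp add: R)
  have ECo: "pdef s [W, T, Suc k, T, T] Co"
    using pdef_cnt_unpack[OF pdef_conj[OF EA(1) Ebad] pdef_const, of True] unfolding Co_def count_def W_def by simp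
  have Eun: "pdef s (ws @ [T, W]) (untimed i)" if "i = 1 \<or> i = 4" for i
  proof -
    have "pdef s (ws @ [T, W]) (\<lambda>w us. Co w (map (nth us) [8, 7, i, i + 1, i + 2]))"
      by (rule pdef_sel) (use ECo that in \<open>auto simp: ws_def\<close>)
    then show ?thesis unfolding untimed_def
      by (intro pdef_disj pdef_conj) (use that in \<open>auto simp: ws_def intro!: pdef_fo fr1_not fr1_eq fr1_done\<close>)
  qed
  have EB: "pdef s (ws @ [T, W]) B"
    unfolding B_def by (intro pdef_disj Eun pdef_fo fr1_not fr1_zero fr1_less) (simp_all add: ws_def)
  have "pdef s [W, T, W] (\<lambda>w as. count A1 B w (as ! 0) (drop 1 as))"
    using pdef_cnt_unpack[OF EA(2) EB] unfolding count_def W_def by simp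
  then have "pdef s [T, W, W] (\<lambda>w as. (\<lambda>w as. count A1 B w (as ! 0) (drop 1 as)) w (map (nth as) [2, 0, 1]))"
    by (intro pdef_sel) auto
  then have "pdef s [T, W, W] (\<lambda>w as. Step w (as ! 0) (as ! 1) (as ! 2) (drop 3 as))"
    by (simp add: Step_def)
  then have Eit: "pdef s [T, W] (\<lambda>w as. iter Step W w (as ! 0) (as ! 1) (drop 2 as))"
    by (rule pdef_iter)
  have "pdef s (ws @ [T, Suc k]) (\<lambda>w us. A w us \<and> us ! 1 \<noteq> us ! 8)"
    by (intro pdef_conj EA pdef_fo fr1_not fr1_eq) (simp_all add: ws_def)
  from pdef_cnt_unpack[OF this pdef_const, of True] have EFin: "pdef s [W, T, Suc k] Fin"
    unfolding Fin_def count_def W_def by simp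
  have "pdef s [T, W, Suc k] (\<lambda>w as. iter Step W w (map (nth as) [0, 1] ! 0) (map (nth as) [0, 1] ! 1) (drop 2 (map (nth as) [0, 1])) \<and>
      Fin w (map (nth as) [1, 0, 2]))"
    by (intro pdef_conj pdef_sel[where P = "\<lambda>w as. iter Step W w (as ! 0) (as ! 1) (drop 2 as)"] pdef_sel[where P = Fin])
      (use Eit EFin in auto)
  then have inner: "pdef s [T, W, Suc k] (\<lambda>w as. iter Step W w (as ! 0) (as ! 1) [] \<and> Fin w [as ! 1, as ! 0, as ! 2])"
    by simp
  have G: "fr2 s ks [T, W, Suc k] (\<lambda>w as bs. Suc (bs ! 0) = cap w T \<and> Init w as (bs ! 2))"
    unfolding fr2_def using S by (auto simp: map_eq_Cons_conv pure_sys_def intro!: fod)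
  show ?thesis
  proof (rule pdef_cong[OF pdef_ex[OF G inner]])
    fix w as assume w: "is_string s w" "okr w ks as"
    have n: "0 < length w" using is_string_pos[OF w(1)] .
    define u where "u p = unpack (length w) ws p" for p
    define X where "X t = {p. p < cap w W \<and> A w (u p @ [t])}" for t
    define N where "N t = card (X t)" for t
    define rest where "rest = sum_list (tl ws)"
    have lu: "length (u p) = 7" for p by (simp add: u_def ws_def)
    have ub: "u p ! i < cap w (ws ! i)" if "i < 7" for p i
      using okr_unpack[of w ws p] that by (auto simp: okr_def u_def ws_def)
    have up: "\<exists>p<cap w W. u p = as" if "okr w ws as" for as
      using pack_bound[OF that] unpack_pack[OF that, of 0] by (auto simp: u_def W_def)
    have W: "W = Suc rest" by (simp add: W_def rest_def ws_def)
    have lead: "p < cap w rest" if "p < cap w W" "u p ! 0 = 0" for p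
    proof -
      have "p div cap w rest < 2 ^ length w"
        using that(1) W by (simp add: div_less_iff_less_mult power_add)
      then show ?thesis using that(2) by (simp add: u_def ws_def rest_def div_eq_0_iff)
    qed
    have rest: "(2::nat) ^ (length w * rest) < cap w W"
      using n W by (intro power_strict_increasing) auto
    have lead': "p < cap w W - 1" if "p < cap w W" "u p ! 0 = 0" for p
      using lead[OF that] rest by linarith
    have fX: "finite (X t)" for t by (simp add: X_def)
    have N_bound: "N t < cap w W" for t
    proof -
      have "X t \<subseteq> {..<cap w rest}" using lead by (auto simp: X_def A_def both_def nth_append lu)
      then have "N t \<le> card {..<(2::nat) ^ (length w * rest)}" unfolding N_def by (intro card_mono) auto
      then show ?thesis using rest by (simp only: card_lessThan)
    qed
    have ext: "A w (u p @ t # ps) \<longleftrightarrow> A w (u p @ [t])" for p t ps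
      by (simp add: A_def both_def nth_append lu)
    \<comment> \<open>The premises of a configuration starting at time \<open>a\<close> start at
      time \<open>a - 1\<close> or earlier, hence before \<open>t\<close>. Therefore the pairs
      counted for \<open>t\<close> decide all configurations up to and including time
      \<open>t\<close>, which is what the count for \<open>t + 1\<close> requires.\<close>
    have tm_iff: "tm w c a b \<longleftrightarrow> (\<exists>p\<in>X t. bad w (u p @ [t, c, a, b]))"
      if c: "\<not> c < cap w k" "a < cap w T" "b < cap w T" "a \<le> t" for c a b t
    proof
      assume "tm w c a b"
      then have ba: "b \<le> a" "psz k R w c (a - b)" by (auto simp: tm_def timed_def)
      from ba(2) c(1) obtain x y m1 m2 where m: "a - b = Suc (m1 + m2)" "x < cap w (Suc k)" "y < cap w (Suc k)"
        "R w c x y" "psz k R w x m1" "psz k R w y m2" by (cases rule: psz.cases) auto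
      have "a - 1 < cap w T" "b + m2 < cap w T" using m(1) c by auto
      then have "okr w ws [0, x, a - 1, b + m2, y, b + m2, b]" using m(2,3) c by (simp add: ws_def)
      from up[OF this] obtain p where p: "p < cap w W" "u p = [0, x, a - 1, b + m2, y, b + m2, b]"
        by blast
      have "a - 1 = b + m2 + m1" using m(1) ba by simp
      then have "tm w x (a - 1) (b + m2)" "tm w y (b + m2) b" using m(5,6) by (simp_all add: tm_def timed_def)
      then have "p \<in> X t" using p m c by (auto simp: X_def A_def both_def)
      moreover have "bad w (u p @ [t, c, a, b])" using p m by (simp add: bad_def)
      ultimately show "\<exists>p\<in>X t. bad w (u p @ [t, c, a, b])" by blast
    next
      assume "\<exists>p\<in>X t. bad w (u p @ [t, c, a, b])"
      then obtain p where p: "tm w (u p ! 1) (u p ! 2) (u p ! 3)" "tm w (u p ! 4) (u p ! 5) (u p ! 6)"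
        "R w c (u p ! 1) (u p ! 4)" "a = Suc (u p ! 2)" "u p ! 3 = u p ! 5" "u p ! 6 = b"
        by (auto simp: X_def A_def both_def bad_def nth_append lu)
      have "psz k R w c (Suc ((u p ! 2 - u p ! 3) + (u p ! 5 - u p ! 6)))"
        using p c ub[of 1 p] ub[of 4 p] by (intro psz.rule[where x = "u p ! 1" and y = "u p ! 4"]) (auto simp: tm_def timed_def ws_def)
      moreover have "Suc ((u p ! 2 - u p ! 3) + (u p ! 5 - u p ! 6)) = a - b" "b \<le> a"
        using p by (auto simp: tm_def timed_def)
      ultimately show "tm w c a b" unfolding tm_def timed_def by simp
    qed
    \<comment> \<open>As many elements as \<open>X t\<close> has can be found inside a subset of
      \<open>X t\<close> only if the subset is everything.\<close>
    have full: "N t \<le> card {p. p < cap w W \<and> A w (u p @ [t]) \<and> F p} \<longleftrightarrow> (\<forall>p\<in>X t. F p)" for t F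
    proof
      assume "N t \<le> card {p. p < cap w W \<and> A w (u p @ [t]) \<and> F p}"
      then have "{p. p < cap w W \<and> A w (u p @ [t]) \<and> F p} = X t"
        unfolding N_def by (intro card_seteq fX) (auto simp: X_def)
      then show "\<forall>p\<in>X t. F p" by blast
    next
      assume "\<forall>p\<in>X t. F p"
      then have "{p. p < cap w W \<and> A w (u p @ [t]) \<and> F p} = X t" by (auto simp: X_def)
      then show "N t \<le> card {p. p < cap w W \<and> A w (u p @ [t]) \<and> F p}" by (simp add: N_def)
    qed
    have lead_A: "p < cap w W - 1" if "p < cap w W" "A w (u p @ ps)" for p ps
      using lead'[OF that(1)] that(2) by (simp add: A_def both_def nth_append lu)
    have Co: "Co w [N t, t, c, a, b] \<longleftrightarrow> \<not> tm w c a b"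
      if "\<not> c < cap w k" "a < cap w T" "b < cap w T" "a \<le> t" for c a b t
    proof -
      have "Co w [N t, t, c, a, b] \<longleftrightarrow> N t \<le> card {p. p < cap w W \<and> A w (u p @ [t, c, a, b]) \<and> \<not> bad w (u p @ [t, c, a, b])}"
        unfolding Co_def count_def by (subst cnt_lower) (use lead_A[of _ "[t, c, a, b]"] in \<open>auto simp: u_def\<close>)
      also have "\<dots> \<longleftrightarrow> \<not> tm w c a b" unfolding ext[of _ t "[c, a, b]"] full tm_iff[OF that] by blast
      finally show ?thesis .
    qed
    have untimed: "untimed i w (u p @ [t, N t]) \<longleftrightarrow> \<not> tm w (u p ! i) (u p ! (i + 1)) (u p ! (i + 2))"
      if "i = 1 \<or> i = 4" "u p ! (i + 1) \<le> t" for i p t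
    proof (cases "u p ! i < cap w k")
      case True
      then show ?thesis using that lu by (auto simp: untimed_def nth_append tm_def timed_done)
    next
      case False
      have "u p ! (i + 1) < cap w T" "u p ! (i + 2) < cap w T"
        using ub[of "i + 1" p] ub[of "i + 2" p] that by (auto simp: ws_def)
      from Co[OF False this that(2)] show ?thesis using False that lu by (auto simp: untimed_def nth_append)
    qed
    have Step: "Step w t (N t) v ps \<longleftrightarrow> v = N (Suc t)" for t v ps
    proof -
      have e: "A1 w (u p @ [t, N t]) \<longleftrightarrow> A w (u p @ [Suc t])" for p
        by (simp add: A1_def A_def both_def nth_append lu less_Suc_eq_le)
      have "Step w t (N t) v ps \<longleftrightarrow> v = card {p. p < cap w W \<and> A1 w (u p @ [t, N t])}"
        unfolding Step_def count_def u_def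
      proof (rule cnt_exact, unfold u_def[symmetric])
        show "B w (u p @ [t, N t]) \<longleftrightarrow> \<not> A1 w (u p @ [t, N t])" for p
        proof (cases "u p ! 0 = 0 \<and> u p ! 2 \<le> t \<and> u p ! 5 \<le> t")
          case True
          have "untimed 1 w (u p @ [t, N t]) \<longleftrightarrow> \<not> tm w (u p ! 1) (u p ! 2) (u p ! 3)"
            "untimed 4 w (u p @ [t, N t]) \<longleftrightarrow> \<not> tm w (u p ! 4) (u p ! 5) (u p ! 6)"
            using untimed[of 1 p t] untimed[of 4 p t] True by (simp_all add: numeral_2_eq_2 numeral_3_eq_3)
          then show ?thesis using True by (auto simp: B_def A1_def both_def nth_append lu)
        next
          case False
          then show ?thesis by (auto simp: B_def A1_def both_def nth_append lu)
        qed
      qed (use e lead_A in blast)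
      then show ?thesis unfolding e by (simp add: N_def[of "Suc t"] X_def[of "Suc t"])
    qed
    have N0: "N 0 = 0" by (simp add: N_def X_def A_def nth_append lu)
    have iter: "iter Step W w t v [] \<longleftrightarrow> v = N t" for t v
    proof
      assume "iter Step W w t v []"
      then obtain h where h: "h 0 = 0" "h t = v" "\<forall>i<t. Step w i (h i) (h (Suc i)) []" unfolding iter_def by blast
      have "h i = N i" if "i \<le> t" for i
        using that
      proof (induction i)
        case (Suc i)
        then have "Step w i (N i) (h (Suc i)) []" using h(3) by (metis Suc_le_eq Suc_leD)
        then show ?case by (simp add: Step)
      qed (simp add: h(1) N0)
      then show "v = N t" using h(2) by simp
    next
      assume "v = N t"
      then show "iter Step W w t v []" unfolding iter_def
        by (intro exI[of _ N]) (simp add: N0 Step N_bound)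
    qed
    have Fin: "Fin w [N t, t, z] \<longleftrightarrow> (\<forall>p\<in>X t. u p ! 1 \<noteq> z)" for t z
    proof -
      have "Fin w [N t, t, z] \<longleftrightarrow> N t \<le> card {p. p < cap w W \<and> A w (u p @ [t, z]) \<and> (u p @ [t, z]) ! 1 \<noteq> (u p @ [t, z]) ! 8}"
        unfolding Fin_def count_def by (subst cnt_lower) (use lead_A[of _ "[t, z]"] in \<open>auto simp: u_def\<close>)
      also have "\<dots> \<longleftrightarrow> (\<forall>p\<in>X t. u p ! 1 \<noteq> z)" unfolding ext[of _ t "[z]"] full by (simp add: nth_append lu)
      finally show ?thesis .
    qed
    define t where "t = cap w T - (1::nat)"
    have t: "Suc t = cap w T" by (simp add: t_def)
    have key: "P w as \<longleftrightarrow> (\<exists>p\<in>X t. u p ! 1 = z)" if z: "Init w as z" "z < cap w (Suc k)" for z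
    proof
      assume "P w as"
      then obtain m where m: "m \<le> 2 ^ (c * length w)" "psz k R w z m" "cap w k \<le> z"
        using S z(1) w unfolding pure_sys_def by blast
      have "(4::nat) \<le> 2 ^ (2 * length w)" using n power_increasing[of 2 "2 * length w" "2::nat"] by (cases "length w") auto
      then have "4 * m \<le> 2 ^ (2 * length w) * 2 ^ (c * length w)" using m(1) by (intro mult_mono) auto
      also have "\<dots> = cap w T" by (simp add: T_def power_add[symmetric] algebra_simps)
      finally have "4 * m < Suc (Suc t)" using t by simp
      moreover have "0 < m" using m(2,3) by (cases rule: psz.cases) auto
      ultimately have mt: "m < t" by simp
      obtain p where p: "p < cap w W" "u p = [0, z, m, 0, z, m, 0]"
        using up[of "[0, z, m, 0, z, m, 0]"] z mt t by (auto simp: ws_def)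
      have "tm w z m 0" using m by (simp add: tm_def timed_def)
      then have "p \<in> X t" using p mt by (simp add: X_def A_def both_def)
      then show "\<exists>p\<in>X t. u p ! 1 = z" using p by (intro bexI[of _ p]) auto
    next
      assume "\<exists>p\<in>X t. u p ! 1 = z"
      then obtain a b where "tm w z a b" by (auto simp: X_def A_def both_def nth_append lu)
      then show "P w as" using S z(1) w unfolding pure_sys_def tm_def timed_def by blast
    qed
    show "\<not> P w as \<longleftrightarrow> (\<exists>bs. okr w [T, W, Suc k] bs \<and> (Suc (bs ! 0) = cap w T \<and> Init w as (bs ! 2)) \<and>
       iter Step W w (bs ! 0) (bs ! 1) [] \<and> Fin w [bs ! 1, bs ! 0, bs ! 2])"
    proof
      assume nP: "\<not> P w as"
      obtain z where z: "z < cap w (Suc k)" "Init w as z" using S w unfolding pure_sys_def by blast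
      have "Fin w [N t, t, z]" using nP key[OF z(2,1)] Fin by blast
      then show "\<exists>bs. okr w [T, W, Suc k] bs \<and> (Suc (bs ! 0) = cap w T \<and> Init w as (bs ! 2)) \<and>
         iter Step W w (bs ! 0) (bs ! 1) [] \<and> Fin w [bs ! 1, bs ! 0, bs ! 2]"
        using z t N_bound[of t] by (intro exI[of _ "[t, N t, z]"]) (simp add: iter)
    next
      assume "\<exists>bs. okr w [T, W, Suc k] bs \<and> (Suc (bs ! 0) = cap w T \<and> Init w as (bs ! 2)) \<and>
         iter Step W w (bs ! 0) (bs ! 1) [] \<and> Fin w [bs ! 1, bs ! 0, bs ! 2]"
      then obtain t' v z where b: "Suc t' = cap w T" "Init w as z" "iter Step W w t' v []" "Fin w [v, t', z]"
        "z < cap w (Suc k)" by (auto simp: okr_Cons)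
      have "t' = t" using b(1) t by simp
      then show "\<not> P w as" using b key[OF b(2,5)] Fin iter by simp
    qed
  qed
qed

subsection \<open>Translation of formulas\<close>

text \<open>Used for first-order formulas only: they bind no set variables, so renaming causes no
  capture.\<close>

fun ren :: "(nat \<Rightarrow> nat) \<Rightarrow> form \<Rightarrow> form" where
  "ren \<sigma> (Mem X t) = Mem (\<sigma> X) t"
| "ren \<sigma> (Neg \<phi>) = Neg (ren \<sigma> \<phi>)"
| "ren \<sigma> (Conj \<phi> \<psi>) = Conj (ren \<sigma> \<phi>) (ren \<sigma> \<psi>)"
| "ren \<sigma> (Disj \<phi> \<psi>) = Disj (ren \<sigma> \<phi>) (ren \<sigma> \<psi>)"
| "ren \<sigma> (Ex x \<phi>) = Ex x (ren \<sigma> \<phi>)"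
| "ren \<sigma> (All x \<phi>) = All x (ren \<sigma> \<phi>)"
| "ren \<sigma> \<phi> = \<phi>"

lemma sat_ren: "is_fo \<phi> \<Longrightarrow> sat w fo e (ren \<sigma> \<phi>) = sat w fo (\<lambda>v. e (\<sigma> v)) \<phi>"
  by (induction \<phi> arbitrary: fo) auto

lemma ren_simps:
  assumes "is_fo \<phi>"
  shows "is_fo (ren \<sigma> \<phi>)" "wf s (ren \<sigma> \<phi>) = wf s \<phi>" "fvars (ren \<sigma> \<phi>) = fvars \<phi>" "svars (ren \<sigma> \<phi>) = \<sigma> ` svars \<phi>"
  using assms by (induction \<phi>) auto

lemma fodef_ren: "fodef s P \<Longrightarrow> fodef s (\<lambda>w e. P w (\<lambda>v. e (\<sigma> v)))"
  unfolding fodef_def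
  by (elim exE, rule_tac x = "ren \<sigma> \<phi>" in exI) (simp add: ren_simps sat_ren venv_def)

text \<open>Every set denotes a position and every position is denoted by a singleton, so a
  first-order quantifier becomes a set quantifier without a guard. The value \<open>0\<close> at the
  empty set matches the assignment used in \<open>models\<close>.\<close>

definition lst :: "nat set \<Rightarrow> nat" where
  "lst A = (if A = {} then 0 else Min A)"

text \<open>First-order variables are simulated by sets, read through \<open>lst\<close>: the set variable \<open>X\<close> becomes \<open>2 * X\<close>
  and the first-order variable \<open>x\<close> becomes \<open>2 * x + 1\<close>.\<close>

definition sat_env where
  "sat_env \<phi> w e = sat w (\<lambda>x. lst (e (Suc (2 * x)))) (\<lambda>X. e (2 * X)) \<phi>"

lemma lst_less: "A \<subseteq> {..<n} \<Longrightarrow> 0 < n \<Longrightarrow> lst A < n"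
  using Min_in[of A] finite_subset[of A "{..<n}"] unfolding lst_def by fastforce

lemma lst_single [simp]: "lst {a} = a" by (simp add: lst_def)

lemma lst_iff:
  assumes "A \<subseteq> {..<n}"
  shows "a = lst A \<longleftrightarrow> a \<in> A \<and> (\<forall>b<n. \<not> b < a \<or> b \<notin> A) \<or> a = 0 \<and> (\<forall>b<n. b \<notin> A)"
proof -
  have "finite A" using assms finite_subset by blast
  show ?thesis
  proof (cases "A = {}")
    case False
    have "a = Min A \<longleftrightarrow> a \<in> A \<and> (\<forall>b\<in>A. a \<le> b)" using Min_eq_iff[OF \<open>finite A\<close> False, of a] by (simp add: eq_commute[of a])
    then show ?thesis using False assms by (auto simp: lst_def not_less)
  qed (simp add: lst_def)
qed

text \<open>Says that the first-order variable \<open>d\<close> is the value of the term under the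
  assignment coded by sets; variable \<open>2\<close> is scratch.\<close>

fun valF :: "trm \<Rightarrow> nat \<Rightarrow> form" where
  "valF (V x) d = Disj (Conj (Mem (Suc (2 * x)) (V d)) (All 2 (Disj (Neg (Lt (V 2) (V d))) (Neg (Mem (Suc (2 * x)) (V 2))))))
     (Conj (Eq (V d) Mn) (All 2 (Neg (Mem (Suc (2 * x)) (V 2)))))"
| "valF t d = Eq (V d) t"

lemma valF [simp]: "wf s (valF t d)" "is_fo (valF t d)" "fvars (valF t d) = {d}"  if "d \<noteq> 2" for d
  using that by (cases t; auto)+

lemma sat_valF:
  assumes "venv w e" "d \<noteq> 2"
  shows "sat w fo e (valF t d) \<longleftrightarrow> fo d = tval w (\<lambda>x. lst (e (Suc (2 * x)))) t"
  using assms lst_iff[OF venvD[OF assms(1)]] by (cases t) auto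

lemma tval_less: "venv w e \<Longrightarrow> w \<noteq> [] \<Longrightarrow> tval w (\<lambda>x. lst (e (Suc (2 * x)))) t < length w"
  by (cases t) (simp_all add: lst_less venvD)

lemma fodef_atoms:
  "fodef s (sat_env (Eq t u))" "fodef s (sat_env (Lt t u))" "a < s \<Longrightarrow> fodef s (sat_env (Pr a t))" "fodef s (sat_env (Mem X t))"
proof -
  show "fodef s (sat_env (Eq t u))"
    by (rule fodefI[where \<phi> = "Ex 0 (Ex 1 (Conj (valF t 0) (Conj (valF u 1) (Eq (V 0) (V 1)))))"])
      (auto simp: sat_valF sat_env_def tval_less is_string_def)
  show "fodef s (sat_env (Lt t u))"
    by (rule fodefI[where \<phi> = "Ex 0 (Ex 1 (Conj (valF t 0) (Conj (valF u 1) (Lt (V 0) (V 1)))))"])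
      (auto simp: sat_valF sat_env_def tval_less is_string_def)
  show "a < s \<Longrightarrow> fodef s (sat_env (Pr a t))"
    by (rule fodefI[where \<phi> = "Ex 0 (Conj (valF t 0) (Pr a (V 0)))"]) (auto simp: sat_valF sat_env_def tval_less is_string_def)
  show "fodef s (sat_env (Mem X t))"
    by (rule fodefI[where \<phi> = "Ex 0 (Conj (valF t 0) (Mem (2 * X) (V 0)))"]) (auto simp: sat_valF sat_env_def tval_less is_string_def)
qed

section \<open>Environments stored in registers of width one\<close>

definition dset :: "nat \<Rightarrow> nat \<Rightarrow> nat set" where
  "dset n a = asg n 1 a 0"

definition env :: "nat list \<Rightarrow> nat list \<Rightarrow> nat \<Rightarrow> nat set" where
  "env w as v = (if v < length as then dset (length w) (as ! v) else {})"

lemma asg_num: "venv w e \<Longrightarrow> l < length vs \<Longrightarrow> asg (length w) (length vs) (wnum w e vs) l = e (vs ! l)"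
  using asg_numl[of "map e vs" "length w" l] by (auto simp: num_def venvD)

lemma dset_num: "venv w e \<Longrightarrow> dset (length w) (wnum w e [x]) = e x"
  using asg_num[of w e 0 "[x]"] by (simp add: dset_def)

lemma dset_numl: "A \<subseteq> {..<n} \<Longrightarrow> dset n (numl n [A]) = A"
  using asg_numl[of "[A]" n 0] by (simp add: dset_def)

lemma dset_inj: "a < 2 ^ n \<Longrightarrow> b < 2 ^ n \<Longrightarrow> dset n a = dset n b \<longleftrightarrow> a = b"
proof -
  assume "a < 2 ^ n" "b < 2 ^ n"
  moreover have "numl n [dset n c] = c" if "c < 2 ^ n" for c
    using numl_asg[of c n 1] that by (simp add: dset_def)
  ultimately show ?thesis by metis
qed

lemma venv_env: "venv w (env w as)"
  using asg_subset by (auto simp: venv_def env_def dset_def)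

lemma ex_okr_env:
  assumes "venv w e" "\<And>v. K \<le> v \<Longrightarrow> e v = {}"
  shows "\<exists>as. okr w (replicate K 1) as \<and> env w as = e"
proof (intro exI conjI)
  let ?as = "map (\<lambda>v. numl (length w) [e v]) [0..<K]"
  have "numl (length w) [e v] < 2 ^ length w" for v
    using numl_bound[of "length w" "[e v]"] by simp
  then show "okr w (replicate K 1) ?as" by (simp add: okr_def)
  show "env w ?as = e" using assms by (auto simp: env_def dset_numl venvD fun_eq_iff)
qed

lemma env_eqD:
  assumes "okr w (replicate K 1) as" "okr w (replicate K 1) bs" "v < K"
  shows "env w as v = env w bs v \<longleftrightarrow> as ! v = bs ! v"
  using assms dset_inj[of "as ! v" "length w" "bs ! v"] by (auto simp: env_def okr_def)

lemma env_out: "okr w (replicate K 1) as \<Longrightarrow> K \<le> v \<Longrightarrow> env w as v = {}"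
  by (simp add: env_def okr_def)

lemma singletons:
  assumes "map length vs = replicate K 1" "v < K"
  obtains x where "vs ! v = [x]"
proof -
  have "length (vs ! v) = 1" using assms by (metis length_map length_replicate nth_map nth_replicate)
  then show ?thesis using that by (auto simp: length_Suc_conv)
qed

lemma env_nums:
  assumes "venv w e" "map length vs = replicate K 1"
  shows "env w (nums w e vs) = (\<lambda>v. if v < K then e (hd (vs ! v)) else {})"
proof (rule ext)
  fix v
  have l: "length vs = K" using assms(2) by (metis length_map length_replicate)
  show "env w (nums w e vs) v = (if v < K then e (hd (vs ! v)) else {})"
  proof (cases "v < K")
    case True
    then obtain x where "vs ! v = [x]" using singletons[OF assms(2)] by blast
    then show ?thesis using True l assms by (simp add: env_def dset_num)
  qed (simp add: env_def l)
qed

lemma pdef_fodef: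
  assumes "fodef s P" "\<And>w e. P w (\<lambda>v. if v < K then e v else {}) = P w e"
  shows "pdef s (replicate K 1) (\<lambda>w as. P w (env w as))"
proof (rule pdef_fo, unfold fr1_def, intro allI impI)
  fix vs :: "nat list list" assume l: "map length vs = replicate K 1"
  show "fodef s (\<lambda>w e. P w (env w (nums w e vs)))"
  proof (rule fodef_cong)
    show "fodef s (\<lambda>w e. P w (\<lambda>v. e (hd (vs ! v))))" by (rule fodef_ren[OF assms(1)])
    show "P w (env w (nums w e vs)) \<longleftrightarrow> P w (\<lambda>v. e (hd (vs ! v)))" if "venv w e" for w e
      using assms(2)[of w "\<lambda>v. e (hd (vs ! v))"] env_nums[OF that l] by simp
  qed
qed

text \<open>All registers of a new environment are guessed, and all but the one of \<open>x\<close>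
  are required to agree with the old ones.\<close>

lemma pdef_ex_var:
  assumes "pdef s (replicate K 1) (\<lambda>w as. P w (env w as))" "x < K"
  shows "pdef s (replicate K 1) (\<lambda>w as. \<exists>A\<subseteq>{..<length w}. P w ((env w as)(x := A)))"
proof (rule pdef_cong[OF pdef_ex[OF _ assms(1), of _ "\<lambda>w as bs. \<forall>i<K. i \<noteq> x \<longrightarrow> bs ! i = as ! i"]])
  show "fr2 s (replicate K 1) (replicate K 1) (\<lambda>w as bs. \<forall>i<K. i \<noteq> x \<longrightarrow> bs ! i = as ! i)"
    unfolding fr2_def
  proof (intro allI impI fodef_all_less fodef_imp fodef_const)
    fix vs vs' :: "nat list list" and i assume l: "map length vs = replicate K 1" "map length vs' = replicate K 1" "i < K"
    then have "length vs = K" "length vs' = K" by (metis length_map length_replicate)+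
    moreover have "length (vs ! i) = 1" "length (vs' ! i) = 1" using singletons l by (metis One_nat_def length_Cons list.size(3))+
    ultimately show "fodef s (\<lambda>w e. nums w e vs' ! i = nums w e vs ! i)" using l by (simp add: fod)
  qed
  fix w as assume w: "okr w (replicate K 1) as"
  show "(\<exists>A\<subseteq>{..<length w}. P w ((env w as)(x := A))) \<longleftrightarrow>
    (\<exists>bs. okr w (replicate K 1) bs \<and> (\<forall>i<K. i \<noteq> x \<longrightarrow> bs ! i = as ! i) \<and> P w (env w bs))"
  proof
    assume "\<exists>A\<subseteq>{..<length w}. P w ((env w as)(x := A))"
    then obtain A where A: "A \<subseteq> {..<length w}" "P w ((env w as)(x := A))" by blast
    have "venv w ((env w as)(x := A))" using A venv_env[of w as] by (simp add: venv_def)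
    moreover have "((env w as)(x := A)) v = {}" if "K \<le> v" for v using that assms(2) env_out[OF w] by simp
    ultimately obtain bs where bs: "okr w (replicate K 1) bs" "env w bs = (env w as)(x := A)"
      using ex_okr_env by blast
    then have "bs ! i = as ! i" if "i < K" "i \<noteq> x" for i using env_eqD[OF bs(1) w that(1)] that by simp
    then show "\<exists>bs. okr w (replicate K 1) bs \<and> (\<forall>i<K. i \<noteq> x \<longrightarrow> bs ! i = as ! i) \<and> P w (env w bs)"
      using bs A by auto
  next
    assume "\<exists>bs. okr w (replicate K 1) bs \<and> (\<forall>i<K. i \<noteq> x \<longrightarrow> bs ! i = as ! i) \<and> P w (env w bs)"
    then obtain bs where bs: "okr w (replicate K 1) bs" "\<forall>i<K. i \<noteq> x \<longrightarrow> bs ! i = as ! i" "P w (env w bs)" by blast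
    then have "env w bs = (env w as)(x := env w bs x)"
      using w by (auto simp: fun_eq_iff env_def okr_def)
    moreover have "env w bs x \<subseteq> {..<length w}" using venv_env[of w bs] by (simp add: venv_def)
    ultimately show "\<exists>A\<subseteq>{..<length w}. P w ((env w as)(x := A))" using bs by metis
  qed
qed

lemma upd_sets_Cons: "upd_sets e (X # Xs) (A # As) = upd_sets (e(X := A)) Xs As"
  by (simp add: upd_sets_def)

lemma upd_sets_out: "X \<notin> set Xs \<Longrightarrow> upd_sets e Xs As X = e X"
proof (induction Xs arbitrary: e As)
  case (Cons Y Xs)
  show ?case
  proof (cases As)
    case Nil then show ?thesis by (simp add: upd_sets_def)
  next
    case (Cons A As') then show ?thesis using Cons.IH Cons.prems by (simp add: upd_sets_Cons)
  qed
qed (simp add: upd_sets_def)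

lemma upd_sets_in:
  "distinct Xs \<Longrightarrow> length As = length Xs \<Longrightarrow> l < length Xs \<Longrightarrow> upd_sets e Xs As (Xs ! l) = As ! l"
proof (induction Xs arbitrary: e As l)
  case (Cons Y Xs) then show ?case by (cases As; cases l) (auto simp: upd_sets_Cons upd_sets_out)
qed simp

text \<open>The effect of the \<open>i\<close>-th assignment to \<open>Xs\<close> on an environment
  in which set variables have even indices.\<close>

definition updE :: "nat \<Rightarrow> nat list \<Rightarrow> (nat \<Rightarrow> nat set) \<Rightarrow> nat \<Rightarrow> nat \<Rightarrow> nat set" where
  "updE n Xs e i v = (if even v then upd_sets (\<lambda>X. e (2 * X)) Xs (map (asg n (length Xs) i) [0..<length Xs]) (v div 2) else e v)"

lemma updE_in: "distinct Xs \<Longrightarrow> l < length Xs \<Longrightarrow> updE n Xs e i (2 * (Xs ! l)) = asg n (length Xs) i l"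
  by (simp add: updE_def upd_sets_in)

lemma updE_out: "v \<notin> (\<lambda>X. 2 * X) ` set Xs \<Longrightarrow> updE n Xs e i v = e v"
proof (cases "even v")
  case True
  assume "v \<notin> (\<lambda>X. 2 * X) ` set Xs"
  then have "v div 2 \<notin> set Xs" using True by (metis dvd_mult_div_cancel imageI)
  then show ?thesis using True by (simp add: updE_def upd_sets_out)
qed (simp add: updE_def)

lemma sat_env_updE: "sat_env \<phi> w (updE n Xs e i) =
  sat w (\<lambda>x. lst (e (Suc (2 * x)))) (upd_sets (\<lambda>X. e (2 * X)) Xs (map (asg n (length Xs) i) [0..<length Xs])) \<phi>"
  unfolding sat_env_def by (simp add: updE_def[abs_def])

lemma venv_updE:
  assumes "venv w e" "distinct Xs" shows "venv w (updE (length w) Xs e i)"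
  unfolding venv_def
proof
  fix v show "updE (length w) Xs e i v \<subseteq> {..<length w}"
  proof (cases "v \<in> (\<lambda>X. 2 * X) ` set Xs")
    case True
    then obtain l where "l < length Xs" "v = 2 * (Xs ! l)" by (auto simp: in_set_conv_nth)
    then show ?thesis using updE_in[OF assms(2)] asg_subset by metis
  qed (use updE_out assms venvD in metis)
qed

text \<open>The updated environment is guessed and checked register by register: a register for a
  variable of \<open>Xs\<close> must equal the corresponding set of the tuple with number
  \<open>i\<close>, any other register must equal the old one. Both are equalities of sets.\<close>

lemma pdef_updE:
  assumes P: "pdef s (replicate K 1) (\<lambda>w as. P w (env w as))" and Xs: "distinct Xs" "\<forall>X\<in>set Xs. 2 * X < K"
  shows "pdef s (length Xs # replicate K 1) (\<lambda>w as. P w (updE (length w) Xs (env w (drop 1 as)) (as ! 0)))"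
proof (rule pdef_cong[OF pdef_ex[OF _ P, of _ "\<lambda>w as bs. \<forall>v<K. env w bs v = updE (length w) Xs (env w (drop 1 as)) (as ! 0) v"]])
  show "fr2 s (length Xs # replicate K 1) (replicate K 1) (\<lambda>w as bs. \<forall>v<K. env w bs v = updE (length w) Xs (env w (drop 1 as)) (as ! 0) v)"
    unfolding fr2_def
  proof (intro allI impI fodef_all_less)
    fix vs vs' :: "nat list list" and v assume l: "map length vs = length Xs # replicate K 1" "map length vs' = replicate K 1" "v < K"
    then obtain u us where vs: "vs = u # us" "length u = length Xs" "map length us = replicate K 1" by (auto simp: map_eq_Cons_conv)
    show "fodef s (\<lambda>w e. env w (nums w e vs') v = updE (length w) Xs (env w (drop 1 (nums w e vs))) (nums w e vs ! 0) v)"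
    proof (cases "v \<in> (\<lambda>X. 2 * X) ` set Xs")
      case True
      then obtain p where p: "p < length Xs" "v = 2 * (Xs ! p)" by (auto simp: in_set_conv_nth)
      have "fodef s (\<lambda>w e. e (hd (vs' ! v)) = e (u ! p))" by (intro fod)
      then show ?thesis
      proof (rule fodef_cong)
        fix w e assume e: "venv w e"
        show "(env w (nums w e vs') v = updE (length w) Xs (env w (drop 1 (nums w e vs))) (nums w e vs ! 0) v) = (e (hd (vs' ! v)) = e (u ! p))"
          using l(3) p(1) vs asg_num[OF e, of p u] unfolding p(2) updE_in[OF Xs(1) p(1)] env_nums[OF e l(2)] by simp
      qed
    next
      case False
      have "fodef s (\<lambda>w e. e (hd (vs' ! v)) = e (hd (us ! v)))" by (intro fod)
      then show ?thesis
      proof (rule fodef_cong)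
        fix w e assume e: "venv w e"
        show "(env w (nums w e vs') v = updE (length w) Xs (env w (drop 1 (nums w e vs))) (nums w e vs ! 0) v) = (e (hd (vs' ! v)) = e (hd (us ! v)))"
          using l(3) unfolding updE_out[OF False] env_nums[OF e l(2)] by (simp add: vs env_nums[OF e vs(3)])
      qed
    qed
  qed
  fix w as assume "okr w (length Xs # replicate K 1) as"
  then obtain i ps where as: "as = i # ps" "okr w (replicate K 1) ps" by (auto simp: okr_Cons)
  have out: "updE (length w) Xs (env w ps) i v = {}" if "K \<le> v" for v
    using that Xs env_out[OF as(2)] by (subst updE_out) auto
  have *: "env w bs = updE (length w) Xs (env w ps) i \<longleftrightarrow> (\<forall>v<K. env w bs v = updE (length w) Xs (env w ps) i v)"
    if "okr w (replicate K 1) bs" for bs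
    using out env_out[OF that] unfolding fun_eq_iff by (metis not_less)
  obtain bs where "okr w (replicate K 1) bs" "env w bs = updE (length w) Xs (env w ps) i"
    using ex_okr_env[OF venv_updE[OF venv_env Xs(1)] out] by blast
  then have "P w (updE (length w) Xs (env w ps) i) \<longleftrightarrow> (\<exists>bs. okr w (replicate K 1) bs \<and>
     (\<forall>v<K. env w bs v = updE (length w) Xs (env w ps) i v) \<and> P w (env w bs))"
    using * by metis
  then show "P w (updE (length w) Xs (env w (drop 1 as)) (as ! 0)) \<longleftrightarrow> (\<exists>bs. okr w (replicate K 1) bs \<and>
     (\<forall>v<K. env w bs v = updE (length w) Xs (env w (drop 1 as)) (as ! 0) v) \<and> P w (env w bs))"
    by (simp add: as)
qed

section \<open>The word read by a groupoidal quantifier\<close>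

lemma first_true_iff: "g \<le> length bs \<Longrightarrow> first_true bs = g \<longleftrightarrow> (\<forall>l<g. \<not> bs ! l) \<and> (g < length bs \<longrightarrow> bs ! g)"
proof (induction bs arbitrary: g)
  case (Cons b bs)
  then show ?case by (cases g) (auto simp: first_true_def all_less_Suc2)
qed (simp add: first_true_def)

lemma first_true_le: "first_true bs \<le> length bs"
  by (simp add: first_true_def length_takeWhile_le)

lemma brv_bound: "brv f u g \<Longrightarrow> is_groupoid m f \<Longrightarrow> set u \<subseteq> {..<m} \<Longrightarrow> g < m"
  by (induction rule: brv.induct) (auto simp: is_groupoid_def)

lemma brv_Nil: "brv f u g \<Longrightarrow> u \<noteq> []"
  by (induction rule: brv.induct) auto

lemma map_upt_split:
  assumes "map h [i..<j] = u @ v"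
  shows "u = map h [i..<i + length u] \<and> v = map h [i + length u..<j]"
proof -
  have l: "length u + length v = j - i" using assms by (metis length_append length_map length_upt)
  have "u = take (length u) (map h [i..<j])" "v = drop (length u) (map h [i..<j])" using assms by simp_all
  moreover have "take (length u) [i..<j] = [i..<i + length u]"
  proof (cases "u = []")
    case False
    then have "i + length u \<le> j" using l by (cases u) auto
    then show ?thesis by (rule take_upt)
  qed simp
  ultimately show ?thesis by (metis drop_map drop_upt take_map)
qed

text \<open>State \<open>2 + g\<close> with registers \<open>i, j\<close>: the letters at positions \<open>i, \<dots>, j\<close> can be bracketed to \<open>g\<close>. State \<open>2 + m + g\<close> with
register \<open>i\<close> asks the oracle whether letter \<open>i\<close> is \<open>g\<close>.\<close>

lemma pdef_word:
  assumes L: "\<And>g. g < m \<Longrightarrow> pdef s (k # ks) (\<lambda>w as. L w (drop 1 as) (as ! 0) = g)"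
    and Lm: "\<And>w ps i. L w ps i < m" and grp: "is_groupoid m f" and S: "S \<subseteq> {..<m}"
  shows "pdef s ks (\<lambda>w ps. map (L w ps) [0..<cap w k] \<in> word_problem m f S)"
proof (rule sys_pdef)
  define seg where "seg w ps i j = map (L w ps) [i..<Suc j]" for w and ps :: "nat list" and i j
  let ?P = "\<lambda>w ps. map (L w ps) [0..<cap w k] \<in> word_problem m f S"
  let ?K = "\<lambda>q::nat. if q = 0 then [] else if q = 1 then ks else if q < 2 + m then k # k # ks else k # ks"
  let ?R = "\<lambda>w q as q1 as1 q2 as2.
     (q = 1 \<and> (\<exists>g<m. g \<in> S \<and> q1 = 2 + g) \<and> q2 = (0::nat)) \<and> (\<exists>j. Suc j = 2 ^ (length (w :: nat list) * k) \<and> as1 = 0 # j # as) \<or>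
     (\<exists>g<m. \<exists>h<m. q = 2 + f g h \<and> q1 = 2 + g \<and> q2 = 2 + h) \<and>
        (\<exists>i l j ps. as = i # j # ps \<and> as1 = i # l # ps \<and> as2 = Suc l # j # ps) \<or>
     (\<exists>g<m. q = 2 + g \<and> q1 = 2 + m + g \<and> q2 = 0) \<and> (\<exists>i ps. as = i # i # ps \<and> as1 = i # ps)"
  let ?O = "\<lambda>q w as. 2 + m \<le> q \<and> L w (drop 1 as) (as ! 0) = q - (2 + m)"
  let ?Q = "2 + m + m"
  let ?d = "drv ?O ?Q ?K ?R"
  have fm: "f g h < m" if "g < m" "h < m" for g h using grp that by (auto simp: is_groupoid_def)
  have WP: "?P w ps \<longleftrightarrow> (\<exists>g\<in>S. brv f (map (L w ps) [0..<cap w k]) g)" for w ps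
    using Lm by (auto simp: word_problem_def)
  show "sys s ?O ks ?P ?Q ?K ?R (k + 2)"
    unfolding sys_def
  proof (intro conjI allI impI)
    show "1 < ?Q" using grp by (auto simp: is_groupoid_def)
  next
    fix q q1 q2 :: nat assume q: "q < ?Q" "q1 < ?Q" "q2 < ?Q"
    show "fr3 s (?K q) (?K q1) (?K q2) (\<lambda>w as as1 as2. ?R w q as q1 as1 q2 as2)"
      unfolding fr3_def
    proof (intro allI impI fodef_disj; rule fodef_guard)
      fix vs vs1 vs2 :: "nat list list"
      assume l: "map length vs = ?K q" "map length vs1 = ?K q1" "map length vs2 = ?K q2"
        and q: "q = 1 \<and> (\<exists>g<m. g \<in> S \<and> q1 = 2 + g) \<and> q2 = 0"
      then have "map length vs = ks" "map length vs1 = k # k # ks" by auto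
      then obtain a b c where v: "vs1 = a # b # c" "length a = k" "length b = k" "map length c = map length vs" by (auto simp: map_eq_Cons_conv)
      have "fodef s (\<lambda>w e. wnum w e a = 0 \<and> Suc (wnum w e b) = cap w k \<and> nums w e c = nums w e vs)"
        using v by (intro fod) simp_all
      then show "fodef s (\<lambda>w e. \<exists>j. Suc j = cap w k \<and> nums w e vs1 = 0 # j # nums w e vs)"
        by (rule fodef_cong) (auto simp: v)
    next
      fix vs vs1 vs2 :: "nat list list"
      assume l: "map length vs = ?K q" "map length vs1 = ?K q1" "map length vs2 = ?K q2"
        and q: "\<exists>g<m. \<exists>h<m. q = 2 + f g h \<and> q1 = 2 + g \<and> q2 = 2 + h"
      then have "map length vs = k # k # ks" "map length vs1 = k # k # ks" "map length vs2 = k # k # ks" using fm by auto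
      then obtain a b c a1 b1 c1 a2 b2 c2 where v: "vs = a # b # c" "vs1 = a1 # b1 # c1" "vs2 = a2 # b2 # c2"
        "length a = k" "length b = k" "map length c = ks" "length a1 = k" "length b1 = k" "map length c1 = ks"
        "length a2 = k" "length b2 = k" "map length c2 = ks" by (auto simp: map_eq_Cons_conv)
      have "fodef s (\<lambda>w e. wnum w e a1 = wnum w e a \<and> wnum w e a2 = Suc (wnum w e b1) \<and>
          wnum w e b2 = wnum w e b \<and> nums w e c1 = nums w e c \<and> nums w e c2 = nums w e c)"
        using v by (intro fod) simp_all
      then show "fodef s (\<lambda>w e. \<exists>i l j ps. nums w e vs = i # j # ps \<and> nums w e vs1 = i # l # ps \<and> nums w e vs2 = Suc l # j # ps)"
        by (rule fodef_cong) (auto simp: v)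
    next
      fix vs vs1 vs2 :: "nat list list"
      assume l: "map length vs = ?K q" "map length vs1 = ?K q1" "map length vs2 = ?K q2"
        and q: "\<exists>g<m. q = 2 + g \<and> q1 = 2 + m + g \<and> q2 = 0"
      then have "map length vs = k # k # ks" "map length vs1 = k # ks" by auto
      then obtain a b c a1 c1 where v: "vs = a # b # c" "vs1 = a1 # c1"
        "length a = k" "length b = k" "map length c = ks" "length a1 = k" "map length c1 = ks" by (auto simp: map_eq_Cons_conv)
      have "fodef s (\<lambda>w e. wnum w e a = wnum w e b \<and> wnum w e a1 = wnum w e a \<and> nums w e c1 = nums w e c)"
        using v by (intro fod) simp_all
      then show "fodef s (\<lambda>w e. \<exists>i ps. nums w e vs = i # i # ps \<and> nums w e vs1 = i # ps)"
        by (rule fodef_cong) (auto simp: v)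
    qed
  next
    \<comment> \<open>Each letter costs two steps, its rule and the oracle question, and each
      product one, which makes \<open>3 * length u - 1\<close> in all.\<close>
    have main: "\<exists>a<3 * length u. ?d w (2 + g) (i # j # ps) a"
      if "brv f u g" "u = seg w ps i j" "i \<le> j" "j < cap w k" "okr w ks ps" for u g w ps i j
      using that
    proof (induction arbitrary: i j)
      case (single g)
      then have "i = j" "g = L w ps i" by (auto simp: seg_def upt_conv_Cons split: if_splits dest: arg_cong[where f = length])
      have "?d w (2 + m + g) (i # ps) 1" using \<open>g = _\<close> Lm by (intro drv.ask) auto
      then have "?d w (2 + g) (i # j # ps) (Suc (1 + 0))"
        using \<open>i = j\<close> \<open>g = _\<close> Lm single
        by (intro drv.rule[where ?q1.0 = "2 + m + g" and ?q2.0 = 0 and ?as1.0 = "i # ps" and ?as2.0 = "[]"] drv.finished) (auto simp: trans_less_add1)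
      then show ?case by (intro exI[of _ "Suc (1 + 0)"]) simp
    next
      case (split u g v h)
      have uv: "u = map (L w ps) [i..<i + length u]" "v = map (L w ps) [i + length u..<Suc j]"
        using map_upt_split[of "L w ps" i "Suc j" u v] split.prems(1) by (simp_all add: seg_def)
      have "0 < length u" "0 < length v" using split.hyps brv_Nil by blast+
      define l where "l = i + length u - 1"
      have l: "i + length u = Suc l" using \<open>0 < length u\<close> by (simp add: l_def)
      have "length v = Suc j - Suc l" using arg_cong[OF uv(2), of length] by (simp add: l del: upt_Suc)
      then have il: "i \<le> l" "Suc l \<le> j" using \<open>0 < length u\<close> \<open>0 < length v\<close> l by linarith+
      have "set (map (L w ps) xs) \<subseteq> {..<m}" for xs using Lm by auto
      then have gh: "g < m" "h < m" using brv_bound[OF _ grp] split.hyps uv by metis+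
      obtain a where a: "a < 3 * length u" "?d w (2 + g) (i # l # ps) a"
        using split.IH(1)[of i l] uv(1) l il split.prems by (auto simp: seg_def)
      obtain b where b: "b < 3 * length v" "?d w (2 + h) (Suc l # j # ps) b"
        using split.IH(2)[of "Suc l" j] uv(2) l il split.prems by (auto simp: seg_def)
      have "?d w (2 + f g h) (i # j # ps) (Suc (a + b))"
        by (rule drv.rule[OF _ _ _ _ _ _ _ a(2) b(2)]) (use gh fm[OF gh] il split.prems in auto)
      then show ?case using a(1) b(1) by (intro exI[of _ "Suc (a + b)"]) simp
    qed
    fix w ps assume w: "is_string s w" "okr w ks ps" and P: "?P w ps"
    define j where "j = cap w k - (1::nat)"
    have j: "Suc j = cap w k" by (simp add: j_def)
    obtain g where g: "g \<in> S" "brv f (seg w ps 0 j) g" using P unfolding WP seg_def j by blast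
    obtain a where a: "a < 3 * length (seg w ps 0 j)" "?d w (2 + g) (0 # j # ps) a"
      using main[OF g(2) refl, of ] j w by auto
    have "?d w 1 ps (Suc (a + 0))"
      using a(2) g(1) S j w by (intro drv.rule[where ?q1.0 = "2 + g" and ?q2.0 = 0 and ?as1.0 = "0 # j # ps" and ?as2.0 = "[]"] drv.finished) auto
    moreover have "Suc (a + 0) \<le> 2 ^ ((k + 2) * length w)"
    proof -
      have "(4::nat) \<le> 2 ^ (2 * length w)" using is_string_pos[OF w(1)] power_increasing[of 2 "2 * length w" "2::nat"]
        by (cases "length w") auto
      then have "4 * cap w k \<le> (2::nat) ^ (2 * length w) * cap w k" by (intro mult_right_mono) auto
      also have "\<dots> = 2 ^ ((k + 2) * length w)" by (simp add: power_add[symmetric] algebra_simps)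
      finally show ?thesis using a(1) j by (simp add: seg_def del: upt_Suc)
    qed
    ultimately show "\<exists>a\<le>2 ^ ((k + 2) * length w). ?d w 1 ps a" by blast
  next
    have sound: "(q = 1 \<longrightarrow> ?P w as) \<and> (\<forall>g<m. q = 2 + g \<longrightarrow> (\<forall>i j ps. as = i # j # ps \<longrightarrow> i \<le> j \<and> brv f (seg w ps i j) g)) \<and>
       (2 + m \<le> q \<longrightarrow> L w (drop 1 as) (as ! 0) = q - (2 + m))"
      if "?d w q as a" for w q as a
      using that
    proof induction
      case (rule q q1 q2 as1 as2 as a b)
      from rule.hyps(7) consider
        g j where "q = 1" "g < m" "g \<in> S" "q1 = 2 + g" "Suc j = cap w k" "as1 = 0 # j # as"
        | g h i l j ps where "g < m" "h < m" "q = 2 + f g h" "q1 = 2 + g" "q2 = 2 + h"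
            "as = i # j # ps" "as1 = i # l # ps" "as2 = Suc l # j # ps"
        | g i ps where "g < m" "q = 2 + g" "q1 = 2 + m + g" "as = i # i # ps" "as1 = i # ps" by blast
      then show ?case
      proof cases
        case 1
        have "brv f (seg w as 0 j) g" using rule.IH(1) 1 by blast
        then have "?P w as" unfolding WP using 1 by (auto simp: seg_def simp del: upt_Suc)
        then show ?thesis using 1 by simp
      next
        case 2
        have x: "i \<le> l" "brv f (seg w ps i l) g" and y: "Suc l \<le> j" "brv f (seg w ps (Suc l) j) h"
          using rule.IH 2 by blast+
        have "[i..<Suc j] = [i..<Suc l] @ [Suc l..<Suc j]"
          using x(1) y(1) upt_add_eq_append[of i "Suc l" "Suc j - Suc l"] by (simp del: upt_Suc)
        then have "brv f (seg w ps i j) (f g h)" using brv.split[OF x(2) y(2)] unfolding seg_def map_append[symmetric] by (simp only:)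
        then show ?thesis using 2 fm[OF 2(1,2)] x y by auto
      next
        case 3
        have "L w ps i = g" using rule.IH(1) 3 by auto
        then have "brv f (seg w ps i i) g" using brv.single[of f g] by (simp add: seg_def)
        then show ?thesis using 3 by auto
      qed
    qed auto
    fix w as a assume "?d w 1 as a"
    then show "?P w as" using sound by blast
  qed simp
  show "pdef s (?K q) (?O q)" if "0 < q" "q < ?Q" for q
  proof (cases "2 + m \<le> q")
    case True
    then show ?thesis using L[of "q - (2 + m)"] that by simp
  qed (simp add: pdef_const)
qed

definition letter_index where
  "letter_index \<phi>s Xs w e i = first_true (map (\<lambda>\<phi>. sat_env \<phi> w (updE (length w) Xs e i)) \<phi>s)"

lemma sat_env_Qg: "sat_env (Qg m f S Xs \<phi>s) w e \<longleftrightarrow> map (letter_index \<phi>s Xs w e) [0..<cap w (length Xs)] \<in> word_problem m f S"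
  unfolding letter_index_def[abs_def] sat_env_updE by (simp add: sat_env_def)

text \<open>A letter is the index of the first true formula, so earlier formulas must be false: even
  a quantifier without negations in its scope depends on closure under complement.\<close>

lemma pdef_letter_index:
  assumes \<phi>s: "\<And>\<phi>. \<phi> \<in> set \<phi>s \<Longrightarrow> pdef s (replicate K 1) (\<lambda>w as. sat_env \<phi> w (env w as))"
    and Xs: "distinct Xs" "\<forall>X\<in>set Xs. 2 * X < K" and g: "g \<le> length \<phi>s"
  shows "pdef s (length Xs # replicate K 1) (\<lambda>w as. letter_index \<phi>s Xs w (env w (drop 1 as)) (as ! 0) = g)"
proof -
  have *: "pdef s (length Xs # replicate K 1) (\<lambda>w as. sat_env (\<phi>s ! l) w (updE (length w) Xs (env w (drop 1 as)) (as ! 0)))"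
    if "l < length \<phi>s" for l
    using that by (intro pdef_updE \<phi>s Xs) simp
  have "pdef s (length Xs # replicate K 1) (\<lambda>w as. (\<forall>l<g. \<not> sat_env (\<phi>s ! l) w (updE (length w) Xs (env w (drop 1 as)) (as ! 0))) \<and>
      (length \<phi>s \<le> g \<or> sat_env (\<phi>s ! g) w (updE (length w) Xs (env w (drop 1 as)) (as ! 0))))"
  proof (cases "g < length \<phi>s")
    case True
    then show ?thesis by (intro pdef_conj pdef_all_less pdef_not pdef_disj pdef_const *) auto
  next
    case False
    then have "pdef s (length Xs # replicate K 1) (\<lambda>w as. \<forall>l<g. \<not> sat_env (\<phi>s ! l) w (updE (length w) Xs (env w (drop 1 as)) (as ! 0)))"
      using g by (intro pdef_all_less pdef_not *) auto
    then show ?thesis using False by simp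
  qed
  then show ?thesis
    by (rule pdef_cong) (use g in \<open>auto simp: letter_index_def first_true_iff\<close>)
qed

lemma sat_env_upd: "sat_env (ExS X \<phi>) w e \<longleftrightarrow> (\<exists>A\<subseteq>{..<length w}. sat_env \<phi> w (e(2 * X := A)))"
  "sat_env (AllS X \<phi>) w e \<longleftrightarrow> \<not> (\<exists>A\<subseteq>{..<length w}. \<not> sat_env \<phi> w (e(2 * X := A)))"
proof -
  have "sat_env \<phi> w (e(2 * X := A)) = sat w (\<lambda>x. lst (e (Suc (2 * x)))) ((\<lambda>X. e (2 * X))(X := A)) \<phi>" for A
  proof -
    have "(\<lambda>x. lst ((e(2 * X := A)) (Suc (2 * x)))) = (\<lambda>x. lst (e (Suc (2 * x))))"
      by (rule ext) (simp add: fun_upd_def, presburger)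
    moreover have "(\<lambda>Y. (e(2 * X := A)) (2 * Y)) = (\<lambda>X. e (2 * X))(X := A)" by (rule ext) simp
    ultimately show ?thesis by (simp only: sat_env_def)
  qed
  then show "sat_env (ExS X \<phi>) w e \<longleftrightarrow> (\<exists>A\<subseteq>{..<length w}. sat_env \<phi> w (e(2 * X := A)))"
    "sat_env (AllS X \<phi>) w e \<longleftrightarrow> \<not> (\<exists>A\<subseteq>{..<length w}. \<not> sat_env \<phi> w (e(2 * X := A)))"
    by (auto simp: sat_env_def[of "ExS X \<phi>"] sat_env_def[of "AllS X \<phi>"])
qed

lemma ex_lst: "0 < n \<Longrightarrow> (\<exists>a<n. P a) \<longleftrightarrow> (\<exists>A\<subseteq>{..<n}. P (lst A))"
  using lst_less by (metis lst_single empty_subsetI insert_subset lessThan_iff)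

lemma sat_env_upd':
  assumes "w \<noteq> []"
  shows "sat_env (Ex x \<phi>) w e \<longleftrightarrow> (\<exists>A\<subseteq>{..<length w}. sat_env \<phi> w (e(Suc (2 * x) := A)))"
    "sat_env (All x \<phi>) w e \<longleftrightarrow> \<not> (\<exists>A\<subseteq>{..<length w}. \<not> sat_env \<phi> w (e(Suc (2 * x) := A)))"
proof -
  have *: "sat_env \<phi> w (e(Suc (2 * x) := A)) = sat w ((\<lambda>x. lst (e (Suc (2 * x))))(x := lst A)) (\<lambda>X. e (2 * X)) \<phi>" for A
  proof -
    have ne: "2 * X \<noteq> Suc (2 * x)" for X by presburger
    have "(\<lambda>X. (e(Suc (2 * x) := A)) (2 * X)) = (\<lambda>X. e (2 * X))"
      by (rule ext) (use ne in \<open>simp add: fun_upd_def\<close>)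
    moreover have "(\<lambda>y. lst ((e(Suc (2 * x) := A)) (Suc (2 * y)))) = (\<lambda>x. lst (e (Suc (2 * x))))(x := lst A)"
      by (rule ext) simp
    ultimately show ?thesis by (simp only: sat_env_def)
  qed
  note ex = ex_lst[of "length w"]
  show "sat_env (Ex x \<phi>) w e \<longleftrightarrow> (\<exists>A\<subseteq>{..<length w}. sat_env \<phi> w (e(Suc (2 * x) := A)))"
    unfolding * using ex assms by (simp add: sat_env_def)
  have "sat_env (All x \<phi>) w e \<longleftrightarrow> \<not> (\<exists>a<length w. \<not> sat w ((\<lambda>x. lst (e (Suc (2 * x))))(x := a)) (\<lambda>X. e (2 * X)) \<phi>)"
    by (simp add: sat_env_def)
  then show "sat_env (All x \<phi>) w e \<longleftrightarrow> \<not> (\<exists>A\<subseteq>{..<length w}. \<not> sat_env \<phi> w (e(Suc (2 * x) := A)))"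
    unfolding * using ex assms by simp
qed

lemma pdef_atom:
  assumes "fodef s (sat_env \<phi>)" "\<And>w e e'. (\<And>v. v < K0 \<Longrightarrow> e v = e' v) \<Longrightarrow> sat_env \<phi> w e = sat_env \<phi> w e'"
  shows "\<exists>K0. \<forall>K\<ge>K0. pdef s (replicate K 1) (\<lambda>w as. sat_env \<phi> w (env w as))"
  by (intro exI[of _ K0] allI impI pdef_fodef assms) auto

lemma tval_cong: "(\<And>v. v \<in> tvars t \<Longrightarrow> fo v = fo' v) \<Longrightarrow> tval w fo t = tval w fo' t"
  by (cases t) auto

lemma tvars_bound: "\<exists>b. \<forall>x\<in>tvars t. x < b"
  by (cases t) auto

text \<open>Quantifying over all sufficiently many registers lets subformulas share a common number
  \<open>K\<close>, the maximum of their bounds. The bound exceeds all variables that the formula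
  mentions.\<close>

lemma pdef_formula: "wf s \<phi> \<Longrightarrow> \<exists>K0. \<forall>K\<ge>K0. pdef s (replicate K 1) (\<lambda>w as. sat_env \<phi> w (env w as))"
proof (induction \<phi>)
  case (Eq t u)
  obtain b c where "\<forall>x\<in>tvars t. x < b" "\<forall>x\<in>tvars u. x < c" using tvars_bound by meson
  then have "sat_env (Eq t u) w e = sat_env (Eq t u) w e'" if "\<And>v. v < 2 * b + 2 * c \<Longrightarrow> e v = e' v" for w e e'
    using that tval_cong[of t "\<lambda>x. lst (e (Suc (2 * x)))" "\<lambda>x. lst (e' (Suc (2 * x)))" w]
      tval_cong[of u "\<lambda>x. lst (e (Suc (2 * x)))" "\<lambda>x. lst (e' (Suc (2 * x)))" w] by (fastforce simp: sat_env_def)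
  then show ?case by (intro pdef_atom[where ?K0.0 = "2 * b + 2 * c"] fodef_atoms) blast
next
  case (Lt t u)
  obtain b c where "\<forall>x\<in>tvars t. x < b" "\<forall>x\<in>tvars u. x < c" using tvars_bound by meson
  then have "sat_env (Lt t u) w e = sat_env (Lt t u) w e'" if "\<And>v. v < 2 * b + 2 * c \<Longrightarrow> e v = e' v" for w e e'
    using that tval_cong[of t "\<lambda>x. lst (e (Suc (2 * x)))" "\<lambda>x. lst (e' (Suc (2 * x)))" w]
      tval_cong[of u "\<lambda>x. lst (e (Suc (2 * x)))" "\<lambda>x. lst (e' (Suc (2 * x)))" w] by (fastforce simp: sat_env_def)
  then show ?case by (intro pdef_atom[where ?K0.0 = "2 * b + 2 * c"] fodef_atoms) blast
next
  case (Pr a t)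
  obtain b where "\<forall>x\<in>tvars t. x < b" using tvars_bound by meson
  then have "sat_env (Pr a t) w e = sat_env (Pr a t) w e'" if "\<And>v. v < 2 * b \<Longrightarrow> e v = e' v" for w e e'
    using that tval_cong[of t "\<lambda>x. lst (e (Suc (2 * x)))" "\<lambda>x. lst (e' (Suc (2 * x)))" w] by (fastforce simp: sat_env_def)
  moreover have "a < s" using Pr.prems by simp
  ultimately show ?case by (intro pdef_atom[where ?K0.0 = "2 * b"] fodef_atoms) blast+
next
  case (Mem X t)
  obtain b where "\<forall>x\<in>tvars t. x < b" using tvars_bound by meson
  then have "sat_env (Mem X t) w e = sat_env (Mem X t) w e'" if "\<And>v. v < 2 * b + 2 * X + 1 \<Longrightarrow> e v = e' v" for w e e'
    using that tval_cong[of t "\<lambda>x. lst (e (Suc (2 * x)))" "\<lambda>x. lst (e' (Suc (2 * x)))" w] by (fastforce simp: sat_env_def)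
  then show ?case by (intro pdef_atom[where ?K0.0 = "2 * b + 2 * X + 1"] fodef_atoms) blast
next
  case (Neg \<phi>)
  have "sat_env (Neg \<phi>) = (\<lambda>w e. \<not> sat_env \<phi> w e)" by (simp add: sat_env_def fun_eq_iff)
  moreover obtain K1 where "\<forall>K\<ge>K1. pdef s (replicate K 1) (\<lambda>w as. sat_env \<phi> w (env w as))" using Neg by auto
  ultimately show ?case by (intro exI[of _ K1]) (auto intro: pdef_not)
next
  case (Conj \<phi> \<psi>)
  then obtain K1 K2 where "\<forall>K\<ge>K1. pdef s (replicate K 1) (\<lambda>w as. sat_env \<phi> w (env w as))" "\<forall>K\<ge>K2. pdef s (replicate K 1) (\<lambda>w as. sat_env \<psi> w (env w as))" by auto
  moreover have "sat_env (Conj \<phi> \<psi>) = (\<lambda>w e. sat_env \<phi> w e \<and> sat_env \<psi> w e)" by (simp add: sat_env_def fun_eq_iff)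
  ultimately show ?case by (intro exI[of _ "max K1 K2"]) (auto intro: pdef_conj)
next
  case (Disj \<phi> \<psi>)
  then obtain K1 K2 where "\<forall>K\<ge>K1. pdef s (replicate K 1) (\<lambda>w as. sat_env \<phi> w (env w as))" "\<forall>K\<ge>K2. pdef s (replicate K 1) (\<lambda>w as. sat_env \<psi> w (env w as))" by auto
  moreover have "sat_env (Disj \<phi> \<psi>) = (\<lambda>w e. sat_env \<phi> w e \<or> sat_env \<psi> w e)" by (simp add: sat_env_def fun_eq_iff)
  ultimately show ?case by (intro exI[of _ "max K1 K2"]) (auto intro: pdef_disj)
next
  case (Ex x \<phi>)
  then obtain K1 where K1: "\<And>K. K1 \<le> K \<Longrightarrow> pdef s (replicate K 1) (\<lambda>w as. sat_env \<phi> w (env w as))" by auto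
  show ?case
  proof (intro exI[of _ "max K1 (2 * x + 2)"] allI impI)
    fix K assume K: "max K1 (2 * x + 2) \<le> K"
    have "pdef s (replicate K 1) (\<lambda>w as. \<exists>A\<subseteq>{..<length w}. sat_env \<phi> w ((env w as)(Suc (2 * x) := A)))"
      by (rule pdef_ex_var[where P = "sat_env \<phi>", OF K1]) (use K in auto)
    then show "pdef s (replicate K 1) (\<lambda>w as. sat_env (Ex x \<phi>) w (env w as))"
      by (rule pdef_cong) (auto simp: sat_env_upd' is_string_def)
  qed
next
  case (All x \<phi>)
  then obtain K1 where K1: "\<And>K. K1 \<le> K \<Longrightarrow> pdef s (replicate K 1) (\<lambda>w as. sat_env \<phi> w (env w as))" by auto
  show ?case
  proof (intro exI[of _ "max K1 (2 * x + 2)"] allI impI)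
    fix K assume K: "max K1 (2 * x + 2) \<le> K"
    have "pdef s (replicate K 1) (\<lambda>w as. \<not> (\<exists>A\<subseteq>{..<length w}. \<not> sat_env \<phi> w ((env w as)(Suc (2 * x) := A))))"
      by (rule pdef_not, rule pdef_ex_var[where P = "\<lambda>w e. \<not> sat_env \<phi> w e", OF pdef_not[OF K1]]) (use K in auto)
    then show "pdef s (replicate K 1) (\<lambda>w as. sat_env (All x \<phi>) w (env w as))"
      by (rule pdef_cong) (auto simp: sat_env_upd' is_string_def)
  qed
next
  case (ExS X \<phi>)
  then obtain K1 where K1: "\<And>K. K1 \<le> K \<Longrightarrow> pdef s (replicate K 1) (\<lambda>w as. sat_env \<phi> w (env w as))" by auto
  show ?case
  proof (intro exI[of _ "max K1 (2 * X + 1)"] allI impI)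
    fix K assume K: "max K1 (2 * X + 1) \<le> K"
    have "pdef s (replicate K 1) (\<lambda>w as. \<exists>A\<subseteq>{..<length w}. sat_env \<phi> w ((env w as)(2 * X := A)))"
      by (rule pdef_ex_var[where P = "sat_env \<phi>", OF K1]) (use K in auto)
    then show "pdef s (replicate K 1) (\<lambda>w as. sat_env (ExS X \<phi>) w (env w as))"
      by (rule pdef_cong) (auto simp: sat_env_upd)
  qed
next
  case (AllS X \<phi>)
  then obtain K1 where K1: "\<And>K. K1 \<le> K \<Longrightarrow> pdef s (replicate K 1) (\<lambda>w as. sat_env \<phi> w (env w as))" by auto
  show ?case
  proof (intro exI[of _ "max K1 (2 * X + 1)"] allI impI)
    fix K assume K: "max K1 (2 * X + 1) \<le> K"
    have "pdef s (replicate K 1) (\<lambda>w as. \<not> (\<exists>A\<subseteq>{..<length w}. \<not> sat_env \<phi> w ((env w as)(2 * X := A))))"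
      by (rule pdef_not, rule pdef_ex_var[where P = "\<lambda>w e. \<not> sat_env \<phi> w e", OF pdef_not[OF K1]]) (use K in auto)
    then show "pdef s (replicate K 1) (\<lambda>w as. sat_env (AllS X \<phi>) w (env w as))"
      by (rule pdef_cong) (auto simp: sat_env_upd)
  qed
next
  case (Qg m f S Xs \<phi>s)
  then have "\<forall>\<phi>\<in>set \<phi>s. \<exists>K0. \<forall>K\<ge>K0. pdef s (replicate K 1) (\<lambda>w as. sat_env \<phi> w (env w as))" by auto
  then obtain k where k: "\<And>\<phi> K. \<phi> \<in> set \<phi>s \<Longrightarrow> k \<phi> \<le> K \<Longrightarrow> pdef s (replicate K 1) (\<lambda>w as. sat_env \<phi> w (env w as))" by metis
  have wf: "is_groupoid m f" "S \<subseteq> {..<m}" "distinct Xs" "length \<phi>s = m - 1" "0 < m" using Qg.prems by (auto simp: is_groupoid_def)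
  show ?case
  proof (intro exI[of _ "Suc (2 * Max (insert 0 (set Xs))) + sum_list (map k \<phi>s)"] allI impI)
    fix K assume K: "Suc (2 * Max (insert 0 (set Xs))) + sum_list (map k \<phi>s) \<le> K"
    have kK: "k \<phi> \<le> K" if "\<phi> \<in> set \<phi>s" for \<phi> using that member_le_sum_list[of "k \<phi>" "map k \<phi>s"] K by simp
    have "\<forall>X\<in>set Xs. 2 * X < K"
    proof
      fix X assume "X \<in> set Xs"
      then have "X \<le> Max (insert 0 (set Xs))" by (intro Max_ge) auto
      then show "2 * X < K" using K by linarith
    qed
    then have lt: "pdef s (length Xs # replicate K 1) (\<lambda>w as. letter_index \<phi>s Xs w (env w (drop 1 as)) (as ! 0) = g)" if "g < m" for g
      using that wf k kK by (intro pdef_letter_index) auto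
    have "letter_index \<phi>s Xs w e i < m" for w e i
      using first_true_le[of "map (\<lambda>\<phi>. sat_env \<phi> w (updE (length w) Xs e i)) \<phi>s"] wf by (simp add: letter_index_def)
    then show "pdef s (replicate K 1) (\<lambda>w as. sat_env (Qg m f S Xs \<phi>s) w (env w as))"
      unfolding sat_env_Qg by (intro pdef_word[where L = "\<lambda>w as. letter_index \<phi>s Xs w (env w as)"] lt wf)
  qed
qed

subsection \<open>A groupoid for pushdown runs with skippable blocks\<close>

datatype letter = Ne | Psh bool | Pop bool | LB | RB

text \<open>Pushdown runs in which a bracketed block \<open>LB \<dots> RB\<close> may be skipped; \<open>run u st\<close>: from the stack \<open>st\<close>,
  the word \<open>u\<close> can be processed such that the stack is empty at the end.\<close>

definition movs :: "letter set" where
  "movs = range Psh \<union> range Pop"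

inductive run :: "letter list \<Rightarrow> bool list \<Rightarrow> bool" where
  run_Nil: "run [] []"
| run_Psh: "run v (b # st) \<Longrightarrow> run (Psh b # v) st"
| run_Pop: "run v st \<Longrightarrow> run (Pop b # v) (b # st)"
| run_LB: "run v st \<Longrightarrow> run (LB # v) st"
| run_RB: "run v st \<Longrightarrow> run (RB # v) st"
| run_skip: "run v st \<Longrightarrow> set x \<subseteq> movs \<Longrightarrow> run (LB # x @ RB # v) st"

text \<open>A grammar for the words that have a run from the empty stack: \<open>ND\<close> derives the words without effect,
  \<open>NO b\<close> and \<open>NC b\<close> those pushing and popping \<open>b\<close>, and \<open>NL\<close> the proper prefixes of a skipped block.\<close>

datatype nt = ND | NO bool | NC bool | NL | NR | NA

inductive rul :: "nt \<Rightarrow> nt \<Rightarrow> nt \<Rightarrow> bool" where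
  "rul ND ND ND"
| "rul ND (NO b) (NC b)"
| "rul ND NL NR"
| "rul (NO b) (NO b) ND"
| "rul NL NL NA"
| "rul NA NA NA"

text \<open>A bracket by itself is also effect-free, since an executed block ignores its brackets. A
  move is also an arbitrary move \<open>NA\<close>, as it can lie in a skipped block.\<close>

fun lts :: "letter \<Rightarrow> nt set" where
  "lts Ne = {}"
| "lts (Psh b) = {NO b, NA}"
| "lts (Pop b) = {NC b, NA}"
| "lts LB = {NL, ND}"
| "lts RB = {NR, ND}"

inductive der :: "nt \<Rightarrow> letter list \<Rightarrow> bool" where
  der_single: "X \<in> lts l \<Longrightarrow> der X [l]"
| der_split: "rul X Y Z \<Longrightarrow> der Y u \<Longrightarrow> der Z v \<Longrightarrow> der X (u @ v)"

text \<open>Each nonterminal is given its meaning as an operation on runs: what the derived word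
  does in front of an arbitrary continuation \<open>v\<close>.\<close>

lemma der_run:
  "der X u \<Longrightarrow> (case X of ND \<Rightarrow> (\<forall>v st. run v st \<longrightarrow> run (u @ v) st)
     | NO b \<Rightarrow> (\<forall>v st. run v (b # st) \<longrightarrow> run (u @ v) st)
     | NC b \<Rightarrow> (\<forall>v st. run v st \<longrightarrow> run (u @ v) (b # st))
     | NL \<Rightarrow> (\<exists>x. u = LB # x \<and> set x \<subseteq> movs) | NR \<Rightarrow> u = [RB] | NA \<Rightarrow> set u \<subseteq> movs)"
proof (induction rule: der.induct)
  case (der_single X l)
  then show ?case by (cases l) (auto simp: movs_def intro: run.intros)
next
  case (der_split X Y Z u v)
  then show ?case by (cases rule: rul.cases) (auto intro: run.intros)
qed

definition noeff :: "letter list \<Rightarrow> bool" where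
  "noeff u \<longleftrightarrow> u = [] \<or> der ND u"

text \<open>Cuts a word at the moments when the elements of the initial stack are popped; the pieces
  between them are effect-free. After a push, the first cut is the pop matching it.\<close>

fun pops :: "bool list \<Rightarrow> letter list \<Rightarrow> bool" where
  "pops [] w = noeff w"
| "pops (b # st) w = (\<exists>u v. w = u @ Pop b # v \<and> noeff u \<and> pops st v)"

lemma noeff_append: "der ND u \<Longrightarrow> noeff v \<Longrightarrow> noeff (u @ v)"
  using der_split[OF rul.intros(1)] by (auto simp: noeff_def)

lemma pops_append: "der ND u \<Longrightarrow> pops st v \<Longrightarrow> pops st (u @ v)"
proof (cases st)
  case (Cons b st')
  assume u: "der ND u" and "pops st v"
  then obtain v1 v2 where "v = v1 @ Pop b # v2" "noeff v1" "pops st' v2" using Cons by auto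
  then show ?thesis using noeff_append[OF u] Cons
    by (simp only: pops.simps) (intro exI[of _ "u @ v1"] exI[of _ v2], simp)
qed (simp add: noeff_append)

lemma der_skip: "set x \<subseteq> movs \<Longrightarrow> der ND (LB # x @ [RB])"
proof -
  have "der NL (LB # x)" if "set x \<subseteq> movs" using that
  proof (induction x rule: rev_induct)
    case Nil show ?case using der_single[of NL LB] by simp
  next
    case (snoc l x)
    have "der NA [l]" using snoc.prems by (intro der_single) (auto simp: movs_def)
    then show ?case using der_split[OF rul.intros(5), of "LB # x" "[l]"] snoc by simp
  qed
  then show "set x \<subseteq> movs \<Longrightarrow> der ND (LB # x @ [RB])"
    using der_split[OF rul.intros(3), of "LB # x" "[RB]"] der_single[of NR RB] by simp
qed

lemma run_pops: "run u st \<Longrightarrow> pops st u"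
proof (induction rule: run.induct)
  case run_Nil then show ?case by (simp add: noeff_def)
next
  case (run_Psh v b st)
  then obtain u v' where v: "v = u @ Pop b # v'" "noeff u" "pops st v'" by auto
  have "der (NO b) [Psh b]" "der (NC b) [Pop b]" by (auto intro: der_single)
  then have "der (NO b) (Psh b # u)"
    using v(2) der_split[OF rul.intros(4), of b "[Psh b]" u] by (auto simp: noeff_def)
  then have "der ND (Psh b # u @ [Pop b])"
    using der_split[OF rul.intros(2), of b "Psh b # u" "[Pop b]"] \<open>der (NC b) [Pop b]\<close> by simp
  from pops_append[OF this v(3)] show ?case by (simp add: v)
next
  case (run_Pop v st b)
  then show ?case by (simp only: pops.simps) (intro exI[of _ "[]"] exI[of _ v], simp add: noeff_def)
next
  case (run_LB v st)
  then show ?case using pops_append[of "[LB]"] der_single[of ND LB] by simp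
next
  case (run_RB v st)
  then show ?case using pops_append[of "[RB]"] der_single[of ND RB] by simp
next
  case (run_skip v st x)
  then show ?case using pops_append[OF der_skip, of x st v] by simp
qed

lemma run_der: "u \<noteq> [] \<Longrightarrow> run u [] \<longleftrightarrow> der ND u"
proof
  assume "u \<noteq> []" "run u []"
  then show "der ND u" using run_pops[of u "[]"] by (simp add: noeff_def)
next
  assume "der ND u"
  then have "run (u @ []) []" using der_run[of ND u] run_Nil by (simp del: append_Nil2)
  then show "run u []" by simp
qed

section \<open>The groupoid of the grammar\<close>

text \<open>No set of nonterminals is neutral for this product, so an identity \<open>None\<close>
  is adjoined; it is distinct from \<open>Some {}\<close>, which stands for a failed
  derivation.\<close>

fun mul :: "nt set option \<Rightarrow> nt set option \<Rightarrow> nt set option" where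
  "mul None y = y"
| "mul x None = x"
| "mul (Some A) (Some B) = Some {X. \<exists>Y\<in>A. \<exists>Z\<in>B. rul X Y Z}"

lemma mul_None [simp]: "mul x None = x" by (cases x) auto

fun lv :: "letter \<Rightarrow> nt set option" where
  "lv l = (if l = Ne then None else Some (lts l))"

inductive gbrv :: "letter list \<Rightarrow> nt set option \<Rightarrow> bool" where
  "gbrv [l] (lv l)"
| "gbrv u x \<Longrightarrow> gbrv v y \<Longrightarrow> gbrv (u @ v) (mul x y)"

abbreviation strip :: "letter list \<Rightarrow> letter list" where
  "strip u \<equiv> filter (\<lambda>l. l \<noteq> Ne) u"

lemma gbrv_sound: "gbrv u x \<Longrightarrow> (case x of None \<Rightarrow> strip u = [] | Some A \<Rightarrow> \<forall>X\<in>A. der X (strip u))"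
proof (induction rule: gbrv.induct)
  case (1 l) then show ?case by (auto intro: der_single)
next
  case (2 u x v y)
  then show ?case by (cases x; cases y) (auto intro: der_split)
qed

lemma gbrv_None: "u \<noteq> [] \<Longrightarrow> strip u = [] \<Longrightarrow> gbrv u None"
proof (induction u)
  case (Cons l u)
  then have l: "l = Ne" "strip u = []" by (auto split: if_splits)
  have "gbrv [Ne] None" using gbrv.intros(1)[of Ne] by simp
  then show ?case using gbrv.intros(2)[of "[Ne]" None u None] Cons.IH l by (cases "u = []") auto
qed simp

lemma gbrv_pad:
  assumes "gbrv v x" "strip u = []" "strip u' = []"
  shows "gbrv (u @ v @ u') x"
proof -
  have "gbrv (v @ u') x" using assms gbrv.intros(2)[OF assms(1) gbrv_None[of u']] by (cases "u' = []") auto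
  then show ?thesis using gbrv.intros(2)[OF gbrv_None[of u], of "v @ u'" x] assms by (cases "u = []") auto
qed

lemma filter_append_split: "filter P u = v1 @ v2 \<Longrightarrow> \<exists>u1 u2. u = u1 @ u2 \<and> filter P u1 = v1 \<and> filter P u2 = v2"
proof (induction u arbitrary: v1)
  case (Cons a u)
  show ?case
  proof (cases "P a \<and> v1 \<noteq> []")
    case True
    then obtain v1' where "v1 = a # v1'" "filter P u = v1' @ v2" using Cons.prems by (cases v1) auto
    then show ?thesis using Cons.IH[of v1'] True by (metis append_Cons filter.simps(2))
  next
    case False
    show ?thesis
    proof (cases "P a")
      case True
      then show ?thesis using Cons.prems False by (intro exI[of _ "[]"] exI[of _ "a # u"]) simp
    next
      case False
      then obtain u1 u2 where "u = u1 @ u2" "filter P u1 = v1" "filter P u2 = v2" using Cons by auto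
      then show ?thesis using False by (intro exI[of _ "a # u1"] exI[of _ u2]) simp
    qed
  qed
qed simp

text \<open>The derivation tree prescribes the bracketing. Neutral letters are distributed over its
  leaves, where they are multiplied onto a single meaningful letter.\<close>

lemma gbrv_complete: "der X v \<Longrightarrow> strip u = v \<Longrightarrow> \<exists>A. gbrv u (Some A) \<and> X \<in> A"
proof (induction arbitrary: u rule: der.induct)
  case (der_single X l)
  then obtain u1 u2 where u: "u = u1 @ l # u2" "\<forall>a\<in>set u1. a = Ne" "l \<noteq> Ne" "strip u2 = []"
    by (auto simp: filter_eq_Cons_iff)
  have "gbrv (u1 @ [l] @ u2) (lv l)" using u by (intro gbrv_pad gbrv.intros) (auto simp: filter_empty_conv)
  then show ?case using u der_single by auto
next
  case (der_split X Y Z v1 v2)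
  from filter_append_split[OF der_split.prems] obtain u1 u2
    where u: "u = u1 @ u2" "strip u1 = v1" "strip u2 = v2" by auto
  obtain A B where AB: "gbrv u1 (Some A)" "Y \<in> A" "gbrv u2 (Some B)" "Z \<in> B"
    using der_split.IH(1)[of u1] der_split.IH(2)[of u2] u by blast
  then have "gbrv u (Some {X. \<exists>Y\<in>A. \<exists>Z\<in>B. rul X Y Z})" using gbrv.intros(2)[OF AB(1,3)] u by simp
  then show ?case using AB der_split by blast
qed

lemma finite_nt: "finite (UNIV :: nt set)"
proof -
  have eq: "(UNIV :: nt set) = {ND, NL, NR, NA} \<union> range NO \<union> range NC"
  proof (intro set_eqI iffI UNIV_I)
    fix x :: nt show "x \<in> {ND, NL, NR, NA} \<union> range NO \<union> range NC" by (cases x) auto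
  qed
  show ?thesis unfolding eq by simp
qed

text \<open>The elements are numbered by a bijection. A word of neutral letters only would multiply
  out to the identity, which is not accepted although the empty word has a run; hence the condition
  on \<open>strip u\<close>.\<close>

lemma run_groupoid:
  "\<exists>m f S c. is_groupoid m f \<and> S \<subseteq> {..<m} \<and> (\<forall>l. c l < m) \<and>
     (\<forall>u. strip u \<noteq> [] \<longrightarrow> (map c u \<in> word_problem m f S \<longleftrightarrow> run (strip u) []))"
proof -
  have eq: "(UNIV :: nt set option set) = insert None (Some ` Pow UNIV)"
  proof (intro set_eqI iffI UNIV_I)
    fix x :: "nt set option" show "x \<in> insert None (Some ` Pow UNIV)" by (cases x) auto
  qed
  have "finite (UNIV :: nt set option set)" unfolding eq
    by (intro finite.insertI finite_imageI) (simp only: finite_Pow_iff finite_nt)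
  then obtain h :: "nt set option \<Rightarrow> nat" and m where "bij_betw h UNIV {0..<m}" using ex_bij_betw_finite_nat by metis
  then have h: "inj h" "range h = {..<m}" by (auto simp: bij_betw_def atLeast0LessThan)
  define g where "g = inv h"
  have g: "g (h x) = x" for x using h(1) by (simp add: g_def)
  have gh: "h (g i) = i" if "i < m" for i using h(2) that unfolding g_def by (intro f_inv_into_f) auto
  have hm: "h x < m" for x using h(2) by auto
  define f where "f i j = h (mul (g i) (g j))" for i j
  define c where "c l = h (lv l)" for l
  define S where "S = {h (Some A) |A. ND \<in> A}"
  have b1: "gbrv u x \<Longrightarrow> brv f (map c u) (h x)" for u x
  proof (induction rule: gbrv.induct)
    case (1 l) then show ?case using brv.single[of f "c l"] by (simp add: c_def)
  next
    case (2 u x v y) then show ?case using brv.split[OF 2(3,4)] by (simp add: f_def g)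
  qed
  have b2: "brv f v i \<Longrightarrow> v = map c u \<Longrightarrow> \<exists>x. i = h x \<and> gbrv u x" for v i u
  proof (induction arbitrary: u rule: brv.induct)
    case (single a)
    then obtain l where "u = [l]" "a = c l" by auto
    then show ?case using gbrv.intros(1)[of l] by (auto simp: c_def simp del: lv.simps)
  next
    case (split v1 i v2 j)
    then obtain u1 u2 where u: "u = u1 @ u2" "v1 = map c u1" "v2 = map c u2" by (auto simp: append_eq_map_conv map_eq_append_conv)
    then show ?case using split.IH(1)[OF u(2)] split.IH(2)[OF u(3)] gbrv.intros(2) by (force simp: f_def g)
  qed
  have "is_groupoid m f"
    unfolding is_groupoid_def
  proof (intro conjI exI[of _ "h None"] allI impI)
    fix i assume i: "i < m"
    show "f (h None) i = i" "f i (h None) = i" using gh[OF i] by (simp_all add: f_def g)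
  qed (auto simp: f_def hm)
  moreover have "map c u \<in> word_problem m f S \<longleftrightarrow> run (strip u) []" if "strip u \<noteq> []" for u
  proof -
    have "map c u \<in> word_problem m f S \<longleftrightarrow> (\<exists>A. brv f (map c u) (h (Some A)) \<and> ND \<in> A)"
      using hm by (auto simp: word_problem_def S_def c_def)
    also have "\<dots> \<longleftrightarrow> (\<exists>A. gbrv u (Some A) \<and> ND \<in> A)"
      using b1 b2[of "map c u" _ u] injD[OF h(1)] by blast
    also have "\<dots> \<longleftrightarrow> der ND (strip u)" using gbrv_sound[of u] gbrv_complete[of ND "strip u" u] by fastforce
    finally show ?thesis using run_der[OF that] by simp
  qed
  moreover have "S \<subseteq> {..<m}" "\<forall>l. c l < m" using hm by (auto simp: S_def c_def)
  ultimately show ?thesis by blast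
qed

subsection \<open>Encoding proof systems as words\<close>

lemma upt_mult: "[0..<a * b] = concat (map (\<lambda>i. map (\<lambda>j. i * b + j) [0..<b]) [0..<a])"
proof (induction a)
  case (Suc a)
  have "[0..<Suc a * b] = [0..<a * b] @ [a * b..<a * b + b]"
    using upt_add_eq_append[of 0 "a * b" b] by (simp add: add.commute)
  also have "[a * b..<a * b + b] = map (\<lambda>j. a * b + j) [0..<b]"
    using map_add_upt[of "a * b" b] by (simp add: add.commute)
  finally show ?case using Suc by simp
qed simp

text \<open>The positions of the word, read as tuples of registers, in the order in which they
  occur. Its nesting turns the word into iterated concatenations, the first register varying
  slowest.\<close>

fun lexi :: "nat \<Rightarrow> nat list \<Rightarrow> nat list list" where
  "lexi n [] = [[]]"
| "lexi n (k # ks) = concat (map (\<lambda>a. map ((#) a) (lexi n ks)) [0..<2 ^ (n * k)])"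

lemma unpack_add: "unpack n ks (a * 2 ^ (n * sum_list ks) + b) = unpack n ks b"
proof -
  \<comment> \<open>The induction shortens \<open>ks\<close> while the ignored summand keeps its
    place, so the gap \<open>j\<close> between them has to be arbitrary.\<close>
  have "unpack n ks (a * 2 ^ (n * (j + sum_list ks)) + b) = unpack n ks b" for j
  proof (induction ks arbitrary: j)
    case (Cons k ks)
    have e: "a * 2 ^ (n * (j + sum_list (k # ks))) + b =
       b + (a * 2 ^ (n * j) * 2 ^ (n * k)) * 2 ^ (n * sum_list ks)"
      by (simp add: power_add algebra_simps)
    have "(a * 2 ^ (n * (j + sum_list (k # ks))) + b) div 2 ^ (n * sum_list ks) mod 2 ^ (n * k) =
      b div 2 ^ (n * sum_list ks) mod 2 ^ (n * k)"
      unfolding e by simp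
    moreover have "unpack n ks (a * 2 ^ (n * (j + sum_list (k # ks))) + b) = unpack n ks b"
      using Cons.IH[of "j + k"] by (simp add: add.assoc)
    ultimately show ?case by (simp only: unpack.simps)
  qed simp
  from this[of 0] show ?thesis by simp
qed

lemma map_unpack: "map (unpack n ks) [0..<2 ^ (n * sum_list ks)] = lexi n ks"
proof (induction ks)
  case (Cons k ks)
  let ?M = "2 ^ (n * sum_list ks) :: nat"
  have "map (unpack n (k # ks)) [0..<2 ^ (n * sum_list (k # ks))] =
    concat (map (\<lambda>a. map (\<lambda>b. unpack n (k # ks) (a * ?M + b)) [0..<?M]) [0..<2 ^ (n * k)])"
    using upt_mult[of "2 ^ (n * k)" ?M] by (simp add: power_add distrib_left map_concat comp_def del: unpack.simps)
  also have "map (\<lambda>a. map (\<lambda>b. unpack n (k # ks) (a * ?M + b)) [0..<?M]) [0..<2 ^ (n * k)] =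
    map (\<lambda>a. map ((#) a) (lexi n ks)) [0..<2 ^ (n * k)]"
  proof (intro map_cong refl)
    fix a :: nat assume a: "a \<in> set [0..<2 ^ (n * k)]"
    have "map (\<lambda>b. unpack n (k # ks) (a * ?M + b)) [0..<?M] = map (\<lambda>b. a # unpack n ks b) [0..<?M]"
      using a by (intro map_cong refl) (simp add: unpack_add)
    then show "map (\<lambda>b. unpack n (k # ks) (a * ?M + b)) [0..<?M] = map ((#) a) (lexi n ks)"
      by (simp add: Cons[symmetric])
  qed
  finally show ?case by simp
qed simp

section \<open>Bits spelled out in both directions, and their definability\<close>

definition bits :: "nat \<Rightarrow> nat \<Rightarrow> bool list" where
  "bits b z = map (\<lambda>r. odd (z div 2 ^ r)) [0..<b]"

lemma length_bits [simp]: "length (bits b z) = b" by (simp add: bits_def)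

lemma bits_inj: "z < 2 ^ b \<Longrightarrow> z' < 2 ^ b \<Longrightarrow> bits b z = bits b z' \<Longrightarrow> z = z'"
proof -
  have d: "dv 2 (map of_bool (rev (bits b z))) = z" if "z < 2 ^ b" for z
  proof -
    have "map of_bool (rev (bits b z)) = map (\<lambda>l. z div 2 ^ (b - 1 - l) mod (2::nat)) [0..<b]"
      by (rule nth_equalityI) (auto simp: bits_def rev_nth mod2_eq_if)
    then show ?thesis using dv_digits[of 2 z b] that by simp
  qed
  show "z < 2 ^ b \<Longrightarrow> z' < 2 ^ b \<Longrightarrow> bits b z = bits b z' \<Longrightarrow> z = z'" using d by metis
qed

text \<open>\<open>hot\<close> enumerates the bits of \<open>z\<close> in increasing order as \<open>p\<close> increases, \<open>cold\<close> in decreasing order: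
  what is pushed along \<open>cold\<close> is popped along \<open>hot\<close>. An addition-free definition of both orders is possible
  because the codes with exactly one bit set and those with exactly one bit missing are ordered oppositely.\<close>

definition hot :: "nat \<Rightarrow> nat \<Rightarrow> nat \<Rightarrow> (bool \<Rightarrow> letter) \<Rightarrow> letter" where
  "hot b p z F = (if \<exists>r<b. p = 2 ^ r \<and> odd (z div 2 ^ r) then F True
     else if \<exists>r<b. p = 2 ^ r \<and> even (z div 2 ^ r) then F False else Ne)"

definition cold :: "nat \<Rightarrow> nat \<Rightarrow> nat \<Rightarrow> (bool \<Rightarrow> letter) \<Rightarrow> letter" where
  "cold b p z F = (if \<exists>r<b. p = 2 ^ b - 1 - 2 ^ r \<and> odd (z div 2 ^ r) then F True
     else if \<exists>r<b. p = 2 ^ b - 1 - 2 ^ r \<and> even (z div 2 ^ r) then F False else Ne)"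

lemma hot_power: "r < b \<Longrightarrow> hot b (2 ^ r) z F = F (odd (z div 2 ^ r))"
  by (auto simp: hot_def)

lemma hot_not_power: "(\<And>r. r < b \<Longrightarrow> p \<noteq> 2 ^ r) \<Longrightarrow> hot b p z F = Ne"
  by (auto simp: hot_def)

lemma one_less_numeral: "1 < (2::nat)" by simp

text \<open>Doubling the range adds the power \<open>2 ^ c\<close>, which contributes bit
  \<open>c\<close>, and numbers that are not powers of two, which contribute nothing.\<close>

lemma strip_hot_upto:
  assumes "F True \<noteq> Ne" "F False \<noteq> Ne"
  shows "c \<le> b \<Longrightarrow> strip (map (\<lambda>p. hot b p z F) [0..<2 ^ c]) = map F (bits c z)"
proof (induction c)
  case 0
  then show ?case by (simp add: bits_def hot_not_power)
next
  case (Suc c)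
  have "[0..<2 ^ Suc c] = [0..<2 ^ c] @ 2 ^ c # [Suc (2 ^ c)..<2 ^ Suc c]"
    using upt_add_eq_append[of 0 "2 ^ c" "2 ^ c"] by (simp add: upt_conv_Cons mult_2)
  moreover have "strip (map (\<lambda>p. hot b p z F) [Suc (2 ^ c)..<2 ^ Suc c]) = []"
  proof -
    have "hot b p z F = Ne" if p: "p \<in> set [Suc (2 ^ c)..<2 ^ Suc c]" for p
    proof (rule hot_not_power)
      fix r show "p \<noteq> 2 ^ r"
      proof
        assume r: "p = 2 ^ r"
        have "2 ^ c < p" "p < 2 ^ Suc c" using p by auto
        then have "(2::nat) ^ c < 2 ^ r" "(2::nat) ^ r < 2 ^ Suc c" unfolding r .
        then have "c < r" "r < Suc c" using power_less_imp_less_exp[of "2::nat", OF one_less_numeral] by blast+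
        then show False by simp
      qed
    qed
    then show ?thesis by (simp add: filter_empty_conv)
  qed
  moreover have "F (odd (z div 2 ^ c)) \<noteq> Ne" using assms by (cases "odd (z div 2 ^ c)") auto
  ultimately show ?case using Suc by (simp add: hot_power bits_def del: upt_conv_Cons power_Suc)
qed

lemma strip_hot: "F True \<noteq> Ne \<Longrightarrow> F False \<noteq> Ne \<Longrightarrow> strip (map (\<lambda>p. hot b p z F) [0..<2 ^ b]) = map F (bits b z)"
  by (rule strip_hot_upto) auto

lemma cold_hot: "p < 2 ^ b \<Longrightarrow> cold b p z F = hot b (2 ^ b - 1 - p) z F"
proof -
  assume p: "p < 2 ^ b"
  have "p = 2 ^ b - 1 - 2 ^ r \<longleftrightarrow> 2 ^ b - 1 - p = 2 ^ r" if "r < b" for r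
  proof -
    have "(2::nat) ^ r < 2 ^ b" using that by simp
    then show ?thesis using p by linarith
  qed
  then show ?thesis unfolding cold_def hot_def by (simp cong: conj_cong)
qed

lemma strip_cold:
  assumes "F True \<noteq> Ne" "F False \<noteq> Ne"
  shows "strip (map (\<lambda>p. cold b p z F) [0..<2 ^ b]) = map F (rev (bits b z))"
proof -
  have e: "map (\<lambda>p. cold b p z F) [0..<2 ^ b] = rev (map (\<lambda>p. hot b p z F) [0..<2 ^ b])"
    by (rule nth_equalityI) (auto simp: rev_nth cold_hot)
  show ?thesis unfolding e
    by (simp only: rev_filter[symmetric] strip_hot[of F b z, OF assms]) (simp only: rev_map)
qed

lemma fodef_if: "fodef s C \<Longrightarrow> fodef s (\<lambda>w e. Q (a w e)) \<Longrightarrow> fodef s (\<lambda>w e. Q (b w e)) \<Longrightarrow> fodef s (\<lambda>w e. Q (if C w e then a w e else b w e))"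
proof -
  assume "fodef s C" "fodef s (\<lambda>w e. Q (a w e))" "fodef s (\<lambda>w e. Q (b w e))"
  then have "fodef s (\<lambda>w e. (C w e \<and> Q (a w e)) \<or> (\<not> C w e \<and> Q (b w e)))" by (intro fod)
  then show ?thesis by (rule fodef_cong) auto
qed

lemma odd_complement:
  fixes i :: nat
  assumes "i < 2 ^ b" "r < b"
  shows "odd ((2 ^ b - 1 - i) div 2 ^ r) \<longleftrightarrow> even (i div 2 ^ r)"
proof -
  define q t where "q = i div 2 ^ r" and "t = i mod 2 ^ r"
  have i: "i = q * 2 ^ r + t" "t < 2 ^ r" by (simp_all only: q_def t_def div_mult_mod_eq) simp
  have e: "(2::nat) ^ b = 2 ^ (b - r) * 2 ^ r" using assms(2) by (simp flip: power_add)
  have "q * 2 ^ r < 2 ^ (b - r) * 2 ^ r" using assms(1) i unfolding e by linarith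
  then have q: "q < 2 ^ (b - r)" by simp
  have "2 ^ b - 1 - i = (2 ^ (b - r) - 1 - q) * 2 ^ r + (2 ^ r - 1 - t)"
  proof -
    obtain d where d: "2 ^ (b - r) = q + 1 + d" using q less_iff_Suc_add by (metis Suc_eq_plus1 add_Suc)
    obtain d' where d': "2 ^ r = t + 1 + d'" using i(2) less_iff_Suc_add by (metis Suc_eq_plus1 add_Suc)
    have "2 ^ b = (q + 1 + d) * 2 ^ r" unfolding e d ..
    then have "2 ^ b - 1 - i = d * 2 ^ r + (2 ^ r - 1 - t)" using i(2) unfolding i(1) by (simp add: algebra_simps)
    then show ?thesis using d by simp
  qed
  then have "(2 ^ b - 1 - i) div 2 ^ r = 2 ^ (b - r) - 1 - q"
    using div_mult_self3[of "2 ^ r" "2 ^ (b - r) - 1 - q" "2 ^ r - 1 - t"] by simp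
  moreover have "even ((2::nat) ^ (b - r))" using assms(2) by simp
  ultimately show ?thesis using q unfolding q_def[symmetric] by auto
qed

text \<open>Being a particular power of two is expressed by the bits alone: the set-coded number has
  exactly one element, in the right place.\<close>

lemma eq_power_iff:
  fixes p :: nat
  assumes "p < 2 ^ b" "r < b"
  shows "p = 2 ^ r \<longleftrightarrow> (\<forall>r'<b. odd (p div 2 ^ r') \<longleftrightarrow> r' = r)"
proof -
  have b: "(2::nat) ^ r < 2 ^ b" using assms(2) by simp
  have *: "odd ((2::nat) ^ r div 2 ^ r') \<longleftrightarrow> r' = r" for r'
  proof (cases r' r rule: linorder_cases)
    case less
    then have "(2::nat) ^ r div 2 ^ r' = 2 ^ (r - r')" by (simp add: power_diff)
    then show ?thesis using less by simp
  qed (simp_all add: div_less)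
  have "p = 2 ^ r \<longleftrightarrow> bits b p = bits b (2 ^ r)" using bits_inj[OF assms(1) b] by blast
  also have "\<dots> \<longleftrightarrow> (\<forall>r'<b. odd (p div 2 ^ r') \<longleftrightarrow> r' = r)" by (auto simp: bits_def *)
  finally show ?thesis .
qed

lemma member_iff_odd:
  assumes "venv w e" "l < length vs" "j < length w"
  shows "j \<in> e (vs ! l) \<longleftrightarrow> odd (wnum w e vs div 2 ^ (length w * length vs - 1 - (l * length w + j)))"
  using asg_num[OF assms(1,2)] assms(3) by (auto simp: asg_def)

lemma ex_position: "(\<exists>r<n * k. Q r) \<longleftrightarrow> (\<exists>l<k. \<exists>j<n. Q (n * k - 1 - (l * n + j)))" for n :: nat
proof
  assume "\<exists>r<n * k. Q r"
  then obtain r where r: "r < n * k" "Q r" by blast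
  define p where "p = n * k - 1 - r"
  have p: "p < n * k" "r = n * k - 1 - p" using r by (auto simp: p_def)
  have "0 < n" using p by (cases n) auto
  then have "p div n < k" "p mod n < n" using p(1) by (auto simp: div_less_iff_less_mult mult.commute)
  moreover have "p div n * n + p mod n = p" by simp
  ultimately show "\<exists>l<k. \<exists>j<n. Q (n * k - 1 - (l * n + j))" using p r by metis
next
  assume "\<exists>l<k. \<exists>j<n. Q (n * k - 1 - (l * n + j))"
  then obtain l j where "l < k" "j < n" "Q (n * k - 1 - (l * n + j))" by blast
  moreover from this have "n * k - 1 - (l * n + j) < n * k" by (cases n; cases k) auto
  ultimately show "\<exists>r<n * k. Q r" by blast
qed

lemma all_position: "(\<forall>r<n * k. Q r) \<longleftrightarrow> (\<forall>l<k. \<forall>j<n. Q (n * k - 1 - (l * n + j)))" for n :: nat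
  using ex_position[of n k "\<lambda>r. \<not> Q r"] by blast

lemma position_inj: "l < k \<Longrightarrow> j < n \<Longrightarrow> l' < k \<Longrightarrow> j' < n \<Longrightarrow>
   n * k - 1 - (l * n + j) = n * k - 1 - (l' * n + j') \<longleftrightarrow> l = l' \<and> j = j'" for n :: nat
proof -
  assume a: "l < k" "j < n" "l' < k" "j' < n"
  have lt: "l * n + j < n * k" if "l < k" "j < n" for l j :: nat
    using two_digit_less[of j n 0 l k] that by (simp add: mult.commute)
  have "n * k - 1 - (l * n + j) = n * k - 1 - (l' * n + j') \<longleftrightarrow> l * n + j = l' * n + j'"
    using lt[OF a(1,2)] lt[OF a(3,4)] by linarith
  also have "\<dots> \<longleftrightarrow> l = l' \<and> j = j'" using two_digit_eq[OF a(2,4)] by simp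
  finally show ?thesis .
qed

text \<open>A bit position consists of the index \<open>l\<close> of a set, ranging over a fixed
  finite range, and an element \<open>j\<close>, which a first-order quantifier finds. With
  \<open>\<beta>\<close> true the code has exactly one bit set, as for \<open>hot\<close>; with
  \<open>\<beta>\<close> false exactly one bit is missing, as for \<open>cold\<close>.
  \<open>\<gamma>\<close> is the bit of \<open>zs\<close> at that position.\<close>

lemma fodef_hot_pos:
  assumes "length ps = k" "length zs = k"
  shows "fodef s (\<lambda>w e. \<exists>r<length w * k. (\<forall>r'<length w * k. (odd (wnum w e ps div 2 ^ r') \<longleftrightarrow> \<beta>) \<longleftrightarrow> r' = r) \<and>
     (odd (wnum w e zs div 2 ^ r) \<longleftrightarrow> \<gamma>))"
proof (rule fodef_cong)
  let ?B = "\<lambda>x. if \<beta> then Mem x (V 1) else Neg (Mem x (V 1))"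
  let ?C = "\<lambda>x. if \<gamma> then Mem x (V 0) else Neg (Mem x (V 0))"
  have 1: "fodef s (\<lambda>w e. \<exists>j<length w. (\<forall>j'<length w. (j' \<in> e x \<longleftrightarrow> \<beta>) \<longleftrightarrow> j' = j) \<and> (j \<in> e y \<longleftrightarrow> \<gamma>))" for x y
    by (rule fodefI[where \<phi> = "Ex 0 (Conj (All 1 (Disj (Conj (?B x) (Eq (V 1) (V 0))) (Conj (Neg (?B x)) (Neg (Eq (V 1) (V 0)))))) (?C y))"]) auto
  have 2: "fodef s (\<lambda>w e. \<forall>j'<length w. (j' \<in> e x \<longleftrightarrow> \<not> \<beta>))" for x
    by (rule fodefI[where \<phi> = "All 1 (Neg (?B x))"]) auto
  show "fodef s (\<lambda>w e. \<exists>l<k. (\<exists>j<length w. (\<forall>j'<length w. (j' \<in> e (ps ! l) \<longleftrightarrow> \<beta>) \<longleftrightarrow> j' = j) \<and> (j \<in> e (zs ! l) \<longleftrightarrow> \<gamma>)) \<and>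
      (\<forall>l'<k. l' \<noteq> l \<longrightarrow> (\<forall>j'<length w. (j' \<in> e (ps ! l') \<longleftrightarrow> \<not> \<beta>))))"
    by (intro fodef_ex_less fodef_conj fodef_all_less fodef_imp fodef_const 1 2)
  fix w e assume e: "venv w e"
  have "(\<exists>r<length w * k. (\<forall>r'<length w * k. (odd (wnum w e ps div 2 ^ r') \<longleftrightarrow> \<beta>) \<longleftrightarrow> r' = r) \<and>
     (odd (wnum w e zs div 2 ^ r) \<longleftrightarrow> \<gamma>)) \<longleftrightarrow>
     (\<exists>l<k. \<exists>j<length w. (\<forall>l'<k. \<forall>j'<length w. (j' \<in> e (ps ! l') \<longleftrightarrow> \<beta>) \<longleftrightarrow> l' = l \<and> j' = j) \<and> (j \<in> e (zs ! l) \<longleftrightarrow> \<gamma>))"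
    unfolding ex_position all_position
    using member_iff_odd[OF e, of _ ps] member_iff_odd[OF e, of _ zs] assms position_inj[of _ k _ "length w"]
    by (simp cong: conj_cong)
  also have "\<dots> \<longleftrightarrow> (\<exists>l<k. (\<exists>j<length w. (\<forall>j'<length w. (j' \<in> e (ps ! l) \<longleftrightarrow> \<beta>) \<longleftrightarrow> j' = j) \<and> (j \<in> e (zs ! l) \<longleftrightarrow> \<gamma>)) \<and>
      (\<forall>l'<k. l' \<noteq> l \<longrightarrow> (\<forall>j'<length w. (j' \<in> e (ps ! l') \<longleftrightarrow> \<not> \<beta>))))"
    by blast
  finally show "(\<exists>r<length w * k. (\<forall>r'<length w * k. (odd (wnum w e ps div 2 ^ r') \<longleftrightarrow> \<beta>) \<longleftrightarrow> r' = r) \<and>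
     (odd (wnum w e zs div 2 ^ r) \<longleftrightarrow> \<gamma>)) \<longleftrightarrow> (\<exists>l<k. (\<exists>j<length w. (\<forall>j'<length w. (j' \<in> e (ps ! l) \<longleftrightarrow> \<beta>) \<longleftrightarrow> j' = j) \<and> (j \<in> e (zs ! l) \<longleftrightarrow> \<gamma>)) \<and>
      (\<forall>l'<k. l' \<noteq> l \<longrightarrow> (\<forall>j'<length w. (j' \<in> e (ps ! l') \<longleftrightarrow> \<not> \<beta>))))" .
qed

lemma fodef_hot_cold:
  assumes l: "length ps = k" "length zs = k"
  shows "fodef s (\<lambda>w e. Q (hot (length w * k) (wnum w e ps) (wnum w e zs) F))"
    "fodef s (\<lambda>w e. Q (cold (length w * k) (wnum w e ps) (wnum w e zs) F))"
proof -
  have h: "fodef s (\<lambda>w e. \<exists>r<length w * k. wnum w e ps = 2 ^ r \<and> (odd (wnum w e zs div 2 ^ r) \<longleftrightarrow> \<gamma>))" for \<gamma>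
  proof (rule fodef_cong[OF fodef_hot_pos[OF l, of s True \<gamma>]])
    fix w e
    let ?b = "length w * k" and ?p = "wnum w e ps"
    have p: "?p < 2 ^ ?b" using num_bound[of "length w" e ps] l by simp
    show "(\<exists>r<?b. ?p = 2 ^ r \<and> (odd (wnum w e zs div 2 ^ r) \<longleftrightarrow> \<gamma>)) \<longleftrightarrow>
      (\<exists>r<?b. (\<forall>r'<?b. (odd (?p div 2 ^ r') \<longleftrightarrow> True) \<longleftrightarrow> r' = r) \<and> (odd (wnum w e zs div 2 ^ r) \<longleftrightarrow> \<gamma>))"
      using eq_power_iff[OF p] by (simp cong: conj_cong)
  qed
  have c: "fodef s (\<lambda>w e. \<exists>r<length w * k. wnum w e ps = cap w k - 1 - 2 ^ r \<and> (odd (wnum w e zs div 2 ^ r) \<longleftrightarrow> \<gamma>))" for \<gamma>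
  proof (rule fodef_cong[OF fodef_hot_pos[OF l, of s False \<gamma>]])
    fix w e
    let ?b = "length w * k" and ?p = "wnum w e ps"
    have p: "?p < 2 ^ ?b" using num_bound[of "length w" e ps] l by simp
    have "?p = 2 ^ ?b - 1 - 2 ^ r \<longleftrightarrow> (\<forall>r'<?b. (odd (?p div 2 ^ r') \<longleftrightarrow> False) \<longleftrightarrow> r' = r)" if "r < ?b" for r
    proof -
      have "(2::nat) ^ r < 2 ^ ?b" using that by simp
      then have "?p = 2 ^ ?b - 1 - 2 ^ r \<longleftrightarrow> 2 ^ ?b - 1 - ?p = 2 ^ r" using p by linarith
      also have "\<dots> \<longleftrightarrow> (\<forall>r'<?b. odd ((2 ^ ?b - 1 - ?p) div 2 ^ r') \<longleftrightarrow> r' = r)"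
        using p that by (intro eq_power_iff) auto
      finally show ?thesis using odd_complement[OF p] by simp
    qed
    then show "(\<exists>r<?b. ?p = 2 ^ ?b - 1 - 2 ^ r \<and> (odd (wnum w e zs div 2 ^ r) \<longleftrightarrow> \<gamma>)) \<longleftrightarrow>
      (\<exists>r<?b. (\<forall>r'<?b. (odd (?p div 2 ^ r') \<longleftrightarrow> False) \<longleftrightarrow> r' = r) \<and> (odd (wnum w e zs div 2 ^ r) \<longleftrightarrow> \<gamma>))"
      by (simp cong: conj_cong)
  qed
  show "fodef s (\<lambda>w e. Q (hot (length w * k) (wnum w e ps) (wnum w e zs) F))"
    unfolding hot_def
    by (rule fodef_if[where Q = Q], rule h[of True, unfolded simp_thms], rule fodef_const,
        rule fodef_if[where Q = Q], rule h[of False, unfolded simp_thms], rule fodef_const, rule fodef_const)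
  show "fodef s (\<lambda>w e. Q (cold (length w * k) (wnum w e ps) (wnum w e zs) F))"
    unfolding cold_def
    by (rule fodef_if[where Q = Q], rule c[of True, unfolded simp_thms], rule fodef_const,
        rule fodef_if[where Q = Q], rule c[of False, unfolded simp_thms], rule fodef_const, rule fodef_const)
qed

section \<open>Runs through lists of blocks\<close>

lemma run_simps [simp]:
  "run [] st \<longleftrightarrow> st = []"
  "run (Psh b # v) st \<longleftrightarrow> run v (b # st)"
  "run (Pop b # v) st \<longleftrightarrow> (\<exists>st'. st = b # st' \<and> run v st')"
  "run (RB # v) st \<longleftrightarrow> run v st"
  by (auto intro: run.intros elim: run.cases)

lemma run_push: "run (map Psh bs @ v) st \<longleftrightarrow> run v (rev bs @ st)"
  by (induction bs arbitrary: st) auto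

lemma run_pop: "run (map Pop bs @ v) st \<longleftrightarrow> (\<exists>st'. st = bs @ st' \<and> run v st')"
  by (induction bs arbitrary: st) auto

text \<open>Moves contain no bracket, so the end of a block is unambiguous and skipping it is
  deterministic.\<close>

lemma movs_RB: "set x \<subseteq> movs \<Longrightarrow> set x' \<subseteq> movs \<Longrightarrow> x @ RB # v = x' @ RB # v' \<longleftrightarrow> x = x' \<and> v = v'"
proof (induction x arbitrary: x')
  case Nil then show ?case by (cases x') (auto simp: movs_def)
next
  case (Cons a x) then show ?case by (cases x') (auto simp: movs_def)
qed

lemma run_block:
  assumes "set x \<subseteq> movs"
  shows "run (LB # x @ RB # v) st \<longleftrightarrow> run (x @ RB # v) st \<or> run v st"
proof
  assume "run (LB # x @ RB # v) st"
  then show "run (x @ RB # v) st \<or> run v st"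
    by (cases rule: run.cases) (auto simp: movs_RB[OF assms])
next
  show "run (x @ RB # v) st \<or> run v st \<Longrightarrow> run (LB # x @ RB # v) st"
    using run_LB run_skip[OF _ assms] by blast
qed

lemma strip_lexi: "strip (map f (lexi n (k # k' # ks))) =
  concat (map (\<lambda>a. strip (map (\<lambda>u. f (a # u)) (lexi n (k' # ks)))) [0..<2 ^ (n * k)])"
  by (simp only: lexi.simps(2)[of n k] map_concat filter_concat map_map comp_def)

lemma strip_lexi_last: "strip (map f (lexi n [k])) = strip (map (\<lambda>a. f [a]) [0..<2 ^ (n * k)])"
proof -
  have "map f (concat (map (\<lambda>a. [[a]]) xs)) = map (\<lambda>a. f [a]) xs" for xs :: "nat list" by (induction xs) auto
  then show ?thesis by (simp add: comp_def)
qed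

lemma concat_ends:
  assumes "2 \<le> N" "\<And>i. 0 < i \<Longrightarrow> Suc i < N \<Longrightarrow> G i = []"
  shows "concat (map G [0..<N]) = G 0 @ G (N - 1)"
proof -
  have "[0..<N] = 0 # [1..<N - 1] @ [N - 1]"
    using assms(1) upt_Suc_append[of 1 "N - 1"] by (simp add: upt_conv_Cons)
  moreover have "concat (map G [1..<N - 1]) = []" using assms(2) by (auto simp: concat_eq_Nil_conv)
  ultimately show ?thesis by simp
qed

lemma concat_unique: "distinct xs \<Longrightarrow> a \<in> set xs \<Longrightarrow> (\<And>x. x \<in> set xs \<Longrightarrow> x \<noteq> a \<Longrightarrow> F x = []) \<Longrightarrow> concat (map F xs) = F a"
proof (induction xs)
  case (Cons x xs)
  show ?case
  proof (cases "x = a")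
    case True
    then have "concat (map F xs) = []" using Cons.prems by (auto simp: concat_eq_Nil_conv)
    then show ?thesis using True by simp
  next
    case False then show ?thesis using Cons by simp
  qed
qed simp

lemma concat_product: "concat (map F (List.product xs ys)) = concat (map (\<lambda>x. concat (map (\<lambda>y. F (x, y)) ys)) xs)"
  by (induction xs) (simp_all add: comp_def)

text \<open>A final configuration needs no proof and leaves nothing on the stack. All others get
  codes of the same length, so that the stack splits uniquely into configurations.\<close>

definition enc :: "nat \<Rightarrow> nat list \<Rightarrow> nat \<Rightarrow> bool list" where
  "enc k w z = (if z < cap w k then [] else bits (length w * Suc k) z)"

definition block where
  "block k R w = (\<lambda>(z, x, y). if \<not> z < cap w k \<and> R w z x y
     then LB # (map Pop (enc k w z) @ map Psh (rev (enc k w y)) @ map Psh (rev (enc k w x))) @ [RB] else [])"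

lemma run_block_iff:
  "run (block k R w (z, x, y) @ v) st \<longleftrightarrow> run v st \<or>
     (\<not> z < cap w k \<and> R w z x y \<and> (\<exists>st'. st = enc k w z @ st' \<and> run v (enc k w x @ enc k w y @ st')))"
proof (cases "\<not> z < cap w k \<and> R w z x y")
  case True
  let ?x = "map Pop (enc k w z) @ map Psh (rev (enc k w y)) @ map Psh (rev (enc k w x))"
  have "set ?x \<subseteq> movs" by (auto simp: movs_def)
  from run_block[OF this, of v st] show ?thesis using True by (auto simp: block_def run_push run_pop)
qed (auto simp: block_def)

lemma run_blocks_skip: "run v st \<Longrightarrow> run (concat (map (block k R w) ts) @ v) st"
  by (induction ts) (auto simp: run_block_iff)

text \<open>The stack is a list of goals. An executed block can only pop the first goal, since codes
  have equal length and are injective, and replaces it by its premises that are not final. Reading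
  backwards from the empty stack, all goals are provable.\<close>

lemma run_blocks_sound:
  assumes "0 < length w"
  shows "run (concat (map (block k R w) ts)) (concat (map (enc k w) zs)) \<Longrightarrow>
     \<forall>(z, x, y)\<in>set ts. z < cap w (Suc k) \<and> x < cap w (Suc k) \<and> y < cap w (Suc k) \<Longrightarrow>
     \<forall>z\<in>set zs. \<not> z < cap w k \<and> z < cap w (Suc k) \<Longrightarrow> \<forall>z\<in>set zs. \<exists>a. psz k R w z a"
proof (induction ts arbitrary: zs)
  case Nil
  have "enc k w z \<noteq> []" if "z \<in> set zs" for z
    using Nil(3) that assms by (auto simp: enc_def bits_def)
  then show ?case using Nil by auto
next
  case (Cons t ts)
  obtain z x y where t: "t = (z, x, y)" by (cases t)
  let ?v = "concat (map (block k R w) ts)" and ?b = "length w * Suc k"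
  have "run (block k R w (z, x, y) @ ?v) (concat (map (enc k w) zs))" using Cons.prems(1) t by simp
  then consider "run ?v (concat (map (enc k w) zs))"
    | st' where "\<not> z < cap w k" "R w z x y" "concat (map (enc k w) zs) = enc k w z @ st'"
      "run ?v (enc k w x @ enc k w y @ st')" unfolding run_block_iff by blast
  then show ?case
  proof cases
    case 1
    then show ?thesis using Cons by auto
  next
    case 2
    have lz: "length (enc k w z') = ?b" if "\<not> z' < cap w k" for z'
      using that by (simp add: enc_def)
    have "zs \<noteq> []" using 2(3) lz[OF 2(1)] assms by auto
    then obtain z' zs' where zs: "zs = z' # zs'" by (cases zs) auto
    have z': "\<not> z' < cap w k" "z' < 2 ^ ?b" using Cons.prems(3) zs by auto
    have e: "enc k w z' = enc k w z" "st' = concat (map (enc k w) zs')"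
      using 2(3) lz[OF 2(1)] lz[OF z'(1)] unfolding zs by auto
    have xyz: "z < 2 ^ ?b" "x < 2 ^ ?b" "y < 2 ^ ?b" using Cons.prems(2) t by auto
    have "z' = z" using e(1) z' 2(1) xyz bits_inj[of z' ?b z] by (simp add: enc_def)
    let ?u = "(if x < cap w k then [] else [x]) @ (if y < cap w k then [] else [y]) @ zs'"
    have "run ?v (concat (map (enc k w) ?u))" using 2(4) e(2) by (auto simp: enc_def)
    then have IH: "\<forall>z\<in>set ?u. \<exists>a. psz k R w z a"
      using Cons.prems xyz zs by (intro Cons.IH) auto
    have "\<exists>a. psz k R w x a" "\<exists>a. psz k R w y a"
      using IH by (auto split: if_splits intro: psz.finished)
    then obtain a c where "psz k R w x a" "psz k R w y c" by blast
    then have "psz k R w z (Suc (a + c))" using 2 xyz by (intro psz.rule) auto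
    then show ?thesis using IH \<open>z' = z\<close> zs by fastforce
  qed
qed

text \<open>Each rule application of the proof uses one copy of the list of all instances: the
  required block is executed, the others are skipped. The first premise lies on top, so its subproof
  consumes the next \<open>a\<close> copies, and the second one the \<open>b\<close> copies after
  these.\<close>

lemma run_blocks_complete:
  assumes ts: "\<And>z x y. z < cap w (Suc k) \<Longrightarrow> x < cap w (Suc k) \<Longrightarrow> y < cap w (Suc k) \<Longrightarrow> (z, x, y) \<in> set ts"
  shows "psz k R w z a \<Longrightarrow> z < cap w (Suc k) \<Longrightarrow> run v st \<Longrightarrow>
     run (concat (replicate a (concat (map (block k R w) ts))) @ v) (enc k w z @ st)"
proof (induction arbitrary: v st rule: psz.induct)
  case (finished z) then show ?case by (simp add: enc_def)
next
  case (rule z x y a b)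
  let ?B = "concat (map (block k R w) ts)"
  let ?v = "concat (replicate a ?B) @ concat (replicate b ?B) @ v"
  have "run ?v (enc k w x @ enc k w y @ st)" using rule by blast
  moreover obtain ts1 ts2 where "ts = ts1 @ (z, x, y) # ts2"
    using ts[OF rule.prems(1) rule.hyps(2,3)] by (auto simp: in_set_conv_decomp)
  ultimately have "run (?B @ ?v) (enc k w z @ st)"
    using rule.hyps by (auto simp: run_block_iff intro!: run_blocks_skip)
  then show ?case by (simp add: replicate_add)
qed

text \<open>The position of a letter is split into the number of the copy, \<open>z\<close>, \<open>x\<close>, \<open>y\<close>, two flags selecting one of the phases
``open and pop \<open>z\<close>'', ``push \<open>y\<close>'', ``push \<open>x\<close>'' and ``close'', and a code enumerating bits. Copy \<open>0\<close> has no
skippable blocks: it just pushes the initial configuration.\<close>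

definition letter_at where
  "letter_at k R Init w u = (let b = length w * Suc k;
       act = (u ! 0 \<noteq> 0 \<and> \<not> u ! 1 < cap w k \<and> R w (u ! 1) (u ! 2) (u ! 3));
       ini = (u ! 0 = (0::nat) \<and> Init w [] (u ! 1) \<and> u ! 2 = 0 \<and> u ! 3 = 0) in
     if u ! 4 = 0 \<and> u ! 5 = 0 then
       if act then if u ! 6 = 0 then LB else hot b (u ! 6) (u ! 1) Pop else Ne
     else if u ! 4 = 0 \<and> Suc (u ! 5) = cap w 1 then
       if act then if u ! 3 < cap w k then Ne else cold b (u ! 6) (u ! 3) Psh
       else if ini then cold b (u ! 6) (u ! 1) Psh else Ne
     else if Suc (u ! 4) = cap w 1 \<and> u ! 5 = 0 then
       if act \<and> \<not> u ! 2 < cap w k then cold b (u ! 6) (u ! 2) Psh else Ne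
     else if Suc (u ! 4) = cap w 1 \<and> Suc (u ! 5) = cap w 1 then
       if act \<and> u ! 6 = 0 then RB else Ne
     else Ne)"

definition widths where
  "widths k T = [T, Suc k, Suc k, Suc k, 1, 1, Suc k]"

lemma fodef_letter_at:
  assumes S: "pure_sys s [] P k R c Init" and vs: "map length vs = widths k T"
  shows "fodef s (\<lambda>w e. Q (letter_at k R Init w (nums w e vs)))"
proof -
  obtain v0 v1 v2 v3 v4 v5 v6 where v: "vs = [v0, v1, v2, v3, v4, v5, v6]" and
    l: "length v0 = T" "length v1 = Suc k" "length v2 = Suc k" "length v3 = Suc k" "length v4 = 1" "length v5 = 1" "length v6 = Suc k"
    using vs by (auto simp: widths_def map_eq_Cons_conv)
  have R: "fodef s (\<lambda>w e. R w (wnum w e v1) (wnum w e v2) (wnum w e v3))"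
    using S l by (simp add: pure_sys_def)
  have I: "fodef s (\<lambda>w e. Init w [] (wnum w e v1))"
    using S l by (simp add: pure_sys_def)
  have nth: "nums w e vs ! 0 = wnum w e v0" "nums w e vs ! 1 = wnum w e v1" "nums w e vs ! 2 = wnum w e v2"
    "nums w e vs ! 3 = wnum w e v3" "nums w e vs ! 4 = wnum w e v4" "nums w e vs ! 5 = wnum w e v5"
    "nums w e vs ! 6 = wnum w e v6" for w e by (simp_all add: v)
  show ?thesis
    unfolding letter_at_def Let_def nth
    by (intro fodef_if[where Q = Q] fodef_hot_cold[where Q = Q] fodef_const fodef_conj fodef_not
        fodef_num_zero fodef_num_max fodef_done R I l)
qed

text \<open>Each flag is a set of which only the values empty and full carry letters, so the two
  flags yield the four phases in order; \<open>2 \<le> N\<close> makes the two values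
  distinct.\<close>

lemma concat_corners:
  assumes "2 \<le> N" "\<And>f g. \<not> ((f = 0 \<or> f = N - 1) \<and> (g = 0 \<or> g = N - 1)) \<Longrightarrow> G f g = []"
  shows "concat (map (\<lambda>f. concat (map (G f) [0..<N])) [0..<N]) = G 0 0 @ G 0 (N - 1) @ G (N - 1) 0 @ G (N - 1) (N - 1)"
proof -
  have row: "concat (map (G f) [0..<N]) = G f 0 @ G f (N - 1)" for f
  proof (rule concat_ends[OF assms(1)])
    fix i assume "0 < i" "Suc i < N"
    then show "G f i = []" by (intro assms(2)) auto
  qed
  have "concat (map (\<lambda>f. G f 0 @ G f (N - 1)) [0..<N]) = (G 0 0 @ G 0 (N - 1)) @ (G (N - 1) 0 @ G (N - 1) (N - 1))"
  proof (rule concat_ends[OF assms(1)])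
    fix i assume "0 < i" "Suc i < N"
    then show "G i 0 @ G i (N - 1) = []" using assms(2)[of i 0] assms(2)[of i "N - 1"] by auto
  qed
  then show ?thesis unfolding row by simp
qed

definition pushes where
  "pushes k w z = map Psh (rev (enc k w z))"

lemma strip_letter_at:
  assumes n: "0 < length w"
  shows "concat (map (\<lambda>f. concat (map (\<lambda>g. strip (map (\<lambda>p. letter_at k R Init w [t, z, x, y, f, g, p]) [0..<cap w (Suc k)]))
       [0..<cap w 1])) [0..<cap w 1]) =
     (if t \<noteq> 0 then block k R w (z, x, y)
      else if Init w [] z \<and> x = 0 \<and> y = 0 then map Psh (rev (bits (length w * Suc k) z)) else [])"
proof -
  let ?b = "length w * Suc k" and ?N = "cap w 1 :: nat"
  define act where "act \<longleftrightarrow> t \<noteq> 0 \<and> \<not> z < cap w k \<and> R w z x y"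
  define ini where "ini \<longleftrightarrow> t = 0 \<and> Init w [] z \<and> x = 0 \<and> y = 0"
  let ?G = "\<lambda>f g. strip (map (\<lambda>p. letter_at k R Init w [t, z, x, y, f, g, p]) [0..<2 ^ ?b])"
  have N: "2 \<le> ?N" using n power_increasing[of 1 "length w" "2::nat"] by (cases "length w") auto
  then obtain M where M: "?N = Suc M" "M \<noteq> 0" by (cases ?N) auto
  have M1: "?N - 1 = M" using M by simp
  have letter_at: "letter_at k R Init w [t, z, x, y, f, g, p] =
     (if f = 0 \<and> g = 0 then if act then if p = 0 then LB else hot ?b p z Pop else Ne
     else if f = 0 \<and> g = M then
       if act then if y < cap w k then Ne else cold ?b p y Psh
       else if ini then cold ?b p z Psh else Ne
     else if f = M \<and> g = 0 then if act \<and> \<not> x < cap w k then cold ?b p x Psh else Ne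
     else if f = M \<and> g = M then if act \<and> p = 0 then RB else Ne
     else Ne)" for f g p
    unfolding letter_at_def M Let_def by (simp add: act_def ini_def del: power_Suc mult_Suc_right)
  have Ne: "strip (map (\<lambda>_. Ne) xs) = []" for xs :: "nat list" by (induction xs) auto
  have upt: "[0..<2 ^ ?b] = 0 # [1..<2 ^ ?b]" by (simp add: upt_conv_Cons)
  have z0: "strip (map (\<lambda>p. hot ?b p z Pop) [1..<2 ^ ?b]) = map Pop (bits ?b z)"
  proof -
    \<comment> \<open>Code \<open>0\<close> is not a power of two, so \<open>hot\<close> leaves this
      place free for the bracket that opens the block.\<close>
    have "hot ?b 0 z Pop = Ne" by (rule hot_not_power) simp
    then show ?thesis using strip_hot[of Pop ?b z] unfolding upt by simp
  qed
  have G1: "?G 0 0 = (if act then LB # map Pop (bits ?b z) else [])"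
  proof (cases act)
    case True
    have "map (\<lambda>p. if p = 0 then LB else hot ?b p z Pop) [0..<2 ^ ?b] = LB # map (\<lambda>p. hot ?b p z Pop) [1..<2 ^ ?b]"
      unfolding upt by simp
    then show ?thesis using True z0 by (simp add: letter_at)
  qed (simp add: letter_at Ne)
  have G2: "?G 0 M = (if act then pushes k w y else if ini then map Psh (rev (bits ?b z)) else [])"
    using M by (simp add: letter_at Ne strip_cold pushes_def enc_def)
  have G3: "?G M 0 = (if act then pushes k w x else [])"
    using M by (simp add: letter_at Ne strip_cold pushes_def enc_def)
  have G4: "?G M M = (if act then [RB] else [])"
  proof (cases act)
    case True
    have "map (\<lambda>p. if p = 0 then RB else Ne) [0..<2 ^ ?b] = RB # map (\<lambda>_. Ne) [1..<2 ^ ?b]"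
      unfolding upt by simp
    then show ?thesis using True M Ne by (simp add: letter_at)
  qed (use M in \<open>simp add: letter_at Ne\<close>)
  have G5: "concat (map (\<lambda>f. concat (map (?G f) [0..<?N])) [0..<?N]) = ?G 0 0 @ ?G 0 M @ ?G M 0 @ ?G M M"
    unfolding M1[symmetric]
  proof (rule concat_corners[OF N])
    fix f g assume "\<not> ((f = 0 \<or> f = ?N - 1) \<and> (g = 0 \<or> g = ?N - 1))"
    then have c: "\<not> (f = 0 \<and> g = 0)" "\<not> (f = 0 \<and> g = M)" "\<not> (f = M \<and> g = 0)" "\<not> (f = M \<and> g = M)"
      unfolding M1 by blast+
    show "?G f g = []" unfolding letter_at if_not_P[OF c(1)] if_not_P[OF c(2)] if_not_P[OF c(3)] if_not_P[OF c(4)] by (rule Ne)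
  qed
  have all: "concat (map (\<lambda>f. concat (map (?G f) [0..<?N])) [0..<?N]) =
      (if act then LB # map Pop (bits ?b z) @ pushes k w y @ pushes k w x @ [RB]
       else if ini then map Psh (rev (bits ?b z)) else [])"
    unfolding G5 G1 G2 G3 G4 by (cases act; cases ini) simp_all
  show ?thesis
  proof (cases "t = 0")
    case True
    then show ?thesis unfolding all by (simp add: act_def ini_def)
  next
    case False
    then show ?thesis unfolding all by (simp add: act_def ini_def block_def pushes_def enc_def)
  qed
qed

lemma encoding_run:
  assumes S: "pure_sys s [] P k R c Init" and w: "is_string s w"
  defines "u \<equiv> strip (map (letter_at k R Init w) (lexi (length w) (widths k (c + 1))))"
  shows "u \<noteq> []" "run u [] \<longleftrightarrow> P w []"
proof -
  let ?b = "length w * Suc k" and ?T = "cap w (c + 1) :: nat"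
  have n: "0 < length w" by (rule is_string_pos[OF w])
  have S': "\<forall>w as. is_string s w \<longrightarrow> okr w [] as \<longrightarrow> (\<exists>z<cap w (Suc k). Init w as z)"
    "\<forall>w as z. is_string s w \<longrightarrow> okr w [] as \<longrightarrow> Init w as z \<longrightarrow> cap w k \<le> z \<and>
      (P w as \<longrightarrow> (\<exists>a\<le>2 ^ (c * length w). psz k R w z a)) \<and> (\<forall>a. psz k R w z a \<longrightarrow> P w as)"
    "\<forall>w z z'. [] = ([] :: nat list) \<longrightarrow> is_string s w \<longrightarrow> Init w [] z \<longrightarrow> Init w [] z' \<longrightarrow> z = z'"
    using S unfolding pure_sys_def by - (elim conjE, assumption)+
  obtain z0 where z0: "z0 < 2 ^ ?b" "Init w [] z0" using S'(1) w okr_Nil by blast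
  have uni: "z = z0" if "Init w [] z" for z using S'(3) w z0 that by blast
  have "cap w k \<le> z0 \<and> (P w [] \<longrightarrow> (\<exists>a\<le>2 ^ (c * length w). psz k R w z0 a)) \<and> (\<forall>a. psz k R w z0 a \<longrightarrow> P w [])"
    using S'(2) w z0(2) okr_Nil by blast
  then have nd: "\<not> z0 < cap w k" and compl: "P w [] \<Longrightarrow> \<exists>a\<le>2 ^ (c * length w). psz k R w z0 a"
    and snd: "psz k R w z0 a \<Longrightarrow> P w []" for a
    by (simp add: not_less, blast+)
  define ts where "ts = List.product [0..<2 ^ ?b] (List.product [0..<2 ^ ?b] [0..<2 ^ ?b :: nat])"
  define B where "B = concat (map (block k R w) ts)"
  have row: "concat (map F ts) = concat (map (\<lambda>z. concat (map (\<lambda>x. concat (map (\<lambda>y. F (z, x, y)) [0..<2 ^ ?b])) [0..<2 ^ ?b])) [0..<2 ^ ?b])"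
    for F :: "nat \<times> nat \<times> nat \<Rightarrow> letter list"
    unfolding ts_def concat_product ..
  have "u = concat (map (\<lambda>t. concat (map (\<lambda>(z, x, y). if t \<noteq> 0 then block k R w (z, x, y)
      else if Init w [] z \<and> x = 0 \<and> y = 0 then map Psh (rev (bits ?b z)) else []) ts)) [0..<?T])"
    unfolding u_def widths_def strip_lexi strip_lexi_last strip_letter_at[OF n] row prod.case ..
  also have "[0..<?T] = 0 # [1..<?T]" by (simp add: upt_conv_Cons)
  also have "concat (map (\<lambda>t. concat (map (\<lambda>(z, x, y). if t \<noteq> 0 then block k R w (z, x, y)
      else if Init w [] z \<and> x = 0 \<and> y = 0 then map Psh (rev (bits ?b z)) else []) ts)) (0 # [1..<?T])) =
      map Psh (rev (bits ?b z0)) @ concat (replicate (?T - 1) B)"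
  proof -
    \<comment> \<open>Uniqueness of the initial number, together with the demand that
      \<open>x\<close> and \<open>y\<close> be \<open>0\<close>, makes copy \<open>0\<close> push
      exactly once.\<close>
    have "concat (map (\<lambda>(z, x, y). if Init w [] z \<and> x = 0 \<and> y = (0::nat) then map Psh (rev (bits ?b z)) else []) ts) =
      (\<lambda>(z, x, y). if Init w [] z \<and> x = 0 \<and> y = (0::nat) then map Psh (rev (bits ?b z)) else []) (z0, 0::nat, 0)"
    proof (rule concat_unique)
      show "distinct ts" by (simp add: ts_def distinct_product)
      show "(z0, 0, 0) \<in> set ts" using z0 by (simp add: ts_def)
    qed (use uni in \<open>auto split: if_splits\<close>)
    then have F0: "concat (map (\<lambda>(z, x, y). if (0::nat) \<noteq> 0 then block k R w (z, x, y)
      else if Init w [] z \<and> x = 0 \<and> y = 0 then map Psh (rev (bits ?b z)) else []) ts) = map Psh (rev (bits ?b z0))"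
      using z0 by simp
    have F1: "map (\<lambda>t. concat (map (\<lambda>(z, x, y). if t \<noteq> 0 then block k R w (z, x, y)
      else if Init w [] z \<and> x = 0 \<and> y = 0 then map Psh (rev (bits ?b z)) else []) ts)) [1..<?T] = map (\<lambda>_. B) [1..<?T]"
      by (intro map_cong refl) (simp add: B_def)
    have F2: "map (\<lambda>_. B) [1..<?T] = replicate (?T - 1) B" by (simp add: map_replicate_const)
    show ?thesis unfolding list.map concat.simps F0 F1 F2 ..
  qed
  finally have u: "u = map Psh (rev (enc k w z0)) @ concat (replicate (?T - 1) B)" using nd by (simp add: enc_def)
  show "u \<noteq> []" using u nd n by (auto simp: enc_def bits_def)
  have rep: "concat (replicate m B) = concat (map (block k R w) (concat (replicate m ts)))" for m
    by (induction m) (simp_all add: B_def)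
  show "run u [] \<longleftrightarrow> P w []"
  proof
    assume "run u []"
    then have "run (concat (map (block k R w) (concat (replicate (?T - 1) ts)))) (concat (map (enc k w) [z0]))"
      unfolding u run_push rep by simp
    then have "\<forall>z\<in>set [z0]. \<exists>a. psz k R w z a"
      by (rule run_blocks_sound[OF n]) (use z0 nd in \<open>auto simp: ts_def\<close>)
    then show "P w []" using snd by auto
  next
    assume "P w []"
    then obtain a where a: "a \<le> 2 ^ (c * length w)" "psz k R w z0 a" using compl by blast
    \<comment> \<open>Strict, because copy \<open>0\<close> contains no rules; this is why the copy
      number has width \<open>c + 1\<close>.\<close>
    have "(2::nat) ^ (c * length w) < ?T" using n by (simp add: mult.commute)
    then have "a \<le> ?T - 1" using a(1) by linarith
    then obtain m where m: "?T - 1 = a + m" using le_Suc_ex by blast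
    have "run (concat (replicate m B)) []" using run_blocks_skip[of "[]" "[]" k R w] unfolding rep by simp
    then have "run (concat (replicate a B) @ concat (replicate m B)) (enc k w z0 @ [])"
      unfolding B_def by (intro run_blocks_complete a z0) (auto simp: ts_def)
    then show "run u []" unfolding u run_push m by (simp add: replicate_add)
  qed
qed

section \<open>From proof systems back to a single quantifier\<close>

lemma pdef_to_QGrpFO:
  assumes "pdef s [] P"
  shows "\<exists>\<psi>. QGrpFO_sentence s \<psi> \<and> (\<forall>w. is_string s w \<longrightarrow> (models w \<psi> \<longleftrightarrow> P w []))"
proof -
  obtain k R c Init where S: "pure_sys s [] P k R c Init" using pdef_pure[OF assms] by blast
  obtain m f G code where grp: "is_groupoid m f" "G \<subseteq> {..<m}" "\<And>l. code l < m"
    "\<And>u. strip u \<noteq> [] \<Longrightarrow> map code u \<in> word_problem m f G \<longleftrightarrow> run (strip u) []"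
    using run_groupoid by metis
  define ws where "ws = widths k (c + 1)"
  define L where "L = sum_list ws"
  let ?D = "\<lambda>g w e. code (letter_at k R Init w (unpack (length w) ws (wnum w e [0..<L]))) = g"
  have L: "0 < L" by (simp add: L_def ws_def widths_def)
  have "fodef s (?D g)" for g
  proof -
    have "map length (slices ws [0..<L]) = ws" by (rule length_slices) (simp add: L_def)
    from fodef_letter_at[OF S this[unfolded ws_def], of "\<lambda>l. code l = g"] show ?thesis
      by (rule fodef_cong) (simp add: nums_slices L_def ws_def)
  qed
  then have "\<exists>\<phi>. wf s \<phi> \<and> is_fo \<phi> \<and> fvars \<phi> = {} \<and> (\<forall>w e. is_string s w \<longrightarrow> venv w e \<longrightarrow> (sat w (\<lambda>_. 0) e \<phi> \<longleftrightarrow> ?D g w e))" for g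
    unfolding fodef_def by blast
  then obtain \<phi> where \<phi>: "\<And>g. wf s (\<phi> g)" "\<And>g. is_fo (\<phi> g)" "\<And>g. fvars (\<phi> g) = {}"
    "\<And>g w e. is_string s w \<Longrightarrow> venv w e \<Longrightarrow> sat w (\<lambda>_. 0) e (\<phi> g) \<longleftrightarrow> ?D g w e" by metis
  \<comment> \<open>The formulas may mention set variables that the quantifier does not bind. Their
    value does not influence the relation, so they are renamed to a bound one, which yields a
    sentence.\<close>
  define \<sigma> where "\<sigma> v = (if v < L then v else 0)" for v
  \<comment> \<open>Exactly one code occurs at each position, so there is a formula for every code
    except the last, \<open>m - 1\<close>, which is the default letter.\<close>
  define \<phi>s where "\<phi>s = map (\<lambda>g. ren \<sigma> (\<phi> g)) [0..<m - 1]"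
  define \<psi> where "\<psi> = Qg m f G [0..<L] \<phi>s"
  have "wf s \<psi>" using grp L \<phi> by (auto simp: \<psi>_def \<phi>s_def ren_simps)
  moreover have "fvars \<psi> = {}" "\<forall>\<phi>\<in>set \<phi>s. is_fo \<phi>" using \<phi> by (auto simp: \<psi>_def \<phi>s_def ren_simps)
  moreover have "svars \<psi> = {}" using \<phi> L by (auto simp: \<psi>_def \<phi>s_def ren_simps \<sigma>_def)
  ultimately have "QGrpFO_sentence s \<psi>" by (simp add: QGrpFO_sentence_def sentence_def \<psi>_def)
  moreover have "models w \<psi> \<longleftrightarrow> P w []" if w: "is_string s w" for w
  proof -
    define e where "e i = upd_sets (\<lambda>_. {}) [0..<L] (map (asg (length w) L i) [0..<L])" for i
    let ?w = "map (letter_at k R Init w) (lexi (length w) ws)"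
    have e: "e i v = (if v < L then asg (length w) L i v else {})" for i v
    proof (cases "v < L")
      case True
      then show ?thesis using upd_sets_in[of "[0..<L]" "map (asg (length w) L i) [0..<L]" v "\<lambda>_. {}"] by (simp add: e_def)
    qed (simp add: e_def upd_sets_out)
    have "sat w (\<lambda>_. 0) (e i) (ren \<sigma> (\<phi> g)) \<longleftrightarrow> code (letter_at k R Init w (unpack (length w) ws i)) = g" if i: "i < cap w L" for i g
    proof -
      have "venv w (\<lambda>v. e i (\<sigma> v))" using asg_subset by (auto simp: venv_def e)
      moreover have me: "map (\<lambda>v. e i (\<sigma> v)) [0..<L] = map (asg (length w) L i) [0..<L]" by (auto simp: e \<sigma>_def)
      have "num (length w) (\<lambda>v. e i (\<sigma> v)) [0..<L] = i" unfolding num_def me by (rule numl_asg[OF i])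
      ultimately show ?thesis using \<phi>(4)[OF w] sat_ren[OF \<phi>(2)] by simp
    qed
    then have ft: "first_true (map (sat w (\<lambda>_. 0) (e i)) \<phi>s) = code (letter_at k R Init w (unpack (length w) ws i))"
      if "i < cap w L" for i
      using that grp(3)[of "letter_at k R Init w (unpack (length w) ws i)"] by (subst first_true_iff) (auto simp: \<phi>s_def)
    have "map (\<lambda>i. first_true (map (sat w (\<lambda>_. 0) (e i)) \<phi>s)) [0..<cap w L] =
      map (\<lambda>i. code (letter_at k R Init w (unpack (length w) ws i))) [0..<cap w L]"
      by (intro map_cong refl ft) simp
    also have "\<dots> = map code ?w" unfolding map_unpack[symmetric] L_def by (simp add: comp_def)
    finally have word: "map (\<lambda>i. first_true (map (sat w (\<lambda>_. 0) (e i)) \<phi>s)) [0..<cap w L] = map code ?w" .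
    have "models w \<psi> \<longleftrightarrow> map (\<lambda>i. first_true (map (sat w (\<lambda>_. 0) (e i)) \<phi>s)) [0..<cap w L] \<in> word_problem m f G"
      by (simp add: models_def \<psi>_def e_def)
    also have "\<dots> \<longleftrightarrow> run (strip ?w) []"
      unfolding word by (rule grp(4)) (use encoding_run(1)[OF S w] in \<open>simp add: ws_def\<close>)
    also have "\<dots> \<longleftrightarrow> P w []" using encoding_run(2)[OF S w] by (simp add: ws_def)
    finally show ?thesis .
  qed
  ultimately show ?thesis by blast
qed

lemma SOM_Grp_to_QGrpFO:
  assumes "wf s \<phi>"
  shows "\<exists>\<psi>. QGrpFO_sentence s \<psi> \<and> equiv_over s \<phi> \<psi>"
proof -
  obtain K where K: "pdef s (replicate K 1) (\<lambda>w as. sat_env \<phi> w (env w as))" using pdef_formula[OF assms] by blast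
  \<comment> \<open>All registers are guessed to be \<open>0\<close>: empty sets for the set
    variables and, through \<open>lst\<close>, position \<open>0\<close> for the first-order
    variables, as in \<open>models\<close>.\<close>
  have "fr2 s [] (replicate K 1) (\<lambda>w as bs. \<forall>i<K. bs ! i = 0)"
    unfolding fr2_def
  proof (intro allI impI fodef_all_less)
    fix vs vs' :: "nat list list" and i assume "map length vs' = replicate K 1" "i < K"
    moreover from this have "length vs' = K" by (metis length_map length_replicate)
    ultimately show "fodef s (\<lambda>w e. nums w e vs' ! i = 0)" by (simp add: fod)
  qed
  from pdef_ex[OF this K] have "pdef s [] (\<lambda>w as. sat_env \<phi> w (\<lambda>_. {}))"
  proof (rule pdef_cong)
    fix w
    have env: "env w bs = (\<lambda>_. {})" if "okr w (replicate K 1) bs" "\<forall>i<K. bs ! i = 0" for bs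
      using that by (auto simp: env_def okr_def dset_def asg_def fun_eq_iff)
    have "okr w (replicate K 1) (replicate K 0)" by (simp add: okr_def)
    then show "sat_env \<phi> w (\<lambda>_. {}) \<longleftrightarrow> (\<exists>bs. okr w (replicate K 1) bs \<and> (\<forall>i<K. bs ! i = 0) \<and> sat_env \<phi> w (env w bs))"
      using env by (metis nth_replicate)
  qed
  from pdef_to_QGrpFO[OF this] show ?thesis
    by (auto simp: equiv_over_def models_def sat_env_def lst_def)
qed

theorem theorem3p3:
  fixes s :: nat
  shows "(\<forall>\<phi>. SOM_Grp_sentence s \<phi> \<longrightarrow> (\<exists>\<psi>. QGrpFO_sentence s \<psi> \<and> equiv_over s \<phi> \<psi>))
       \<and> (\<forall>\<psi>. QGrpFO_sentence s \<psi> \<longrightarrow> (\<exists>\<phi>. SOM_Grp_sentence s \<phi> \<and> equiv_over s \<psi> \<phi>))"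
proof (intro conjI allI impI)
  fix \<phi> assume "SOM_Grp_sentence s \<phi>"
  then show "\<exists>\<psi>. QGrpFO_sentence s \<psi> \<and> equiv_over s \<phi> \<psi>"
    by (intro SOM_Grp_to_QGrpFO) (simp add: SOM_Grp_sentence_def)
next
  fix \<psi> assume "QGrpFO_sentence s \<psi>"
  then show "\<exists>\<phi>. SOM_Grp_sentence s \<phi> \<and> equiv_over s \<psi> \<phi>"
    by (intro exI[of _ \<psi>]) (simp add: QGrpFO_sentence_def SOM_Grp_sentence_def equiv_over_def)
qed

end
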